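(* Consider the uncertain system $\dot x=f(x)+\Delta f(x)+g(x)u$, $x(0)=x_0$, $y=h(x)$, with state $x\in\mathbb{R}^n$, input $u\in\mathbb{R}^p$, controlled output $y\in\mathbb{R}^m$, $p\ge m$, where $\Delta f$ is a vector field representing additive model uncertainties. Let $X\subset\mathbb{R}^n$ be a bounded set. Assume: (1) $f$ and the columns of $g$ are $C^\infty$ vector fields on $X$, $h$ is $C^\infty$ on $X$, and $\Delta f$ is $C^1$ on $X$. (2) The system has a well-defined vector relative degree $\{r_1,\dots,r_m\}$ at each point of $X$, and it is linearizable, i.e. $\sum_{i=1}^m r_i=n$. (3) The desired output trajectories $y_{id}$ ($1\le i\le m$) are smooth functions of time, relating desired initial points $y_{id}(0)$ at $t=0$ to desired final points $y_{id}(t_f)$ at $t=t_f$. (4) The additive uncertainty $\Delta f$ appears as an additive uncertainty $\Delta b$ in the input-output linearized model, that is, $$y^{(r)}(t)=b(\xi(t))+A(\xi(t))u(t)+\Delta b(\xi(t)),$$ where $\Delta b$ is $C^1$ on $\tilde X$ (the notation $y^{(r)},\xi,b,A,\tilde X$ is defined in the context). (5) There is a non-empty set $\mathcal{A}$ of gains such that, for $K^i_j\in\mathcal{A}$ ($1\le i\le m$, $1\le j\le r_i$), the polynomials $s^{r_i}+K^i_{r_i}s^{r_i-1}+\dots+K^i_2s+K^i_1$ are Hurwitz; the gains $K^i_j$ used below are chosen in this way. Assume moreover that $\Delta b$ satisfies $$\|\Delta b(\xi(t))\|\le\|\Delta\|\,\|L(\xi)\|,$$ where $\Delta\in\mathbb{R}^{m\times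 m}$ is an unknown constant matrix and $L(\xi)$ is a known bounded function of the state $\xi$. Let $\widehat\Delta(t)\in\mathbb{R}^{m\times m}$ be a (possibly time-varying) estimate of $\Delta$, let $e_\Delta(t)=\Delta-\widehat\Delta(t)$, and apply the feedback controller $u=u_n+u_r$, where $$u_n=A^{-1}(\xi)\,[v_s(t,\xi)-b(\xi)],\qquad v_{si}=y_{id}^{(r_i)}-\sum_{j=1}^{r_i}K^i_j\bigl(y_i^{(j-1)}-y_{id}^{(j-1)}\bigr)\quad(1\le i\le m),$$ $$u_r=-A^{-1}(\xi)\,\tilde B^TPz\,\|L(\xi)\|^2-A^{-1}(\xi)\,\|\widehat\Delta(t)\|\,\|L(\xi)\|\,\mathrm{sign}(\tilde B^TPz),$$ with $v_s=[v_{s1},\dots,v_{sm}]^T$ and $z,\tilde B,P$ as defined in the context. Then the closed-loop error dynamics, written in the form $\dot z=F(t,z,e_\Delta)$, is input-to-state stable (ISS) from the estimation error input $e_\Delta(t)\in\mathbb{R}^{m\times m}$ to the tracking error state $z(t)\in\mathbb{R}^n$. That is, there exist a class $\mathcal{KL}$ function $\beta$ and a class $\mathcal{K}$ function $\gamma$ such that, for any initial state $z(t_0)$ and any bounded input $e_\Delta(t)$, the solution $z(t)$ exists for all $t\ge t_0$ and satisfies $$\|z(t)\|\le\beta(\|z(t_0)\|,t-t_0)+\gamma\Bigl(\sup_{t_0\le\tau\le t}\|e_\Delta(\tau)\|\Bigr).$$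
   Context: Norm and sign: $\|\cdot\|$ is the Euclidean norm on vectors; the same symbol is used for the norm of $m\times m$ matrices. For $w\in\mathbb{R}^m$, $\mathrm{sign}(w)=[\mathrm{sign}(w_1),\dots,\mathrm{sign}(w_m)]^T$, with $\mathrm{sign}(s)=1,0,-1$ for $s>0$, $s=0$, $s<0$ respectively. Linearized model: $y^{(r)}=[y_1^{(r_1)},\dots,y_m^{(r_m)}]^T$, $\xi=[\xi^1,\dots,\xi^m]^T$, $\xi^i=[y_i,\dot y_i,\dots,y_i^{(r_i-1)}]$. In the nominal case $\Delta f=0$, the relative degree assumption (2) lets the system be written as $y^{(r)}(t)=b(\xi(t))+A(\xi(t))u(t)$, where $b$ and $A$ are expressed through $f,g,h$, and $A(\xi)$ is non-singular on $\tilde X$, the image of $X$ under the diffeomorphism $x\mapsto\xi$ between the states of the original system and of the linearized model. Error state: $e_i(t)=y_i(t)-y_{id}(t)$, $z^i=[e_i,\dot e_i,\dots,e_i^{(r_i-1)}]$, $z=[z^1,\dots,z^m]^T\in\mathbb{R}^n$. Matrices: $\tilde A=\mathrm{diag}\{\tilde A_1,\dots,\tilde A_m\}\in\mathbb{R}^{n\times n}$, where $\tilde A_i$ is the $r_i\times r_i$ companion matrix with ones on the superdiagonal, last row $(-K^i_1,-K^i_2,\dots,-K^i_{r_i})$, and zeros elsewhere. $\tilde B\in\mathbb{R}^{n\times m}$ is the vertical stack of blocks $\tilde B_1,\dots,\tilde B_m$, where $\tilde B_i\in\mathbb{R}^{r_i\times m}$ has entry $1$ at position $(r_i,i)$ and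 zeros elsewhere. By the choice of gains $\tilde A$ is Hurwitz, and $P>0$ is the positive definite solution of $\tilde A^TP+P\tilde A=-I$. Closed-loop error dynamics: under $u=u_n+u_r$ one has $\dot z=\tilde Az+\tilde B\delta$ with $$\delta=A(\xi)u_r+\Delta b(\xi)=-\tilde B^TPz\,\|L(\xi)\|^2-\|\widehat\Delta(t)\|\,\|L(\xi)\|\,\mathrm{sign}(\tilde B^TPz)+\Delta b(\xi);$$ this is the system written $\dot z=F(t,z,e_\Delta)$, with input $e_\Delta$ and state $z$. Inputs and comparison functions: inputs are piecewise continuous, bounded functions of $t\ge0$. A continuous function $\alpha:[0,a)\to[0,\infty)$ is of class $\mathcal{K}$ if it is strictly increasing and $\alpha(0)=0$. A continuous function $\beta:[0,a)\times[0,\infty)\to[0,\infty)$ is of class $\mathcal{KL}$ if, for each fixed $s$, $\beta(\cdot,s)$ is of class $\mathcal{K}$ and, for each fixed $r$, $\beta(r,\cdot)$ is decreasing with $\beta(r,s)\to0$ as $s\to\infty$. *)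

theory Defs
  imports
    "HOL-Analysis.Analysis"
    "HOL-Computational_Algebra.Polynomial"
    "HOL-Library.Extended_Nat"
begin

section \<open>Differentiability classes\<close>

text \<open>\<open>Ck_open k f U\<close> is meant for open \<open>U\<close>: all partial derivatives up to order \<open>k\<close> exist and
  are continuous on \<open>U\<close>.\<close>

fun Ck_open :: "nat \<Rightarrow> ('a::euclidean_space \<Rightarrow> 'b::real_normed_vector) \<Rightarrow> 'a set \<Rightarrow> bool" where
  "Ck_open 0 f U \<longleftrightarrow> continuous_on U f"
| "Ck_open (Suc k) f U \<longleftrightarrow> (\<forall>x\<in>U. f differentiable (at x)) \<and>
     (\<forall>i\<in>Basis. Ck_open k (\<lambda>x. frechet_derivative f (at x) i) U)"

text \<open>For a set \<open>S\<close> that need not be open there are two versions. \<open>C_around\<close> makes the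
  derivatives of \<open>f\<close> itself meaningful at the points of \<open>S\<close>; \<open>C_on\<close> only concerns the values of
  \<open>f\<close> on \<open>S\<close> and leaves those outside \<open>S\<close> arbitrary.\<close>

definition C_around :: "enat \<Rightarrow> ('a::euclidean_space \<Rightarrow> 'b::real_normed_vector) \<Rightarrow> 'a set \<Rightarrow> bool" where
  "C_around n f S \<longleftrightarrow> (\<exists>U. open U \<and> S \<subseteq> U \<and> (\<forall>k. enat k \<le> n \<longrightarrow> Ck_open k f U))"

definition C_on :: "enat \<Rightarrow> ('a::euclidean_space \<Rightarrow> 'b::real_normed_vector) \<Rightarrow> 'a set \<Rightarrow> bool" where
  "C_on n f S \<longleftrightarrow> (\<exists>\<psi>. C_around n \<psi> S \<and> (\<forall>x\<in>S. \<psi> x = f x))"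

definition diffeomorphism_on :: "'a::euclidean_space set \<Rightarrow> ('a \<Rightarrow> 'b::euclidean_space) \<Rightarrow> bool" where
  "diffeomorphism_on S \<Phi> \<longleftrightarrow> inj_on \<Phi> S \<and> C_on \<infinity> \<Phi> S \<and> C_on \<infinity> (inv_into S \<Phi>) (\<Phi> ` S)"

section \<open>The plant and its linearized model\<close>

text \<open>\<open>lie f \<phi>\<close> is the Lie derivative of the scalar function \<open>\<phi>\<close> along the vector field \<open>f\<close>.\<close>

definition lie :: "('a::euclidean_space \<Rightarrow> 'a) \<Rightarrow> ('a \<Rightarrow> real) \<Rightarrow> 'a \<Rightarrow> real" where
  "lie f \<phi> x = frechet_derivative \<phi> (at x) (f x)"

definition decoupling_matrix ::
  "(real^'n \<Rightarrow> real^'n) \<Rightarrow> (real^'n \<Rightarrow> real^'p^'n) \<Rightarrow> (real^'n \<Rightarrow> real^'m) \<Rightarrow> ('m \<Rightarrow> nat) \<Rightarrow>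
    real^'n \<Rightarrow> real^'p^'m" where
  "decoupling_matrix f g h r x =
     (\<chi> i j. lie (\<lambda>x. column j (g x)) ((lie f ^^ (r i - 1)) (\<lambda>x. h x $ i)) x)"

text \<open>With \<open>p \<ge> m\<close> inputs, non-singularity of the \<open>m \<times> p\<close> decoupling matrix means full row rank.\<close>

definition vector_relative_degree ::
  "(real^'n \<Rightarrow> real^'n) \<Rightarrow> (real^'n \<Rightarrow> real^'p^'n) \<Rightarrow> (real^'n \<Rightarrow> real^'m) \<Rightarrow> ('m \<Rightarrow> nat) \<Rightarrow>
    real^'n \<Rightarrow> bool" where
  "vector_relative_degree f g h r x0 \<longleftrightarrow>
     (\<forall>i. 1 \<le> r i) \<and>
     (\<forall>i j k. k + 1 < r i \<longrightarrow>
        (\<forall>\<^sub>F x in nhds x0. lie (\<lambda>x. column j (g x)) ((lie f ^^ k) (\<lambda>x. h x $ i)) x = 0)) \<and>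
     rank (decoupling_matrix f g h r x0) = CARD('m)"

text \<open>The state \<open>\<xi> = [\<xi>\<^sup>1,\<dots>,\<xi>\<^sup>m]\<close>, whose block \<open>\<xi>\<^sup>i\<close> has \<open>r i\<close> entries, is a vector of type
  \<open>real^'n\<close>. A labelling says which coordinate is which: coordinate \<open>k\<close> is the entry number
  \<open>off k\<close> (counted from 1) of the block number \<open>blk k\<close>.\<close>

definition block_labelling :: "('m \<Rightarrow> nat) \<Rightarrow> ('n \<Rightarrow> 'm) \<Rightarrow> ('n \<Rightarrow> nat) \<Rightarrow> bool" where
  "block_labelling r blk off \<longleftrightarrow>
     bij_betw (\<lambda>k. (blk k, off k)) UNIV {(i, j). 1 \<le> j \<and> j \<le> r i}"

definition linearizing_coords ::
  "(real^'n \<Rightarrow> real^'n) \<Rightarrow> (real^'n \<Rightarrow> real^'m) \<Rightarrow> ('n \<Rightarrow> 'm) \<Rightarrow> ('n \<Rightarrow> nat) \<Rightarrow> real^'n \<Rightarrow> real^'n" where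
  "linearizing_coords f h blk off x = (\<chi> k. (lie f ^^ (off k - 1)) (\<lambda>x. h x $ blk k) x)"

text \<open>The functions \<open>b\<close> and \<open>A\<close> of the nominal model \<open>y\<^sup>(\<^sup>r\<^sup>) = b(\<xi>) + A(\<xi>) u\<close>; they are
  meaningful for \<open>\<xi> \<in> \<Phi> ` X\<close>.\<close>

definition model_b ::
  "(real^'n \<Rightarrow> real^'n) \<Rightarrow> (real^'n \<Rightarrow> real^'m) \<Rightarrow> ('m \<Rightarrow> nat) \<Rightarrow>
    (real^'n) set \<Rightarrow> (real^'n \<Rightarrow> real^'n) \<Rightarrow> real^'n \<Rightarrow> real^'m" where
  "model_b f h r X \<Phi> \<xi> = (\<chi> i. (lie f ^^ r i) (\<lambda>x. h x $ i) (inv_into X \<Phi> \<xi>))"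

definition model_A ::
  "(real^'n \<Rightarrow> real^'n) \<Rightarrow> (real^'n \<Rightarrow> real^'p^'n) \<Rightarrow> (real^'n \<Rightarrow> real^'m) \<Rightarrow> ('m \<Rightarrow> nat) \<Rightarrow>
    (real^'n) set \<Rightarrow> (real^'n \<Rightarrow> real^'n) \<Rightarrow> real^'n \<Rightarrow> real^'p^'m" where
  "model_A f g h r X \<Phi> \<xi> = decoupling_matrix f g h r (inv_into X \<Phi> \<xi>)"

definition plant_motion ::
  "(real^'n \<Rightarrow> real^'n) \<Rightarrow> (real^'n \<Rightarrow> real^'n) \<Rightarrow> (real^'n \<Rightarrow> real^'p^'n) \<Rightarrow> (real^'n) set \<Rightarrow>
    real set \<Rightarrow> (real \<Rightarrow> real^'n) \<Rightarrow> (real \<Rightarrow> real^'p) \<Rightarrow> bool" where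
  "plant_motion f \<Delta>f g X I x u \<longleftrightarrow>
     (\<forall>t\<in>I. x t \<in> X \<and>
        (x has_vector_derivative f (x t) + \<Delta>f (x t) + g (x t) *v u t) (at t))"

text \<open>Along every motion of the uncertain plant in \<open>X\<close> the vector \<open>\<xi>(t) = \<Phi>(x(t))\<close> consists of the
  outputs and their derivatives, and \<open>y\<^sup>(\<^sup>r\<^sup>) = b(\<xi>) + A(\<xi>) u + \<Delta>b(\<xi>)\<close>.\<close>

definition uncertain_linearized_model ::
  "(real^'n \<Rightarrow> real^'n) \<Rightarrow> (real^'n \<Rightarrow> real^'n) \<Rightarrow> (real^'n \<Rightarrow> real^'p^'n) \<Rightarrow> (real^'n \<Rightarrow> real^'m) \<Rightarrow>
    (real^'n) set \<Rightarrow> ('m \<Rightarrow> nat) \<Rightarrow> ('n \<Rightarrow> 'm) \<Rightarrow> ('n \<Rightarrow> nat) \<Rightarrow> (real^'n \<Rightarrow> real^'n) \<Rightarrow>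
    (real^'n \<Rightarrow> real^'m) \<Rightarrow> (real^'n \<Rightarrow> real^'p^'m) \<Rightarrow> (real^'n \<Rightarrow> real^'m) \<Rightarrow> bool" where
  "uncertain_linearized_model f \<Delta>f g h X r blk off \<Phi> b A \<Delta>b \<longleftrightarrow>
     (\<forall>I x u. open I \<longrightarrow> plant_motion f \<Delta>f g X I x u \<longrightarrow>
        (\<forall>t\<in>I.
           (\<forall>k. (deriv ^^ (off k - 1)) (\<lambda>s. h (x s) $ blk k) t = \<Phi> (x t) $ k) \<and>
           (\<forall>i. ((deriv ^^ (r i - 1)) (\<lambda>s. h (x s) $ i) has_real_derivative
                  (b (\<Phi> (x t)) + A (\<Phi> (x t)) *v u t + \<Delta>b (\<Phi> (x t))) $ i) (at t))))"

section \<open>Error system and controller\<close>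

definition hurwitz_poly :: "complex poly \<Rightarrow> bool" where
  "hurwitz_poly q \<longleftrightarrow> (\<forall>s. poly q s = 0 \<longrightarrow> Re s < 0)"

definition gain_poly :: "(nat \<Rightarrow> real) \<Rightarrow> nat \<Rightarrow> complex poly" where
  "gain_poly \<kappa> d = monom 1 d + (\<Sum>j=1..d. monom (complex_of_real (\<kappa> j)) (j - 1))"

text \<open>\<open>[y\<^sub>i\<^sub>d, y\<^sub>i\<^sub>d', \<dots>]\<close> stacked over the blocks, i.e. the desired value of \<open>\<xi>\<close>.\<close>

definition desired_state ::
  "('n \<Rightarrow> 'm) \<Rightarrow> ('n \<Rightarrow> nat) \<Rightarrow> ('m \<Rightarrow> real \<Rightarrow> real) \<Rightarrow> real \<Rightarrow> real^'n" where
  "desired_state blk off yd t = (\<chi> k. (deriv ^^ (off k - 1)) (yd (blk k)) t)"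

definition A_tilde ::
  "('m \<Rightarrow> nat) \<Rightarrow> ('n \<Rightarrow> 'm) \<Rightarrow> ('n \<Rightarrow> nat) \<Rightarrow> ('m \<Rightarrow> nat \<Rightarrow> real) \<Rightarrow> real^'n^'n" where
  "A_tilde r blk off K = (\<chi> k l.
     if blk k \<noteq> blk l then 0
     else if off k = r (blk k) then - K (blk k) (off l)
     else if off l = off k + 1 then 1 else 0)"

definition B_tilde :: "('m \<Rightarrow> nat) \<Rightarrow> ('n \<Rightarrow> 'm) \<Rightarrow> ('n \<Rightarrow> nat) \<Rightarrow> real^'m^'n" where
  "B_tilde r blk off = (\<chi> k i. if blk k = i \<and> off k = r i then 1 else 0)"

definition sign_vec :: "real^'m \<Rightarrow> real^'m" where
  "sign_vec w = (\<chi> i. sgn (w $ i))"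

definition v_s ::
  "('m \<Rightarrow> nat) \<Rightarrow> ('n::finite \<Rightarrow> 'm) \<Rightarrow> ('n \<Rightarrow> nat) \<Rightarrow> ('m \<Rightarrow> nat \<Rightarrow> real) \<Rightarrow>
    ('m \<Rightarrow> real \<Rightarrow> real) \<Rightarrow> real \<Rightarrow> real^'n \<Rightarrow> real^'m" where
  "v_s r blk off K yd t \<xi> = (\<chi> i. (deriv ^^ r i) (yd i) t -
     (\<Sum>k | blk k = i. K i (off k) * (\<xi> $ k - desired_state blk off yd t $ k)))"

text \<open>The controller \<open>u = u\<^sub>n + u\<^sub>r\<close> as a function of \<open>t\<close>, \<open>\<xi>\<close> and the current estimate \<open>D\<close>
  of \<open>\<Delta>\<close>. \<open>N\<close> is the matrix norm and \<open>Ai\<close> stands for the (right) inverse of \<open>A\<close>.\<close>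

definition controller ::
  "('m \<Rightarrow> nat) \<Rightarrow> ('n \<Rightarrow> 'm) \<Rightarrow> ('n \<Rightarrow> nat) \<Rightarrow> ('m \<Rightarrow> nat \<Rightarrow> real) \<Rightarrow> ('m \<Rightarrow> real \<Rightarrow> real) \<Rightarrow>
    real^'n^'n \<Rightarrow> (real^'m^'m \<Rightarrow> real) \<Rightarrow> (real^'n \<Rightarrow> 'l::real_normed_vector) \<Rightarrow>
    (real^'n \<Rightarrow> real^'m) \<Rightarrow> (real^'n \<Rightarrow> real^'m^'p) \<Rightarrow> real \<Rightarrow> real^'n \<Rightarrow> real^'m^'m \<Rightarrow> real^'p" where
  "controller r blk off K yd P N L b Ai t \<xi> D =
     (let z = \<xi> - desired_state blk off yd t;
          w = transpose (B_tilde r blk off) *v (P *v z);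
          u_n = Ai \<xi> *v (v_s r blk off K yd t \<xi> - b \<xi>);
          u_r = - (Ai \<xi> *v ((norm (L \<xi>))\<^sup>2 *\<^sub>R w)) - Ai \<xi> *v ((N D * norm (L \<xi>)) *\<^sub>R sign_vec w)
      in u_n + u_r)"

text \<open>The right-hand side \<open>F(t,z,e)\<close> of the closed-loop error dynamics, with
  \<open>\<xi>\<close> recovered from \<open>z\<close> and the estimate of \<open>\<Delta>\<close> from the estimation error \<open>e\<close>. It is defined for
  all \<open>z\<close>: \<open>L\<close> and \<open>\<Delta>b\<close> are total functions, with arbitrary values off the image of the plant.\<close>

definition error_field ::
  "('m \<Rightarrow> nat) \<Rightarrow> ('n \<Rightarrow> 'm) \<Rightarrow> ('n \<Rightarrow> nat) \<Rightarrow> ('m \<Rightarrow> nat \<Rightarrow> real) \<Rightarrow> ('m \<Rightarrow> real \<Rightarrow> real) \<Rightarrow>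
    real^'n^'n \<Rightarrow> (real^'m^'m \<Rightarrow> real) \<Rightarrow> (real^'n \<Rightarrow> 'l::real_normed_vector) \<Rightarrow>
    (real^'n \<Rightarrow> real^'m) \<Rightarrow> real^'m^'m \<Rightarrow> real \<Rightarrow> real^'n \<Rightarrow> real^'m^'m \<Rightarrow> real^'n" where
  "error_field r blk off K yd P N L \<Delta>b \<Delta> t z e =
     (let \<xi> = z + desired_state blk off yd t;
          w = transpose (B_tilde r blk off) *v (P *v z);
          \<delta> = - ((norm (L \<xi>))\<^sup>2 *\<^sub>R w) - (N (\<Delta> - e) * norm (L \<xi>)) *\<^sub>R sign_vec w + \<Delta>b \<xi>
      in A_tilde r blk off K *v z + B_tilde r blk off *v \<delta>)"

section \<open>Solutions of discontinuous differential equations\<close>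

definition filippov_set :: "('a::euclidean_space \<Rightarrow> 'a) \<Rightarrow> 'a \<Rightarrow> 'a set" where
  "filippov_set G z =
     (\<Inter>\<epsilon>\<in>{0<..}. \<Inter>M\<in>null_sets lebesgue. closure (convex hull (G ` (ball z \<epsilon> - M))))"

text \<open>\<open>z\<close> is (locally) absolutely continuous on the interval \<open>I\<close> with left end point \<open>t0\<close>, and
  \<open>z'(t) \<in> S t (z t)\<close> for almost all \<open>t\<close>; \<open>v\<close> is the derivative of \<open>z\<close>.\<close>

definition inclusion_solution ::
  "(real \<Rightarrow> 'a::euclidean_space \<Rightarrow> 'a set) \<Rightarrow> real \<Rightarrow> real set \<Rightarrow> (real \<Rightarrow> 'a) \<Rightarrow> bool" where
  "inclusion_solution S t0 I z \<longleftrightarrow> (\<exists>v.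
     (\<forall>t\<in>I. v absolutely_integrable_on {t0..t} \<and> z t = z t0 + integral {t0..t} v) \<and>
     (AE t in lebesgue. t \<in> I \<longrightarrow> v t \<in> S t (z t)))"

definition filippov_solution ::
  "(real \<Rightarrow> 'a::euclidean_space \<Rightarrow> 'a) \<Rightarrow> real \<Rightarrow> real set \<Rightarrow> (real \<Rightarrow> 'a) \<Rightarrow> bool" where
  "filippov_solution G = inclusion_solution (\<lambda>t. filippov_set (G t))"

definition caratheodory_solution ::
  "(real \<Rightarrow> 'a::euclidean_space \<Rightarrow> 'a) \<Rightarrow> real \<Rightarrow> real set \<Rightarrow> (real \<Rightarrow> 'a) \<Rightarrow> bool" where
  "caratheodory_solution G = inclusion_solution (\<lambda>t z. {G t z})"

section \<open>Input-to-state stability\<close>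

text \<open>Comparison functions on the whole of \<open>[0, \<infinity>)\<close>, as they are evaluated at arbitrary states
  and inputs. For \<open>r = 0\<close> a class \<open>\<K>\<L>\<close> function vanishes identically in \<open>s\<close>, so monotonicity in
  \<open>s\<close> is non-strict.\<close>

definition class_K :: "(real \<Rightarrow> real) \<Rightarrow> bool" where
  "class_K \<alpha> \<longleftrightarrow> continuous_on {0..} \<alpha> \<and> strict_mono_on {0..} \<alpha> \<and> \<alpha> 0 = 0"

definition class_KL :: "(real \<Rightarrow> real \<Rightarrow> real) \<Rightarrow> bool" where
  "class_KL \<beta> \<longleftrightarrow> continuous_on ({0..} \<times> {0..}) (\<lambda>(r, s). \<beta> r s) \<and>
     (\<forall>s\<ge>0. class_K (\<lambda>r. \<beta> r s)) \<and>
     (\<forall>r\<ge>0. antimono_on {0..} (\<beta> r) \<and> (\<beta> r \<longlongrightarrow> 0) at_top)"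

definition piecewise_continuous :: "(real \<Rightarrow> 'e::topological_space) \<Rightarrow> bool" where
  "piecewise_continuous e \<longleftrightarrow>
     (\<forall>T. finite {t \<in> {0..T}. \<not> continuous (at t within {0..}) e}) \<and>
     (\<forall>t\<ge>0. \<exists>l. (e \<longlongrightarrow> l) (at_right t)) \<and>
     (\<forall>t>0. \<exists>l. (e \<longlongrightarrow> l) (at_left t))"

definition is_norm :: "('e::real_vector \<Rightarrow> real) \<Rightarrow> bool" where
  "is_norm N \<longleftrightarrow> (\<forall>x. N x = 0 \<longleftrightarrow> x = 0) \<and> (\<forall>c x. N (c *\<^sub>R x) = \<bar>c\<bar> * N x) \<and>
     (\<forall>x y. N (x + y) \<le> N x + N y)"

text \<open>Input-to-state stability of \<open>z' = F(t,z,e)\<close>, the size of the input being measured by the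
  norm \<open>N\<close>. As \<open>F\<close> may be discontinuous in \<open>z\<close>, solutions are taken in the sense of Filippov and
  need not be unique: from every initial state there is a solution on \<open>[t0, \<infinity>)\<close>, no solution
  ends at a finite time, and the estimate holds for all Filippov and all Caratheodory
  solutions, on whatever interval \<open>[t0, T]\<close> they are defined.\<close>

definition input_to_state_stable ::
  "(real \<Rightarrow> 'a::euclidean_space \<Rightarrow> 'e::real_normed_vector \<Rightarrow> 'a) \<Rightarrow> ('e \<Rightarrow> real) \<Rightarrow> bool" where
  "input_to_state_stable F N \<longleftrightarrow> (\<exists>\<beta> \<gamma>. class_KL \<beta> \<and> class_K \<gamma> \<and>
     (\<forall>t0 e. 0 \<le> t0 \<longrightarrow> piecewise_continuous e \<longrightarrow> bounded (e ` {0..}) \<longrightarrow>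
        (\<forall>z0. \<exists>z. z t0 = z0 \<and> filippov_solution (\<lambda>t z. F t z (e t)) t0 {t0..} z) \<and>
        (\<forall>T>t0. \<forall>z. filippov_solution (\<lambda>t z. F t z (e t)) t0 {t0..<T} z \<longrightarrow>
           (\<exists>z'. (\<forall>t\<in>{t0..<T}. z' t = z t) \<and>
              filippov_solution (\<lambda>t z. F t z (e t)) t0 {t0..} z')) \<and>
        (\<forall>T\<ge>t0. \<forall>z.
           filippov_solution (\<lambda>t z. F t z (e t)) t0 {t0..T} z \<or>
           caratheodory_solution (\<lambda>t z. F t z (e t)) t0 {t0..T} z \<longrightarrow>
           (\<forall>t\<in>{t0..T}.
              norm (z t) \<le> \<beta> (norm (z t0)) (t - t0) + \<gamma> (SUP \<tau>\<in>{t0..t}. N (e \<tau>))))))"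

end

theory Submission
  imports
    Defs
    "HOL-Complex_Analysis.Great_Picard"
    "HOL-Real_Asymp.Real_Asymp"
begin

text \<open>
  Let \<open>V z = z \<bullet> P z\<close>, \<open>w = B\<^sup>T P z\<close> and \<open>l = \<parallel>L \<xi>\<parallel>\<close>. The Lyapunov equation gives \<open>V' = - \<parallel>z\<parallel>\<^sup>2 + 2 w \<bullet> \<delta>\<close>.
  The sign term of the controller compensates the part \<open>N (\<Delta> - e) l\<close> of the bound
  \<open>N \<Delta> l \<le> N (\<Delta> - e) l + N e l\<close> on \<open>\<Delta>b\<close>, since \<open>\<parallel>w\<parallel> \<le> w \<bullet> sign w\<close>; what remains is
  \<open>w \<bullet> \<delta> \<le> - l\<^sup>2 \<parallel>w\<parallel>\<^sup>2 + l \<parallel>w\<parallel> N e \<le> (N e)\<^sup>2 / 4\<close>. The resulting bound \<open>V' \<le> - \<parallel>z\<parallel>\<^sup>2 + (N e)\<^sup>2 / 2\<close>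
  survives the passage to Filippov's convex hull because it is a half-space condition on the velocity,
  and integrating it gives an exponentially decaying \<open>\<beta>\<close> and a linear \<open>\<gamma>\<close>.

  Global existence is the harder half, because \<open>L\<close> and \<open>\<Delta>b\<close> are arbitrary, possibly non-measurable
  functions. They are approximated by Borel functions that are close to them on sets of full outer
  measure, which is all that Filippov's regularization sees.
\<close>

section \<open>Measurable approximation and convergent mixtures\<close>

text \<open>Existence is proved for fields of the form \<open>\<Psi> t z (H (z + d t))\<close>:
  \<open>\<Psi>\<close> and \<open>d\<close> are Borel, and the arbitrary functions sit in the
  time-independent map \<open>H\<close>, the pair of \<open>norm (L \<xi>)\<close> and
  \<open>\<Delta>b \<xi>\<close>. One Borel approximation of \<open>H\<close> in the variable \<xi>
  therefore serves all times and keeps the approximating fields jointly measurable. What the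
  approximation guarantees is that a Borel set on which, up to a null set, it is far from
  \<open>H\<close> must be null. So its averages over balls stay near every closed convex set that
  contains the true values off a null set.

  Velocities of approximate solutions have no pointwise limit in general. Convex mixtures restore
  one, and the convexity built into Filippov sets makes mixing harmless.

  Solutions are only absolutely continuous. The chain rule for \<open>V\<close> is replaced by the
  exact identity for \<open>V t - V s\<close> as a product of \<open>z t + z s\<close> and
  \<open>z t - z s\<close>, used on short steps. Solutions need not be unique either, so a solution
  is continued past its end by gluing another one to it; the stability estimate bounds the velocity
  up to the end point.\<close>

lemma (in sigma_finite_measure) measurable_hull:
  assumes "E \<subseteq> space M"
  obtains A where "A \<in> sets M" "E \<subseteq> A"
    "\<And>B N. B \<in> sets M \<Longrightarrow> N \<in> null_sets M \<Longrightarrow> E \<inter> B \<subseteq> N \<Longrightarrow> A \<inter> B \<in> null_sets M"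
proof -
  \<comment> \<open>A positive integrable density replaces \<open>M\<close> by a finite measure with
    the same null sets, so that the infimum below is finite and measures can be subtracted.\<close>
  obtain h where h[measurable]: "h \<in> borel_measurable M" and "integral\<^sup>N M h \<noteq> \<infinity>"
    and hpos: "\<And>x. x \<in> space M \<Longrightarrow> 0 < h x"
    using Ex_finite_integrable_function by blast
  define \<mu> where "\<mu> = density M h"
  have sets_mu: "sets \<mu> = sets M" and space_mu: "space \<mu> = space M"
    by (auto simp: \<mu>_def)
  have "emeasure \<mu> (space \<mu>) = integral\<^sup>N M h"
    unfolding \<mu>_def by (subst emeasure_density) (auto intro!: nn_integral_cong)
  with \<open>integral\<^sup>N M h \<noteq> \<infinity>\<close> interpret \<mu>: finite_measure \<mu>
    by (intro finite_measureI) auto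
  define \<A> where "\<A> = {A \<in> sets M. E \<subseteq> A}"
  have "space M \<in> \<A>" using assms by (auto simp: \<A>_def)
  define c where "c = Inf (measure \<mu> ` \<A>)"
  have bdd: "bdd_below (measure \<mu> ` \<A>)" by (intro bdd_belowI[of _ 0]) auto
  have "\<exists>A\<in>\<A>. measure \<mu> A < c + 1 / Suc n" for n
  proof -
    have "Inf (measure \<mu> ` \<A>) < c + 1 / Suc n" by (simp add: c_def)
    then show ?thesis
      using \<open>space M \<in> \<A>\<close> bdd by (subst (asm) cInf_less_iff) auto
  qed
  then obtain F where F: "\<And>n. F n \<in> \<A>" "\<And>n. measure \<mu> (F n) < c + 1 / Suc n"
    by metis
  \<comment> \<open>The intersection of near-minimizers is still a measurable superset of
    \<open>E\<close> and attains the infimum \<open>c\<close>.\<close>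
  define A where "A = (\<Inter>n. F n)"
  have A: "A \<in> sets M" "E \<subseteq> A"
    using F(1) by (auto simp: A_def \<A>_def)
  have "measure \<mu> A \<le> c"
  proof (rule field_le_epsilon)
    fix e :: real assume "0 < e"
    then obtain n where "1 / Suc n < e" using nat_approx_posE by blast
    have "measure \<mu> A \<le> measure \<mu> (F n)"
      using F(1)[of n] by (intro \<mu>.finite_measure_mono) (auto simp: A_def \<A>_def sets_mu)
    with F(2)[of n] \<open>1 / Suc n < e\<close> show "measure \<mu> A \<le> c + e" by linarith
  qed
  show ?thesis
  proof (rule that[OF A])
    fix B N assume B: "B \<in> sets M" and N: "N \<in> null_sets M" and sub: "E \<inter> B \<subseteq> N"
    \<comment> \<open>\<open>E\<close> misses \<open>?D\<close>, so \<open>A - ?D\<close> competes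
      in the infimum; with \<open>?D\<close> of positive measure it would fall below
      \<open>c\<close>.\<close>
    let ?D = "A \<inter> (B - N)"
    have D: "?D \<in> sets M" using A B N by auto
    have "A - ?D \<in> \<A>" using A D sub by (auto simp: \<A>_def)
    then have "c \<le> measure \<mu> (A - ?D)"
      unfolding c_def by (intro cInf_lower bdd) auto
    also have "\<dots> = measure \<mu> A - measure \<mu> ?D"
      using A D by (intro \<mu>.finite_measure_Diff) (auto simp: sets_mu)
    finally have "measure \<mu> ?D = 0"
      using \<open>measure \<mu> A \<le> c\<close> measure_nonneg[of \<mu> ?D] by linarith
    then have "?D \<in> null_sets \<mu>"
      using D by (simp add: null_sets_def \<mu>.emeasure_eq_measure sets_mu)
    then have "AE x in M. x \<in> ?D \<longrightarrow> h x = 0"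
      unfolding \<mu>_def by (subst (asm) null_sets_density_iff) auto
    then have "AE x in M. x \<notin> ?D"
    proof (rule AE_mp, intro AE_I2 impI)
      fix x assume "x \<in> space M" "x \<in> ?D \<longrightarrow> h x = 0"
      with hpos[of x] show "x \<notin> ?D" by auto
    qed
    then have "?D \<in> null_sets M" using D by (simp add: AE_iff_null_sets)
    then have "?D \<union> N \<in> null_sets M" using N by auto
    then show "A \<inter> B \<in> null_sets M"
      by (rule null_sets_subset) (use A B in auto)
  qed
qed

text \<open>The set where \<open>H\<close> and \<open>H'\<close> are close has full outer measure, although it may have inner
  measure \<open>0\<close> if \<open>H\<close> is not measurable.\<close>

lemma borel_approximation:
  fixes H :: "'a::euclidean_space \<Rightarrow> 'c::{metric_space, second_countable_topology}"
  assumes "0 < \<epsilon>"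
  obtains H' where "H' \<in> borel_measurable borel" "range H' \<subseteq> range H"
    "\<And>Z M. Z \<in> sets borel \<Longrightarrow> M \<in> null_sets lebesgue \<Longrightarrow>
       (\<And>x. x \<in> Z - M \<Longrightarrow> \<epsilon> \<le> dist (H x) (H' x)) \<Longrightarrow> Z \<in> null_sets lborel"
proof -
  obtain D where D: "countable D" "D \<subseteq> range H" "range H \<subseteq> closure D"
    using separable by blast
  then have "D \<noteq> {}" by auto
  define q where "q = from_nat_into D"
  have q: "range q = D" unfolding q_def by (rule range_from_nat_into) (use D \<open>D \<noteq> {}\<close> in auto)
  define E where "E i = {x. dist (H x) (q i) < \<epsilon>}" for i
  have E: "\<exists>i. x \<in> E i" for x
  proof -
    have "H x \<in> closure D" using D by auto
    then obtain y where "y \<in> D" "dist y (H x) < \<epsilon>" using assms closure_approachable by blast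
    then show ?thesis using q unfolding E_def by (auto simp: dist_commute)
  qed
  have "\<exists>A. A \<in> sets borel \<and> E i \<subseteq> A \<and>
      (\<forall>B N. B \<in> sets borel \<longrightarrow> N \<in> null_sets lborel \<longrightarrow> E i \<inter> B \<subseteq> N \<longrightarrow> A \<inter> B \<in> null_sets lborel)" for i
    by (rule sigma_finite_measure.measurable_hull[OF sigma_finite_lborel, of "E i"]) auto
  then obtain A where A[measurable]: "\<And>i. A i \<in> sets borel" and EA: "\<And>i. E i \<subseteq> A i"
    and null: "\<And>i B N. B \<in> sets borel \<Longrightarrow> N \<in> null_sets lborel \<Longrightarrow> E i \<inter> B \<subseteq> N \<Longrightarrow> A i \<inter> B \<in> null_sets lborel"
    by metis
  \<comment> \<open>Choosing the least index through the hulls \<open>A i\<close> rather than the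
    sets \<open>E i\<close> keeps the choice Borel. It may be wrong on \<open>A i - E i\<close>, but
    the hull property says that a Borel set contained there is null.\<close>
  define idx where "idx x = (LEAST i. x \<in> A i)" for x
  have idx[measurable]: "idx \<in> measurable borel (count_space UNIV)"
    unfolding idx_def by measurable
  have idxA: "x \<in> A (idx x)" for x
    unfolding idx_def using E[of x] EA by (meson LeastI subsetD)
  show ?thesis
  proof (rule that)
    show "(\<lambda>x. q (idx x)) \<in> borel_measurable borel"
      by (rule measurable_compose[OF idx]) simp
    show "range (\<lambda>x. q (idx x)) \<subseteq> range H" using D(2) q by blast
    fix Z M assume Z[measurable]: "Z \<in> sets borel" and M: "M \<in> null_sets lebesgue"
      and far: "\<And>x. x \<in> Z - M \<Longrightarrow> \<epsilon> \<le> dist (H x) (q (idx x))"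
    obtain N where N: "N \<in> null_sets lborel" "M \<subseteq> N"
      using null_sets_completion_iff2[THEN iffD1, OF M] by auto
    \<comment> \<open>On the piece with index \<open>i\<close>, being far from \<open>q i\<close>
      means lying outside \<open>E i\<close>; hence \<open>E i\<close> meets the piece only inside
      \<open>N\<close>.\<close>
    have "A i \<inter> (Z \<inter> {x. idx x = i}) \<in> null_sets lborel" for i
    proof (rule null[OF _ N(1)])
      show "Z \<inter> {x. idx x = i} \<in> sets borel" by measurable
      show "E i \<inter> (Z \<inter> {x. idx x = i}) \<subseteq> N"
        using far N(2) by (force simp: E_def)
    qed
    then have "(\<Union>i. A i \<inter> (Z \<inter> {x. idx x = i})) \<in> null_sets lborel"
      by (rule null_sets_UN)
    also have "(\<Union>i. A i \<inter> (Z \<inter> {x. idx x = i})) = Z" using idxA by auto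
    finally show "Z \<in> null_sets lborel" .
  qed
qed

section \<open>Almost everywhere convergent mixtures of bounded functions\<close>

text \<open>Convex combinations with dyadic weights suffice below, because the minimization argument only
  ever takes midpoints; this avoids coefficient families.\<close>

inductive_set dyadic_mixtures :: "(nat \<Rightarrow> 'b \<Rightarrow> 'a::real_vector) \<Rightarrow> nat \<Rightarrow> ('b \<Rightarrow> 'a) set"
  for u n where
  base: "n \<le> j \<Longrightarrow> u j \<in> dyadic_mixtures u n"
| mid: "U \<in> dyadic_mixtures u n \<Longrightarrow> V \<in> dyadic_mixtures u n \<Longrightarrow>
    (\<lambda>x. (1/2) *\<^sub>R (U x + V x)) \<in> dyadic_mixtures u n"

lemma dyadic_mixtures_antimono:
  assumes "n \<le> m" shows "dyadic_mixtures u m \<subseteq> dyadic_mixtures u n"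
proof
  fix U assume "U \<in> dyadic_mixtures u m"
  then show "U \<in> dyadic_mixtures u n"
    by induction (use assms in \<open>auto intro: dyadic_mixtures.intros\<close>)
qed

lemma dyadic_mixture_in_convex:
  assumes "U \<in> dyadic_mixtures u n" "convex S" "\<And>j. n \<le> j \<Longrightarrow> u j x \<in> S"
  shows "U x \<in> S"
  using assms(1)
proof induction
  case (mid U V)
  then show ?case using convexD[OF assms(2), of "U x" "V x" "1/2" "1/2"]
    by (simp add: scaleR_add_right)
qed (use assms in auto)

lemma dyadic_mixture_measurable:
  fixes u :: "nat \<Rightarrow> 'b \<Rightarrow> 'a::euclidean_space"
  assumes "U \<in> dyadic_mixtures u n" "\<And>j. u j \<in> borel_measurable M"
  shows "U \<in> borel_measurable M"
  using assms(1) by induction (use assms(2) in auto)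

text \<open>Near-minimizers of the \<open>L\<^sup>2\<close> norm over the mixtures of the tails form an \<open>L\<^sup>2\<close> Cauchy sequence,
  by the parallelogram law.\<close>

lemma dyadic_mixtures_AE_convergent:
  fixes u :: "nat \<Rightarrow> 'b \<Rightarrow> 'a::euclidean_space"
  assumes "finite_measure M" and u: "\<And>j. u j \<in> borel_measurable M"
    and bound: "\<And>j x. norm (u j x) \<le> 1"
  obtains U where "\<And>n. U n \<in> dyadic_mixtures u n" "AE x in M. convergent (\<lambda>n. U n x)"
proof -
  interpret finite_measure M by fact
  have meas: "V \<in> borel_measurable M" if "V \<in> dyadic_mixtures u n" for V n
    by (rule dyadic_mixture_measurable[OF that u])
  have bnd: "norm (V x) \<le> 1" if "V \<in> dyadic_mixtures u n" for V n x
    using dyadic_mixture_in_convex[OF that, of "cball 0 1" x] bound by simp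
  have int: "integrable M f" if "f \<in> borel_measurable M" "\<And>x. norm (f x) \<le> B" for f :: "'b \<Rightarrow> real" and B
    using that by (intro integrable_const_bound[where B=B]) auto
  define F where "F V = (\<integral>x. (norm (V x))\<^sup>2 \<partial>M)" for V :: "'b \<Rightarrow> 'a"
  have sq: "integrable M (\<lambda>x. (norm (V x))\<^sup>2)" if "V \<in> dyadic_mixtures u n" for V n
    using bnd[OF that] by (intro int[where B=1]) (use meas[OF that] in \<open>auto simp: power_le_one\<close>)
  have F0: "0 \<le> F V" for V unfolding F_def by simp
  have F1: "F V \<le> measure M (space M)" if "V \<in> dyadic_mixtures u n" for V n
  proof -
    have "F V \<le> (\<integral>x. 1 \<partial>M)" unfolding F_def
      by (intro integral_mono sq[OF that]) (use bnd[OF that] in \<open>auto simp: power_le_one\<close>)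
    then show ?thesis by simp
  qed
  \<comment> \<open>The tails shrink, so \<open>q\<close> increases; its convergence is what makes
    the parallelogram bound small.\<close>
  define q where "q n = Inf (F ` dyadic_mixtures u n)" for n
  have ne: "dyadic_mixtures u n \<noteq> {}" for n using dyadic_mixtures.base[of n n u] by auto
  have bdd: "bdd_below (F ` dyadic_mixtures u n)" for n using F0 by (intro bdd_belowI[of _ 0]) auto
  have q_le: "q n \<le> F V" if "V \<in> dyadic_mixtures u n" for V n
    unfolding q_def using that by (intro cInf_lower bdd) auto
  have "incseq q"
    unfolding incseq_def q_def
    by (intro allI impI cInf_superset_mono bdd image_mono dyadic_mixtures_antimono) (simp_all add: ne)
  moreover have "q n \<le> measure M (space M)" for n
    using q_le F1 dyadic_mixtures.base[of n n u] by (meson order_refl order_trans)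
  ultimately obtain l where l: "q \<longlonglongrightarrow> l"
    using incseq_convergent[of q "measure M (space M)"] by metis
  have "\<exists>V\<in>dyadic_mixtures u n. F V < q n + 1 / Suc n" for n
  proof -
    have "Inf (F ` dyadic_mixtures u n) < q n + 1 / Suc n" by (simp add: q_def)
    then show ?thesis using ne bdd by (subst (asm) cInf_less_iff) auto
  qed
  then obtain U where U: "\<And>n. U n \<in> dyadic_mixtures u n" "\<And>n. F (U n) < q n + 1 / Suc n"
    by metis
  note [measurable] = meas[OF U(1)]
  have parallelogram: "(\<integral>x. (norm (U n x - U m x))\<^sup>2 \<partial>M) \<le> 2 * (q m - q n) + 4 / Suc n"
    if "n \<le> m" for n m
  proof -
    let ?W = "\<lambda>x. (1/2) *\<^sub>R (U n x + U m x)"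
    \<comment> \<open>As \<open>n \<le> m\<close>, both functions are mixtures of the tail at
      \<open>n\<close>, so the squared norm of their midpoint is at least
      \<open>q n\<close>.\<close>
    have W: "?W \<in> dyadic_mixtures u n"
      using dyadic_mixtures.mid[OF U(1) subsetD[OF dyadic_mixtures_antimono[OF that] U(1)]] .
    have eq: "(norm (U n x - U m x))\<^sup>2 = 2 * (norm (U n x))\<^sup>2 + 2 * (norm (U m x))\<^sup>2 - 4 * (norm (?W x))\<^sup>2" for x
      by (simp add: power2_norm_eq_inner inner_simps inner_commute[of "U m x" "U n x"] field_simps)
    have "(\<integral>x. (norm (U n x - U m x))\<^sup>2 \<partial>M) = 2 * F (U n) + 2 * F (U m) - 4 * F ?W"
      unfolding eq F_def using sq[OF U(1)[of n]] sq[OF U(1)[of m]] sq[OF W] by simp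
    moreover have "1 / real (Suc m) \<le> 1 / Suc n" using that by (simp add: frac_le)
    ultimately show ?thesis
      using q_le[OF W] U(2)[of n] U(2)[of m] by argo
  qed
  have ex: "\<exists>N. \<forall>i\<ge>N. \<forall>j\<ge>N. (\<integral>x. norm (U i x - U j x) \<partial>M) < e" if "0 < e" for e
  proof -
    define K where "K = measure M (space M)"
    \<comment> \<open>The passage to an almost everywhere Cauchy subsequence asks for L1 estimates,
      so the L2 bound is converted by \<open>a \<le> (\<eta> + a\<^sup>2 / \<eta>) / 2\<close>. The
      size of \<open>\<eta>\<close> keeps the contribution of the constant over the total mass
      \<open>K\<close> below \<open>e / 2\<close>.\<close>
    define \<eta> where "\<eta> = e / (2 * (K + 1))"
    have "0 \<le> K" by (simp add: K_def)
    then have "0 < \<eta>" using that by (simp add: \<eta>_def)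
    have "(\<lambda>n. 2 * \<bar>q n - l\<bar> + 2 / Suc n) \<longlonglongrightarrow> 2 * \<bar>l - l\<bar> + 0"
      by (intro tendsto_intros l LIMSEQ_Suc[OF lim_const_over_n])
    then have "\<forall>\<^sub>F n in sequentially. 2 * \<bar>q n - l\<bar> + 2 / Suc n < \<eta> * e / 4"
      by (intro order_tendstoD) (use \<open>0 < \<eta>\<close> that in auto)
    then obtain N where N: "\<And>n. N \<le> n \<Longrightarrow> 2 * \<bar>q n - l\<bar> + 2 / Suc n < \<eta> * e / 4"
      by (auto simp: eventually_sequentially)
    have L2: "(\<integral>x. (norm (U i x - U j x))\<^sup>2 \<partial>M) < \<eta> * e" if "N \<le> i" "i \<le> j" for i j
    proof -
      have arith: "D < x" if "D \<le> 2 * (b - a) + 4 * s" "2 * \<bar>a - l\<bar> + 2 * s < x / 4"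
        "2 * \<bar>b - l\<bar> + 2 * t < x / 4" "0 \<le> s" "0 \<le> t" for D a b s t x :: real
      proof -
        define p r where "p = \<bar>a - l\<bar>" and "r = \<bar>b - l\<bar>"
        have "b - a \<le> p + r" "0 \<le> p" "0 \<le> r" by (auto simp: p_def r_def)
        with that[folded p_def r_def] show ?thesis by (simp add: field_simps)
      qed
      show ?thesis
        by (rule arith[of _ "q j" "q i" "1 / Suc i" _ "1 / Suc j"])
          (use parallelogram[OF \<open>i \<le> j\<close>] N[of i] N[of j] that in simp_all)
    qed
    have "(\<integral>x. norm (U i x - U j x) \<partial>M) < e" if "N \<le> i" "N \<le> j" for i j
    proof -
      have L2': "(\<integral>x. (norm (U i x - U j x))\<^sup>2 \<partial>M) < \<eta> * e"
        using L2[of i j] L2[of j i] that by (cases "i \<le> j") (auto simp: norm_minus_commute)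
      have le2: "norm (U i x - U j x) \<le> 2" for x
        using norm_triangle_ineq4[of "U i x" "U j x"] bnd[OF U(1)[of i], of x] bnd[OF U(1)[of j], of x] by linarith
      have int1: "integrable M (\<lambda>x. norm (U i x - U j x))" by (rule int[where B=2]) (use le2 in auto)
      have int2: "integrable M (\<lambda>x. (norm (U i x - U j x))\<^sup>2)"
        by (rule int[where B="2\<^sup>2"]) (use power_mono[OF le2, of _ 2] in auto)
      have pt: "a \<le> (\<eta> + a\<^sup>2 / \<eta>) / 2" for a :: real
        using \<open>0 < \<eta>\<close> zero_le_power2[of "a - \<eta>"] by (simp add: field_simps power2_eq_square)
      have "(\<integral>x. norm (U i x - U j x) \<partial>M) \<le> (\<integral>x. (\<eta> + (norm (U i x - U j x))\<^sup>2 / \<eta>) / 2 \<partial>M)"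
        by (intro integral_mono int1) (use int2 pt in auto)
      also have "\<dots> = (\<eta> * K + (\<integral>x. (norm (U i x - U j x))\<^sup>2 \<partial>M) / \<eta>) / 2"
        using int2 by (simp add: K_def mult.commute)
      also have "\<dots> < (e + e) / 2"
      proof -
        have "(\<integral>x. (norm (U i x - U j x))\<^sup>2 \<partial>M) / \<eta> < e" using L2' \<open>0 < \<eta>\<close> by (simp add: field_simps)
        moreover have "\<eta> * K \<le> e"
          using \<open>0 \<le> K\<close> \<open>0 < e\<close> by (simp add: \<eta>_def field_simps)
        ultimately show ?thesis by simp
      qed
      finally show ?thesis by simp
    qed
    then show ?thesis by blast
  qed
  have "integrable M (U n)" for n
    using bnd[OF U(1)] by (intro integrable_const_bound[where B=1]) auto
  then obtain r where r: "strict_mono r" "AE x in M. Cauchy (\<lambda>i. U (r i) x)"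
    using cauchy_L1_AE_cauchy_subseq[of M U, OF _ ex] by blast
  show ?thesis
  proof (rule that)
    show "U (r n) \<in> dyadic_mixtures u n" for n
      using dyadic_mixtures_antimono[OF seq_suble[OF r(1)]] U(1) by blast
    show "AE x in M. convergent (\<lambda>n. U (r n) x)"
      using r(2) by (simp add: Cauchy_convergent_iff)
  qed
qed

text \<open>Mixtures do not refer to the measure, so it can be exchanged for an equivalent finite
  one. This treats the whole time axis at once, without extracting over bounded intervals.\<close>

lemma dyadic_mixtures_AE_convergent_sigma_finite:
  fixes u :: "nat \<Rightarrow> 'b \<Rightarrow> 'a::euclidean_space"
  assumes "sigma_finite_measure M" and u: "\<And>j. u j \<in> borel_measurable M"
    and bound: "\<And>j x. norm (u j x) \<le> 1"
  obtains U where "\<And>n. U n \<in> dyadic_mixtures u n" "AE x in M. convergent (\<lambda>n. U n x)"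
proof -
  interpret sigma_finite_measure M by fact
  obtain h where h[measurable]: "h \<in> borel_measurable M" and "integral\<^sup>N M h \<noteq> \<infinity>"
    and hpos: "\<And>x. x \<in> space M \<Longrightarrow> 0 < h x"
    using Ex_finite_integrable_function by blast
  have "emeasure (density M h) (space M) = integral\<^sup>N M h"
    by (subst emeasure_density) (auto intro!: nn_integral_cong)
  with \<open>integral\<^sup>N M h \<noteq> \<infinity>\<close> have "finite_measure (density M h)"
    by (intro finite_measureI) auto
  then obtain U where U: "\<And>n. U n \<in> dyadic_mixtures u n"
    "AE x in density M h. convergent (\<lambda>n. U n x)"
    using dyadic_mixtures_AE_convergent[of "density M h" u] u bound by auto
  from U(2) have "AE x in M. 0 < h x \<longrightarrow> convergent (\<lambda>n. U n x)"
    by (simp add: AE_density)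
  then have "AE x in M. convergent (\<lambda>n. U n x)"
    by (rule AE_mp) (auto simp: hpos)
  with U(1) show ?thesis by (rule that)
qed

section \<open>Existence of Filippov solutions\<close>

definition ball_average :: "real \<Rightarrow> ('a::euclidean_space \<Rightarrow> 'b::euclidean_space) \<Rightarrow> 'b" where
  "ball_average h f =
     (1 / measure lborel (ball (0::'a) h)) *\<^sub>R (\<integral>y. indicator (ball 0 h) y *\<^sub>R f y \<partial>lborel)"

text \<open>A point outside \<open>S\<close> is strictly separated from \<open>S\<close> by a
  hyperplane; integrating the half-space inequality over the ball puts the average on the wrong
  side.\<close>

lemma ball_average_in_closed_convex:
  fixes f :: "'a::euclidean_space \<Rightarrow> 'b::euclidean_space"
  assumes "0 < h" and f[measurable]: "f \<in> borel_measurable borel"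
    and bound: "\<And>y. y \<in> ball 0 h \<Longrightarrow> norm (f y) \<le> B"
    and S: "convex S" "closed S" and AE: "AE y in lborel. y \<in> ball 0 h \<longrightarrow> f y \<in> S"
  shows "ball_average h f \<in> S"
proof (rule ccontr)
  assume "ball_average h f \<notin> S"
  then obtain a b where ab: "a \<bullet> ball_average h f < b" "\<And>x. x \<in> S \<Longrightarrow> b < a \<bullet> x"
    using separating_hyperplane_closed_point[OF S] by blast
  let ?\<mu> = "measure lborel (ball (0::'a) h)"
  have fin: "emeasure lborel (ball (0::'a) h) < \<infinity>"
    using emeasure_lborel_ball_finite[of "0::'a" h] by (simp add: top.not_eq_extremum)
  have "0 < ?\<mu>"
    using content_ball_pos[OF \<open>0 < h\<close>] by (simp add: measure_completion)
  have int: "integrable lborel (\<lambda>y. indicator (ball 0 h) y *\<^sub>R f y)"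
    by (rule integrableI_bounded_set_indicator[where B=B]) (use fin bound in auto)
  have "b * ?\<mu> = (\<integral>y. indicator (ball (0::'a) h) y *\<^sub>R b \<partial>lborel)"
    using fin by (simp add: mult.commute)
  also have "\<dots> \<le> (\<integral>y. a \<bullet> (indicator (ball 0 h) y *\<^sub>R f y) \<partial>lborel)"
  proof (rule integral_mono_AE)
    show "integrable lborel (\<lambda>y. indicator (ball (0::'a) h) y *\<^sub>R b)"
      by (rule integrableI_bounded_set_indicator[where B="\<bar>b\<bar>"]) (use fin in auto)
    show "integrable lborel (\<lambda>y. a \<bullet> (indicator (ball 0 h) y *\<^sub>R f y))"
      by (rule integrable_inner_right) (use int in auto)
    show "AE y in lborel. indicator (ball 0 h) y *\<^sub>R b \<le> a \<bullet> (indicator (ball 0 h) y *\<^sub>R f y)"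
      using AE by eventually_elim (use ab(2) in \<open>auto simp: indicator_def less_imp_le\<close>)
  qed
  also have "\<dots> = a \<bullet> (\<integral>y. indicator (ball 0 h) y *\<^sub>R f y \<partial>lborel)"
    by (rule integral_inner_right) (use int in auto)
  finally have "b \<le> a \<bullet> ball_average h f"
    using \<open>0 < ?\<mu>\<close> by (simp add: ball_average_def field_simps)
  with ab(1) show False by simp
qed

lemma norm_ball_average_le:
  fixes f :: "'a::euclidean_space \<Rightarrow> 'b::euclidean_space"
  assumes "0 < h" "f \<in> borel_measurable borel" "\<And>y. y \<in> ball 0 h \<Longrightarrow> norm (f y) \<le> B"
  shows "norm (ball_average h f) \<le> B"
  using ball_average_in_closed_convex[OF assms, of "cball 0 B"] assms(3) by auto

lemma borel_measurable_ball_average: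
  fixes f :: "'c::{second_countable_topology} \<Rightarrow> 'a::euclidean_space \<Rightarrow> 'b::euclidean_space"
  assumes f[measurable]: "(\<lambda>(x, y). f x y) \<in> borel_measurable borel"
  shows "(\<lambda>x. ball_average h (f x)) \<in> borel_measurable borel"
proof -
  have "(\<lambda>(x, y). f x y) \<in> borel_measurable (borel \<Otimes>\<^sub>M lborel)"
    using f by (simp add: borel_prod[symmetric] cong: measurable_cong_sets)
  then have meas: "(\<lambda>z. f (fst z) (snd z)) \<in> borel_measurable (borel \<Otimes>\<^sub>M lborel)"
    by (simp add: case_prod_beta')
  show ?thesis
    unfolding ball_average_def
    by (intro borel_measurable_scaleR borel_measurable_const
        sigma_finite_measure.borel_measurable_lebesgue_integral[OF sigma_finite_lborel])
      (auto simp: case_prod_beta' intro!: borel_measurable_scaleR meas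
        borel_measurable_indicator[THEN measurable_compose[OF measurable_snd]])
qed

section \<open>The Euler scheme for measurable fields\<close>

lemma borel_bounded_absolutely_integrable:
  fixes v :: "real \<Rightarrow> 'a::euclidean_space"
  assumes v: "v \<in> borel_measurable borel" and "\<And>s. s \<in> {a..b} \<Longrightarrow> norm (v s) \<le> B"
  shows "v absolutely_integrable_on {a..b}"
proof (rule measurable_bounded_by_integrable_imp_absolutely_integrable[where g="\<lambda>_. B"])
  show "v \<in> borel_measurable (lebesgue_on {a..b})"
    using v by (intro measurable_restrict_space1 measurable_completion) simp
qed (use assms in auto)

lemma norm_integral_le_real_interval:
  fixes v :: "real \<Rightarrow> 'a::euclidean_space"
  assumes "v integrable_on {a..b}" "a \<le> b" "\<And>s. s \<in> {a..b} \<Longrightarrow> norm (v s) \<le> B"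
  shows "norm (integral {a..b} v) \<le> B * (b - a)"
  using integral_norm_bound_integral[OF assms(1), of "\<lambda>_. B"] assms(2,3)
  by (simp add: integrable_const_ivl mult.commute)

text \<open>The state is frozen on each step and only time is integrated, so joint measurability of
  \<open>g\<close> replaces continuity. The velocity is evaluated at the step function
  \<open>p\<close>, and the last estimate compares \<open>p\<close> with the resulting continuous
  curve. The growth bound is a discrete Gronwall argument based on
  \<open>1 + c * h \<le> exp (c * h)\<close>.\<close>

lemma euler_scheme:
  fixes g :: "real \<Rightarrow> 'a::euclidean_space \<Rightarrow> 'a"
  assumes g: "(\<lambda>(s, x). g s x) \<in> borel_measurable borel"
    and growth: "\<And>s x. norm (g s x) \<le> c * (1 + norm x)" and "0 < h"
  obtains p :: "real \<Rightarrow> 'a" where "p \<in> borel_measurable borel"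
    "\<And>s. t0 \<le> s \<Longrightarrow> 1 + norm (p s) \<le> (1 + norm z0) * exp (c * (s - t0))"
    "\<And>s. t0 \<le> s \<Longrightarrow>
       norm (z0 + integral {t0..s} (\<lambda>\<tau>. g \<tau> (p \<tau>)) - p s) \<le> h * (c * (1 + norm (p s)))"
proof -
  have "0 \<le> c" using growth[of 0 0] by (metis add.right_neutral mult.right_neutral norm_ge_zero norm_zero order_trans)
  define x where "x = rec_nat z0 (\<lambda>i y. y + integral {t0 + real i * h..t0 + real (Suc i) * h} (\<lambda>s. g s y))"
  have x0: "x 0 = z0"
    and xS: "x (Suc i) = x i + integral {t0 + real i * h..t0 + real (Suc i) * h} (\<lambda>s. g s (x i))" for i
    by (auto simp: x_def)
  define n where "n s = nat \<lfloor>(s - t0) / h\<rfloor>" for s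
  define p where "p s = x (n s)" for s
  have n_meas: "n \<in> measurable borel (count_space UNIV)"
    unfolding n_def by measurable
  have p_meas: "p \<in> borel_measurable borel"
    unfolding p_def by (rule measurable_compose[OF n_meas]) simp
  have g_meas: "(\<lambda>s. g s (q s)) \<in> borel_measurable borel" if "q \<in> borel_measurable borel" for q
    using measurable_compose[of "\<lambda>s. (s, q s)" borel borel, OF _ g] that by simp
  have n_eq: "n s = i" if "t0 + real i * h \<le> s" "s < t0 + real (Suc i) * h" for s i
  proof -
    have "\<lfloor>(s - t0) / h\<rfloor> = int i"
      using that \<open>0 < h\<close> by (intro floor_unique) (auto simp: field_simps)
    then show ?thesis by (simp add: n_def)
  qed
  have n_bounds: "t0 + real (n s) * h \<le> s" "s < t0 + real (Suc (n s)) * h" if "t0 \<le> s" for s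
  proof -
    have "0 \<le> (s - t0) / h" using that \<open>0 < h\<close> by simp
    then have "real (n s) = \<lfloor>(s - t0) / h\<rfloor>" by (simp add: n_def)
    then have "real (n s) \<le> (s - t0) / h" "(s - t0) / h < real (n s) + 1" by linarith+
    then show "t0 + real (n s) * h \<le> s" "s < t0 + real (Suc (n s)) * h"
      using \<open>0 < h\<close> by (auto simp: field_simps)
  qed
  have step_int: "(\<lambda>s. g s (x i)) absolutely_integrable_on {a..b}" for i a b
    by (rule borel_bounded_absolutely_integrable[OF g_meas growth]) simp
  have node_growth: "1 + norm (x i) \<le> (1 + norm z0) * exp (c * h * i)" for i
  proof (induction i)
    case (Suc i)
    have "norm (x (Suc i)) \<le> norm (x i) + c * (1 + norm (x i)) * h"
      unfolding xS
      using norm_triangle_le[OF add_left_mono[OF norm_integral_le_real_interval[OF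
            set_lebesgue_integral_eq_integral(1)[OF step_int] _ growth]],
          of "t0 + real i * h" "t0 + real (Suc i) * h" "x i" i] \<open>0 < h\<close>
      by (simp add: algebra_simps)
    then have "1 + norm (x (Suc i)) \<le> (1 + norm (x i)) * (1 + c * h)" by (simp add: algebra_simps)
    also have "\<dots> \<le> (1 + norm z0) * exp (c * h * i) * exp (c * h)"
      using Suc \<open>0 \<le> c\<close> \<open>0 < h\<close> by (intro mult_mono) (auto intro: add_nonneg_nonneg)
    finally show ?case by (simp add: exp_add[symmetric] algebra_simps mult_exp_exp)
  qed (simp add: x0)
  have p_growth: "1 + norm (p s) \<le> (1 + norm z0) * exp (c * (s - t0))" if "t0 \<le> s" for s
  proof -
    have "h * n s \<le> s - t0" using n_bounds(1)[OF that] by (simp add: mult.commute)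
    then have "c * h * n s \<le> c * (s - t0)" using \<open>0 \<le> c\<close> by (simp add: mult.assoc mult_left_mono)
    then show ?thesis
      using node_growth[of "n s"] unfolding p_def
      by (smt (verit) exp_le_cancel_iff mult_left_mono norm_ge_zero)
  qed
  let ?v = "\<lambda>s. g s (p s)"
  have v_bound: "norm (?v s) \<le> c * ((1 + norm z0) * exp (c * (T - t0)))" if "s \<in> {t0..T}" for s T
  proof -
    have "1 + norm (p s) \<le> (1 + norm z0) * exp (c * (s - t0))" using p_growth that by auto
    also have "\<dots> \<le> (1 + norm z0) * exp (c * (T - t0))"
      using that \<open>0 \<le> c\<close> by (intro mult_left_mono) (auto intro: mult_left_mono)
    finally show ?thesis using growth[of s "p s"] \<open>0 \<le> c\<close> by (meson mult_left_mono order_trans)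
  qed
  have v_int: "?v integrable_on {t0..T}" for T
    by (intro set_lebesgue_integral_eq_integral(1)
        borel_bounded_absolutely_integrable[OF g_meas[OF p_meas] v_bound])
  \<comment> \<open>At the right end point \<open>n\<close> has already moved on to the next step,
    hence the spike there.\<close>
  have v_eq: "integral {t0 + real i * h..s} ?v = integral {t0 + real i * h..s} (\<lambda>s. g s (x i))"
    if "s \<le> t0 + real (Suc i) * h" for s i
    by (rule integral_spike[of "{t0 + real (Suc i) * h}"]) (use that n_eq[of i] in \<open>auto simp: p_def\<close>)
  have node: "z0 + integral {t0..t0 + real i * h} ?v = x i" for i
  proof (induction i)
    case (Suc i)
    have "integral {t0..t0 + real (Suc i) * h} ?v = integral {t0..t0 + real i * h} ?v + integral {t0 + real i * h..t0 + real (Suc i) * h} ?v"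
      by (rule Henstock_Kurzweil_Integration.integral_combine[symmetric, OF _ _ v_int]) (use \<open>0 < h\<close> in auto)
    also have "z0 + \<dots> = x i + integral {t0 + real i * h..t0 + real (Suc i) * h} ?v"
      using Suc by (simp only: add.assoc[symmetric])
    finally show ?case by (simp only: xS v_eq[OF order_refl])
  qed (simp add: x0)
  have close: "norm (z0 + integral {t0..s} ?v - p s) \<le> h * (c * (1 + norm (p s)))" if "t0 \<le> s" for s
  proof -
    let ?a = "t0 + real (n s) * h"
    have a: "t0 \<le> ?a" "?a \<le> s" "s \<le> t0 + real (Suc (n s)) * h"
      using n_bounds[OF that] \<open>0 < h\<close> by auto
    have "integral {t0..s} ?v = integral {t0..?a} ?v + integral {?a..s} ?v"
      by (rule Henstock_Kurzweil_Integration.integral_combine[symmetric, OF a(1,2) v_int])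
    also have "z0 + \<dots> = x (n s) + integral {?a..s} ?v"
      using node[of "n s"] by (simp only: add.assoc[symmetric])
    finally have "z0 + integral {t0..s} ?v - p s = integral {?a..s} (\<lambda>\<tau>. g \<tau> (x (n s)))"
      unfolding v_eq[OF a(3)] by (simp add: p_def)
    then have "norm (z0 + integral {t0..s} ?v - p s) \<le> c * (1 + norm (x (n s))) * (s - ?a)"
      using norm_integral_le_real_interval[OF set_lebesgue_integral_eq_integral(1)[OF step_int] a(2) growth] by simp
    also have "\<dots> \<le> c * (1 + norm (x (n s))) * h"
      using a(3) \<open>0 \<le> c\<close> by (intro mult_left_mono) (auto simp: algebra_simps)
    finally show ?thesis by (simp add: p_def algebra_simps)
  qed
  show ?thesis by (rule that[OF p_meas p_growth close])
qed

section \<open>Passage to the limit for a non-measurable field\<close>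

lemma closed_convex_thickening:
  fixes K :: "'a::euclidean_space set"
  assumes "closed K" "convex K"
  shows "closed {x. \<exists>y\<in>K. dist x y \<le> \<eta>}" "convex {x. \<exists>y\<in>K. dist x y \<le> \<eta>}"
proof -
  \<comment> \<open>The thickening is the Minkowski sum of \<open>K\<close> with a closed ball; it
    is closed because the ball is compact.\<close>
  have "{x. \<exists>y\<in>K. dist x y \<le> \<eta>} = (\<Union>x\<in>K. \<Union>y\<in>cball 0 \<eta>. {x + y})"
  proof (intro set_eqI iffI)
    fix x assume "x \<in> {x. \<exists>y\<in>K. dist x y \<le> \<eta>}"
    then obtain y where "y \<in> K" "dist x y \<le> \<eta>" by auto
    then have "x - y \<in> cball 0 \<eta>" "x \<in> {y + (x - y)}" by (auto simp: dist_norm norm_minus_commute)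
    with \<open>y \<in> K\<close> show "x \<in> (\<Union>x\<in>K. \<Union>y\<in>cball 0 \<eta>. {x + y})" by blast
  qed (force simp: dist_norm)
  then show "closed {x. \<exists>y\<in>K. dist x y \<le> \<eta>}" "convex {x. \<exists>y\<in>K. dist x y \<le> \<eta>}"
    using closed_compact_sums[OF assms(1), of "cball 0 \<eta>"] convex_sums[OF assms(2), of "cball 0 \<eta>"]
    by auto
qed

text \<open>\<open>H\<close> need not be measurable. Step \<open>k\<close> replaces it by a Borel approximation, averages the field
  over balls of radius \<open>h k\<close> (an average ignores null sets, just as \<^const>\<open>filippov_set\<close> does), and
  runs the Euler scheme. Mixtures of the velocities then converge almost everywhere, and closed
  convex sets containing a tail of the velocities contain the limit.\<close>

theorem filippov_solution_exists:
  fixes \<Psi> :: "real \<Rightarrow> 'a::euclidean_space \<Rightarrow> 'c::euclidean_space \<Rightarrow> 'a"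
    and H :: "'a \<Rightarrow> 'c" and d :: "real \<Rightarrow> 'a"
  assumes \<Psi>: "(\<lambda>(t, z, y). \<Psi> t z y) \<in> borel_measurable borel"
    and d: "d \<in> borel_measurable borel"
    and growth: "\<And>t z \<xi>. norm (\<Psi> t z (H \<xi>)) \<le> C * (1 + norm z)"
    and lip: "\<And>t z \<xi> \<xi>'. norm (\<Psi> t z (H \<xi>) - \<Psi> t z (H \<xi>')) \<le> C * (1 + norm z) * dist (H \<xi>) (H \<xi>')"
  obtains z where "z t0 = z0"
    "filippov_solution (\<lambda>t z. \<Psi> t z (H (z + d t))) t0 {t0..} z"
proof -
  define G where "G t z = \<Psi> t z (H (z + d t))" for t z
  have "0 \<le> C" using growth[of 0 0 0] by (metis add.right_neutral mult.right_neutral norm_ge_zero norm_zero order_trans)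
  \<comment> \<open>One parameter serves as tolerance of the approximation, averaging radius and
    Euler step.\<close>
  define h where "h k = 1 / real (Suc k)" for k
  have h: "0 < h k" "h k \<le> 1" for k by (auto simp: h_def)
  have "\<exists>H'. H' \<in> borel_measurable borel \<and> range H' \<subseteq> range H \<and>
      (\<forall>Z M. Z \<in> sets borel \<longrightarrow> M \<in> null_sets lebesgue \<longrightarrow>
        (\<forall>x\<in>Z - M. h k \<le> dist (H x) (H' x)) \<longrightarrow> Z \<in> null_sets lborel)" for k
    by (rule borel_approximation[OF h(1)[of k], of H]) blast
  then obtain H' where H'_meas: "\<And>k. H' k \<in> borel_measurable borel"
    and H'_range: "\<And>k. range (H' k) \<subseteq> range H"
    and H'_approx: "\<And>k Z M. Z \<in> sets borel \<Longrightarrow> M \<in> null_sets lebesgue \<Longrightarrow>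
        (\<And>x. x \<in> Z - M \<Longrightarrow> h k \<le> dist (H x) (H' k x)) \<Longrightarrow> Z \<in> null_sets lborel"
    by metis
  \<comment> \<open>The values of \<open>H' k\<close> are values of \<open>H\<close>, so the growth
    and Lipschitz hypotheses on \<open>\<Psi>\<close> remain applicable.\<close>
  define G' where "G' k t z = \<Psi> t z (H' k (z + d t))" for k t z
  have G'_meas: "(\<lambda>(t, z). G' k t z) \<in> borel_measurable borel" for k
  proof -
    have "(\<lambda>x. (fst x, snd x, H' k (snd x + d (fst x)))) \<in> borel_measurable (borel :: (real \<times> 'a) measure)"
      by (intro borel_measurable_Pair borel_measurable_add measurable_compose[OF _ H'_meas[of k]]
          measurable_compose[OF _ d] borel_measurable_continuous_onI continuous_intros)
    from measurable_compose[OF this \<Psi>] show ?thesis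
      by (simp add: G'_def case_prod_beta')
  qed
  have G'_growth: "norm (G' k t z) \<le> C * (1 + norm z)" for k t z
    unfolding G'_def using growth H'_range[of k] by (metis image_subset_iff rangeE UNIV_I)
  define g where "g k t \<zeta> = ball_average (h k) (\<lambda>y. G' k t (\<zeta> + y))" for k t \<zeta>
  have slice: "(\<lambda>y. G' k t (\<zeta> + y)) \<in> borel_measurable borel" for k t \<zeta>
    using measurable_compose[of "\<lambda>y. (t, \<zeta> + y)" borel borel, OF _ G'_meas[of k]] by simp
  have g_meas: "(\<lambda>(t, \<zeta>). g k t \<zeta>) \<in> borel_measurable borel" for k
  proof -
    have "(\<lambda>x. (fst (fst x), snd (fst x) + snd x)) \<in> borel_measurable (borel :: ((real \<times> 'a) \<times> 'a) measure)"
      by (intro borel_measurable_continuous_onI continuous_intros)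
    from measurable_compose[OF this G'_meas[of k]]
    have "(\<lambda>(x, y). G' k (fst x) (snd x + y)) \<in> borel_measurable (borel :: ((real \<times> 'a) \<times> 'a) measure)"
      by (simp add: case_prod_beta')
    from borel_measurable_ball_average[OF this] show ?thesis
      by (simp add: g_def case_prod_beta')
  qed
  have near: "norm (\<zeta> + y) \<le> norm \<zeta> + 1" if "y \<in> ball 0 (h k)" for \<zeta> y :: 'a and k
    using that h(2)[of k] norm_triangle_ineq[of \<zeta> y] by simp
  have G'_near: "norm (G' k t (\<zeta> + y)) \<le> C * (2 + norm \<zeta>)" if "y \<in> ball 0 (h k)" for k t \<zeta> y
    using G'_growth[of k t "\<zeta> + y"] near[OF that, of \<zeta>] \<open>0 \<le> C\<close>
    by (smt (verit, ccfv_SIG) mult_left_mono)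
  have g_growth: "norm (g k t \<zeta>) \<le> (2 * C) * (1 + norm \<zeta>)" for k t \<zeta>
  proof -
    have "norm (g k t \<zeta>) \<le> C * (2 + norm \<zeta>)"
      unfolding g_def by (rule norm_ball_average_le[OF h(1) slice G'_near])
    also have "\<dots> \<le> (2 * C) * (1 + norm \<zeta>)"
      using \<open>0 \<le> C\<close> by (simp add: algebra_simps)
    finally show ?thesis .
  qed
  \<comment> \<open>\<open>K\<close> is any closed convex set that holds the true field on the ball
    off a null set. Where \<open>G'\<close> leaves the thickening of \<open>K\<close>, the Lipschitz
    bound forces \<open>H\<close> and \<open>H' k\<close> at least \<open>h k\<close> apart, off a
    null set. This region is Borel, hence null, and the average does not see it.\<close>
  have g_mem: "\<exists>y\<in>K. dist (g k t \<zeta>) y \<le> C * (2 + norm \<zeta>) * h k"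
    if K: "closed K" "convex K" and M: "M \<in> null_sets lebesgue"
      and sub: "G t ` (ball \<zeta> (h k) - M) \<subseteq> K" for K M k t \<zeta>
  proof -
    define \<eta> where "\<eta> = C * (2 + norm \<zeta>) * h k"
    define S where "S = {x. \<exists>y\<in>K. dist x y \<le> \<eta>}"
    have S: "closed S" "convex S" unfolding S_def by (rule closed_convex_thickening[OF K])+
    define Z where "Z = {\<xi>. \<xi> - d t - \<zeta> \<in> ball 0 (h k) \<and> G' k t (\<xi> - d t) \<notin> S}"
    define M' where "M' = {\<xi>. \<xi> - d t \<in> M}"
    have slice': "(\<lambda>\<xi>. G' k t (\<xi> - d t)) \<in> borel_measurable borel"
      using measurable_compose[of "\<lambda>y. (t, y - d t)" borel borel, OF _ G'_meas[of k]] by simp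
    have "M' = (\<lambda>x. d t + x) ` M" by (auto simp: M'_def image_iff algebra_simps) (metis add.commute diff_add_cancel)
    then have M': "M' \<in> null_sets lebesgue"
      using negligible_translation[of M "d t"] M by (simp add: negligible_iff_null_sets)
    have "Z \<in> null_sets lborel"
    proof (rule H'_approx[OF _ M'])
      have "Z = (\<lambda>\<xi>. \<xi> - d t - \<zeta>) -` ball 0 (h k) \<inter> (\<lambda>\<xi>. G' k t (\<xi> - d t)) -` (- S)"
        by (auto simp: Z_def)
      also have "\<dots> \<in> sets borel"
        by (intro sets.Int measurable_sets_borel[OF slice'] measurable_sets_borel[of _ borel]
            borel_measurable_continuous_onI continuous_intros) (use S(1) in auto)
      finally show "Z \<in> sets borel" .
      fix \<xi> assume \<xi>: "\<xi> \<in> Z - M'"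
      define z where "z = \<xi> - d t"
      have z: "z \<in> ball \<zeta> (h k) - M" and zS: "G' k t z \<notin> S"
        using \<xi> by (auto simp: Z_def M'_def z_def dist_norm norm_minus_commute)
      obtain \<xi>' where \<xi>': "H' k \<xi> = H \<xi>'" using H'_range by blast
      have "G t z \<in> K" using sub z by auto
      then have "\<eta> < dist (G' k t z) (G t z)" using zS by (force simp: S_def)
      also have "\<dots> \<le> C * (1 + norm z) * dist (H' k \<xi>) (H \<xi>)"
        unfolding G'_def G_def dist_norm using lip[of t z \<xi>' \<xi>] by (simp add: z_def \<xi>' dist_norm)
      also have "\<dots> \<le> C * (2 + norm \<zeta>) * dist (H' k \<xi>) (H \<xi>)"
      proof -
        have "norm z \<le> norm \<zeta> + 1" using near[of "z - \<zeta>" k \<zeta>] z by (simp add: dist_norm norm_minus_commute)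
        then show ?thesis using \<open>0 \<le> C\<close> by (intro mult_right_mono mult_left_mono) auto
      qed
      finally have "h k < dist (H' k \<xi>) (H \<xi>)"
        unfolding \<eta>_def by (rule mult_left_less_imp_less) (use \<open>0 \<le> C\<close> in simp)
      then show "h k \<le> dist (H \<xi>) (H' k \<xi>)" by (simp add: dist_commute)
    qed
    from null_sets_translation[OF this, of "- (d t + \<zeta>)"]
    have "{y. y \<in> ball 0 (h k) \<and> G' k t (\<zeta> + y) \<notin> S} \<in> null_sets lborel"
      by (simp add: Z_def algebra_simps)
    then have "AE y in lborel. y \<in> ball 0 (h k) \<longrightarrow> G' k t (\<zeta> + y) \<in> S"
      by (rule AE_I') auto
    then have "g k t \<zeta> \<in> S"
      unfolding g_def by (intro ball_average_in_closed_convex[OF h(1) slice G'_near S(2,1)])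
    then show ?thesis by (auto simp: S_def \<eta>_def)
  qed

  \<comment> \<open>Averaging over balls of radius at most \<open>1\<close> raises the growth
    constant from \<open>C\<close> to \<open>2 * C\<close>.\<close>
  define R where "R s = (1 + norm z0) * exp (2 * C * (s - t0))" for s
  have R_mono: "R s \<le> R s'" if "s \<le> s'" for s s'
    unfolding R_def using that \<open>0 \<le> C\<close> by (intro mult_left_mono) (auto intro: mult_left_mono)
  have R_pos: "0 < R s" for s unfolding R_def by (intro mult_pos_pos add_pos_nonneg) auto
  have R_meas: "R \<in> borel_measurable borel" unfolding R_def by measurable
  have "\<exists>p. p \<in> borel_measurable borel \<and> (\<forall>s\<ge>t0. 1 + norm (p s) \<le> R s) \<and>
      (\<forall>s\<ge>t0. norm (z0 + integral {t0..s} (\<lambda>\<tau>. g k \<tau> (p \<tau>)) - p s) \<le> h k * (2 * C * (1 + norm (p s))))" for k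
    unfolding R_def by (rule euler_scheme[OF g_meas[of k] g_growth[of k] h(1)[of k], of t0 z0]) blast
  then obtain p where p_meas: "\<And>k. p k \<in> borel_measurable borel"
    and p_bound: "\<And>k s. t0 \<le> s \<Longrightarrow> 1 + norm (p k s) \<le> R s"
    and p_close: "\<And>k s. t0 \<le> s \<Longrightarrow>
      norm (z0 + integral {t0..s} (\<lambda>\<tau>. g k \<tau> (p k \<tau>)) - p k s) \<le> h k * (2 * C * (1 + norm (p k s)))"
    by metis
  define v where "v k s = g k s (p k s)" for k s
  define \<zeta> where "\<zeta> k s = z0 + integral {t0..s} (v k)" for k s
  \<comment> \<open>The summand \<open>1\<close> keeps \<open>c\<close> positive when
    \<open>C = 0\<close>; velocities are later divided by \<open>c * R s\<close>.\<close>
  define c where "c = 2 * C + 1"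
  have c: "0 < c" "2 * C \<le> c" using \<open>0 \<le> C\<close> by (auto simp: c_def)
  have v_meas: "v k \<in> borel_measurable borel" for k
    unfolding v_def using measurable_compose[of "\<lambda>s. (s, p k s)" borel borel, OF _ g_meas[of k]] p_meas[of k] by simp
  have v_bound: "norm (v k s) \<le> c * R s" if "t0 \<le> s" for k s
  proof -
    have "norm (v k s) \<le> 2 * C * (1 + norm (p k s))" unfolding v_def by (rule g_growth)
    also have "\<dots> \<le> c * R s"
      using p_bound[OF that, of k] c by (intro mult_mono) auto
    finally show ?thesis .
  qed
  have v_bound_on: "norm (v k s) \<le> c * R b" if "t0 \<le> a" "s \<in> {a..b}" for k s a b
    using v_bound[of s k] R_mono[of s b] that c(1) by (smt (verit) atLeastAtMost_iff mult_left_mono)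
  have v_int: "v k absolutely_integrable_on {a..b}" if "t0 \<le> a" for k a b
    by (rule borel_bounded_absolutely_integrable[OF v_meas v_bound_on[OF that]])
  have \<zeta>_close: "norm (\<zeta> k s - p k s) \<le> h k * (c * R s)" if "t0 \<le> s" for k s
  proof -
    have "norm (\<zeta> k s - p k s) \<le> h k * (2 * C * (1 + norm (p k s)))"
      unfolding \<zeta>_def v_def by (rule p_close[OF that])
    also have "\<dots> \<le> h k * (c * R s)"
      using p_bound[OF that, of k] c h(1)[of k] \<open>0 \<le> C\<close> by (intro mult_left_mono mult_mono) auto
    finally show ?thesis .
  qed
  have \<zeta>_lip: "norm (\<zeta> k s' - \<zeta> k s) \<le> c * R s' * (s' - s)" if "t0 \<le> s" "s \<le> s'" for k s s'
  proof -
    have "integral {t0..s} (v k) + integral {s..s'} (v k) = integral {t0..s'} (v k)"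
      using that by (intro Henstock_Kurzweil_Integration.integral_combine set_lebesgue_integral_eq_integral(1) v_int) auto
    then have "\<zeta> k s' - \<zeta> k s = integral {s..s'} (v k)" by (simp add: \<zeta>_def algebra_simps)
    then show ?thesis
      using norm_integral_le_real_interval[OF set_lebesgue_integral_eq_integral(1)[OF v_int] that(2) v_bound_on] that by simp
  qed

  \<comment> \<open>This is the Arzela-Ascoli argument: a diagonal subsequence converges at rational
    times, and the local Lipschitz bounds, uniform in \<open>k\<close>, carry convergence to all
    times. Dividing by \<open>R s\<close> gives the bound independent of \<open>s\<close> that the
    diagonal extraction asks for.\<close>
  obtain \<kappa> :: "nat \<Rightarrow> nat" where \<kappa>: "strict_mono \<kappa>"
    and conv_Q: "\<And>s. s \<in> \<rat> \<inter> {t0..} \<Longrightarrow> \<exists>l. (\<lambda>n. (1 / R s) *\<^sub>R \<zeta> (\<kappa> n) s) \<longlonglongrightarrow> l"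
  proof (rule function_convergent_subsequence[of "\<rat> \<inter> {t0..}" "\<lambda>k s. (1 / R s) *\<^sub>R \<zeta> k s" "1 + c"])
    show "countable (\<rat> \<inter> {t0..})" using countable_rat by (rule countable_subset[rotated]) auto
    fix k s assume "s \<in> \<rat> \<inter> {t0..}"
    then have s: "t0 \<le> s" by auto
    have "norm (\<zeta> k s) \<le> norm (p k s) + h k * (c * R s)"
      using \<zeta>_close[OF s, of k] norm_triangle_sub[of "\<zeta> k s" "p k s"] by linarith
    also have "\<dots> \<le> R s + 1 * (c * R s)"
      using p_bound[OF s, of k] h(2)[of k] c R_pos[of s] by (intro add_mono mult_right_mono) auto
    finally show "norm ((1 / R s) *\<^sub>R \<zeta> k s) \<le> 1 + c"
      using R_pos[of s] by (simp add: field_simps)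
  qed auto
  have conv: "convergent (\<lambda>n. \<zeta> (\<kappa> n) s)" if "t0 \<le> s" for s
  proof -
    have "Cauchy (\<lambda>n. \<zeta> (\<kappa> n) s)"
    proof (rule metric_CauchyI)
      fix e :: real assume "0 < e"
      define B where "B = c * R (s + 1)"
      have "0 < B" using c R_pos by (simp add: B_def)
      obtain s' where s': "s' \<in> \<rat>" "s < s'" "s' < s + min 1 (e / (3 * B))"
        using Rats_dense_in_real[of s "s + min 1 (e / (3 * B))"] \<open>0 < e\<close> \<open>0 < B\<close> by auto
      obtain l where "(\<lambda>n. (1 / R s') *\<^sub>R \<zeta> (\<kappa> n) s') \<longlonglongrightarrow> l"
        using conv_Q[of s'] s' \<open>t0 \<le> s\<close> by auto
      from tendsto_scaleR[OF tendsto_const[of "R s'"] this]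
      have "(\<lambda>n. \<zeta> (\<kappa> n) s') \<longlonglongrightarrow> R s' *\<^sub>R l" using R_pos[of s'] by simp
      then have "Cauchy (\<lambda>n. \<zeta> (\<kappa> n) s')" by (rule LIMSEQ_imp_Cauchy)
      then obtain N where N: "\<And>m n. N \<le> m \<Longrightarrow> N \<le> n \<Longrightarrow> dist (\<zeta> (\<kappa> m) s') (\<zeta> (\<kappa> n) s') < e / 3"
        using \<open>0 < e\<close> by (metis Cauchy_def divide_pos_pos zero_less_numeral)
      have near_s: "dist (\<zeta> k s') (\<zeta> k s) \<le> e / 3" for k
      proof -
        have "dist (\<zeta> k s') (\<zeta> k s) \<le> c * R s' * (s' - s)"
          using \<zeta>_lip[of s s' k] s' that by (simp add: dist_norm)
        also have "\<dots> \<le> B * (s' - s)"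
          unfolding B_def using R_mono[of s' "s + 1"] s' c by (intro mult_right_mono mult_left_mono) auto
        also have "\<dots> \<le> B * (e / (3 * B))"
          using s' \<open>0 < B\<close> by (intro mult_left_mono) auto
        finally show ?thesis using \<open>0 < B\<close> by simp
      qed
      have "dist (\<zeta> (\<kappa> m) s) (\<zeta> (\<kappa> n) s) < e" if "N \<le> m" "N \<le> n" for m n
      proof -
        have "dist (\<zeta> (\<kappa> m) s) (\<zeta> (\<kappa> n) s) \<le> dist (\<zeta> (\<kappa> m) s) (\<zeta> (\<kappa> m) s')
            + dist (\<zeta> (\<kappa> m) s') (\<zeta> (\<kappa> n) s') + dist (\<zeta> (\<kappa> n) s') (\<zeta> (\<kappa> n) s)"
          by (meson add_right_mono dist_triangle dist_triangle_le order_trans)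
        with near_s[of "\<kappa> m"] near_s[of "\<kappa> n"] N[OF that] show ?thesis
          by (simp add: dist_commute)
      qed
      then show "\<exists>N. \<forall>m\<ge>N. \<forall>n\<ge>N. dist (\<zeta> (\<kappa> m) s) (\<zeta> (\<kappa> n) s) < e" by blast
    qed
    then show ?thesis by (simp add: Cauchy_convergent)
  qed
  define z where "z s = lim (\<lambda>n. \<zeta> (\<kappa> n) s)" for s
  have z_lim: "(\<lambda>n. \<zeta> (\<kappa> n) s) \<longlonglongrightarrow> z s" if "t0 \<le> s" for s
    unfolding z_def using conv[OF that] by (simp add: convergent_LIMSEQ_iff)
  have h_lim: "(\<lambda>n. h (\<kappa> n)) \<longlonglongrightarrow> 0"
    using LIMSEQ_subseq_LIMSEQ[OF LIMSEQ_Suc[OF lim_const_over_n[of 1]] \<kappa>] by (simp add: h_def o_def)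
  have p_lim: "(\<lambda>n. p (\<kappa> n) s) \<longlonglongrightarrow> z s" if "t0 \<le> s" for s
  proof (rule Lim_transform[OF z_lim[OF that]])
    have "(\<lambda>n. \<zeta> (\<kappa> n) s - p (\<kappa> n) s) \<longlonglongrightarrow> 0"
      by (rule Lim_null_comparison[OF always_eventually[OF allI[OF \<zeta>_close[OF that]]]])
        (rule tendsto_mult_left_zero[OF h_lim])
    then show "(\<lambda>n. p (\<kappa> n) s - \<zeta> (\<kappa> n) s) \<longlonglongrightarrow> 0"
      using tendsto_minus by fastforce
  qed

  \<comment> \<open>Normalized velocities are bounded by \<open>1\<close> at all times, so a single
    choice of mixtures works on the whole axis. Before \<open>t0\<close>, where
    \<open>v_bound\<close> says nothing, they are set to \<open>0\<close>.\<close>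
  define u where "u n s = (if t0 \<le> s then (1 / (c * R s)) *\<^sub>R v (\<kappa> n) s else 0)" for n s
  have v_u: "v (\<kappa> n) s = (c * R s) *\<^sub>R u n s" if "t0 \<le> s" for n s
    using that c(1) R_pos[of s] by (simp add: u_def)
  have u_meas: "u n \<in> borel_measurable lborel" for n
  proof -
    note [measurable] = v_meas R_meas
    show ?thesis unfolding u_def by measurable
  qed
  have u_bound: "norm (u n s) \<le> 1" for n s
    using v_bound[of s "\<kappa> n"] c(1) R_pos[of s] by (simp add: u_def field_simps)
  obtain U where U: "\<And>n. U n \<in> dyadic_mixtures u n" and U_conv: "AE s in lborel. convergent (\<lambda>n. U n s)"
    by (rule dyadic_mixtures_AE_convergent_sigma_finite[of lborel u, OF sigma_finite_lborel u_meas u_bound]) blast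
  have U_meas: "U n \<in> borel_measurable lborel" for n
    by (rule dyadic_mixture_measurable[OF U u_meas])
  have U_bound: "norm (V s) \<le> 1" if "V \<in> dyadic_mixtures u n" for n s V
    using dyadic_mixture_in_convex[OF that, of "cball 0 1" s] u_bound by simp
  define w where "w s = (c * R s) *\<^sub>R lim (\<lambda>n. U n s)" for s
  have w_lim: "AE s in lborel. (\<lambda>n. (c * R s) *\<^sub>R U n s) \<longlonglongrightarrow> w s"
    using U_conv by eventually_elim (auto simp: w_def convergent_LIMSEQ_iff intro!: tendsto_intros)
  have w_meas: "w \<in> borel_measurable lborel"
    unfolding w_def using R_meas
    by (intro borel_measurable_scaleR borel_measurable_times borel_measurable_const borel_measurable_lim_metric U_meas) simp

  have mix_int: "set_integrable lborel {t0..t} (\<lambda>s. (c * R s) *\<^sub>R V s)"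
    if "V \<in> borel_measurable lborel" "\<And>s. norm (V s) \<le> 1" for V :: "real \<Rightarrow> 'a" and t
    unfolding set_integrable_def
  proof (rule integrableI_bounded_set_indicator[where B="c * R t"])
    show "AE s in lborel. s \<in> {t0..t} \<longrightarrow> norm ((c * R s) *\<^sub>R V s) \<le> c * R t"
    proof (intro AE_I2 impI)
      fix s assume s: "s \<in> {t0..t}"
      have "(c * R s) * norm (V s) \<le> (c * R t) * 1"
        using that(2) c(1) R_pos R_mono[of s t] s by (intro mult_mono) (auto simp: less_imp_le)
      then show "norm ((c * R s) *\<^sub>R V s) \<le> c * R t" using c(1) R_pos[of s] by simp
    qed
  qed (use that(1) R_meas emeasure_compact_finite[OF compact_Icc, of t0 t] in auto)
  have V_meas: "V \<in> borel_measurable lborel" if "V \<in> dyadic_mixtures u n" for V n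
    by (rule dyadic_mixture_measurable[OF that u_meas])
  have u_integral: "z0 + (LINT s:{t0..t}|lborel. (c * R s) *\<^sub>R u n s) = \<zeta> (\<kappa> n) t" for n t
  proof -
    have "(LINT s:{t0..t}|lborel. (c * R s) *\<^sub>R u n s) = integral {t0..t} (\<lambda>s. (c * R s) *\<^sub>R u n s)"
      by (rule set_borel_integral_eq_integral(2)[OF mix_int[OF u_meas u_bound]])
    also have "\<dots> = integral {t0..t} (v (\<kappa> n))"
      by (rule Henstock_Kurzweil_Integration.integral_cong) (simp add: v_u)
    finally show ?thesis by (simp add: \<zeta>_def)
  qed
  \<comment> \<open>A midpoint of velocities integrates to the midpoint of the positions, and balls
    around \<open>z t\<close> are convex; mixing therefore does not disturb the limit
    position.\<close>
  have mix_integral: "dist (z t) (z0 + (LINT s:{t0..t}|lborel. (c * R s) *\<^sub>R V s)) \<le> \<eta>"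
    if V: "V \<in> dyadic_mixtures u n" and \<eta>: "\<And>j. n \<le> j \<Longrightarrow> dist (z t) (\<zeta> (\<kappa> j) t) \<le> \<eta>" for V n t \<eta>
    using V
  proof induction
    case (mid V1 V2)
    let ?I = "\<lambda>V. z0 + (LINT s:{t0..t}|lborel. (c * R s) *\<^sub>R V s)"
    have ii: "set_integrable lborel {t0..t} (\<lambda>s. (c * R s) *\<^sub>R V s)" if "V \<in> dyadic_mixtures u n" for V
      by (rule mix_int[OF V_meas[OF that] U_bound[OF that]])
    have "(LINT s:{t0..t}|lborel. (c * R s) *\<^sub>R ((1/2) *\<^sub>R (V1 s + V2 s)))
        = (LINT s:{t0..t}|lborel. (1/2) *\<^sub>R ((c * R s) *\<^sub>R V1 s + (c * R s) *\<^sub>R V2 s))"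
      by (rule set_lebesgue_integral_cong) (auto simp: algebra_simps)
    also have "\<dots> = (1/2) *\<^sub>R ((LINT s:{t0..t}|lborel. (c * R s) *\<^sub>R V1 s) + (LINT s:{t0..t}|lborel. (c * R s) *\<^sub>R V2 s))"
      using ii[OF mid(1)] ii[OF mid(2)] by (simp add: set_integral_add)
    finally have "?I (\<lambda>s. (1/2) *\<^sub>R (V1 s + V2 s)) = (1/2) *\<^sub>R ?I V1 + (1/2) *\<^sub>R ?I V2"
      by (simp add: algebra_simps flip: scaleR_add_left)
    then show ?case
      using convexD[OF convex_cball[of "z t" \<eta>], of "?I V1" "?I V2" "1/2" "1/2"] mid(3,4) by simp
  qed (use \<eta> u_integral in simp)

  have w_integral: "set_integrable lborel {t0..t} w" "z t = z0 + (LINT s:{t0..t}|lborel. w s)"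
    if "t0 \<le> t" for t
  proof -
    have meas1: "(\<lambda>s. indicator {t0..t} s *\<^sub>R w s) \<in> borel_measurable lborel"
      using w_meas by (intro borel_measurable_scaleR borel_measurable_indicator) auto
    have meas2: "(\<lambda>s. indicator {t0..t} s *\<^sub>R (c * R s) *\<^sub>R U n s) \<in> borel_measurable lborel" for n
      using U_meas R_meas by (intro borel_measurable_scaleR borel_measurable_indicator borel_measurable_times) auto
    have dom: "integrable lborel (\<lambda>s. indicator {t0..t} s *\<^sub>R (c * R t))"
      by (rule integrableI_bounded_set_indicator[where B="c * R t"]) (use c R_pos emeasure_compact_finite[OF compact_Icc, of t0 t] in \<open>auto simp: abs_mult less_imp_le\<close>)
    have lim: "AE s in lborel. (\<lambda>n. indicator {t0..t} s *\<^sub>R (c * R s) *\<^sub>R U n s) \<longlonglongrightarrow> indicator {t0..t} s *\<^sub>R w s"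
      using w_lim by eventually_elim (intro tendsto_intros)
    have le: "AE s in lborel. norm (indicator {t0..t} s *\<^sub>R (c * R s) *\<^sub>R U n s) \<le> indicator {t0..t} s *\<^sub>R (c * R t)" for n
    proof (intro AE_I2)
      fix s
      have "(c * R s) * norm (U n s) \<le> (c * R t) * 1" if "s \<le> t"
        using U_bound[OF U] c(1) R_pos R_mono[OF that] by (intro mult_mono) (auto simp: less_imp_le)
      then show "norm (indicator {t0..t} s *\<^sub>R (c * R s) *\<^sub>R U n s) \<le> indicator {t0..t} s *\<^sub>R (c * R t)"
        using c(1) R_pos[of s] by (auto simp: indicator_def)
    qed
    show "set_integrable lborel {t0..t} w"
      unfolding set_integrable_def by (rule integrable_dominated_convergence[OF meas1 meas2 dom lim le])
    have "(\<lambda>n. LINT s:{t0..t}|lborel. (c * R s) *\<^sub>R U n s) \<longlonglongrightarrow> (LINT s:{t0..t}|lborel. w s)"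
      unfolding set_lebesgue_integral_def by (rule integral_dominated_convergence[OF meas1 meas2 dom lim le])
    then have "(\<lambda>n. z0 + (LINT s:{t0..t}|lborel. (c * R s) *\<^sub>R U n s)) \<longlonglongrightarrow> z0 + (LINT s:{t0..t}|lborel. w s)"
      by (intro tendsto_intros)
    moreover have "(\<lambda>n. z0 + (LINT s:{t0..t}|lborel. (c * R s) *\<^sub>R U n s)) \<longlonglongrightarrow> z t"
    proof (rule metric_LIMSEQ_I)
      fix e :: real assume "0 < e"
      then obtain n0 where n0: "\<And>j. n0 \<le> j \<Longrightarrow> dist (\<zeta> (\<kappa> j) t) (z t) < e / 2"
        using metric_LIMSEQ_D[OF z_lim[OF \<open>t0 \<le> t\<close>], of "e / 2"] by auto
      have "dist (z t) (z0 + (LINT s:{t0..t}|lborel. (c * R s) *\<^sub>R U n s)) \<le> e / 2" if "n0 \<le> n" for n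
        by (rule mix_integral[OF U]) (use n0 that in \<open>auto simp: dist_commute intro: less_imp_le\<close>)
      then show "\<exists>n0. \<forall>n\<ge>n0. dist (z0 + (LINT s:{t0..t}|lborel. (c * R s) *\<^sub>R U n s)) (z t) < e"
        using \<open>0 < e\<close> by (intro exI[of _ n0]) (force simp: dist_commute)
    qed
    ultimately show "z t = z0 + (LINT s:{t0..t}|lborel. w s)" by (rule LIMSEQ_unique[rotated])
  qed
  have w_abs: "w absolutely_integrable_on {t0..t}" and z_eq: "z t = z0 + integral {t0..t} w"
    if "t0 \<le> t" for t
  proof -
    show "w absolutely_integrable_on {t0..t}"
      using w_integral(1)[OF that] integrable_completion[OF borel_measurable_integrable]
      unfolding set_integrable_def by blast
    show "z t = z0 + integral {t0..t} w"
      using w_integral[OF that] set_borel_integral_eq_integral(2) by metis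
  qed
  have zt0: "z t0 = z0" using z_eq[of t0] by simp

  have w_mem: "w s \<in> filippov_set (G s) (z s)"
    if s: "t0 \<le> s" and lim: "(\<lambda>n. (c * R s) *\<^sub>R U n s) \<longlonglongrightarrow> w s" for s
    unfolding filippov_set_def
  proof (intro INT_I)
    fix \<epsilon> :: real and M :: "'a set" assume "\<epsilon> \<in> {0<..}" and M: "M \<in> null_sets lebesgue"
    then have "0 < \<epsilon>" by simp
    define K where "K = closure (convex hull (G s ` (ball (z s) \<epsilon> - M)))"
    have K: "closed K" "convex K" unfolding K_def by (auto intro: convex_closure)
    \<comment> \<open>As \<open>p (\<kappa> n) s\<close> tends to \<open>z s\<close>, the averaging
      ball ends up inside \<open>ball (z s) \<epsilon>\<close>, and \<open>g_mem\<close> puts the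
      velocities of a tail into a thickening of \<open>K\<close>. Being closed and convex, it also
      contains their mixtures and the limit.\<close>
    have near_K: "\<exists>y\<in>K. dist (w s) y \<le> \<eta>" if "0 < \<eta>" for \<eta>
    proof -
      define S where "S = {x. \<exists>y\<in>K. dist x y \<le> \<eta>}"
      have S: "closed S" "convex S" unfolding S_def by (rule closed_convex_thickening[OF K])+
      have "(\<lambda>n. C * (1 + R s) * h (\<kappa> n)) \<longlonglongrightarrow> C * (1 + R s) * 0"
        by (intro tendsto_intros h_lim)
      then have "\<forall>\<^sub>F n in sequentially. C * (1 + R s) * h (\<kappa> n) < \<eta>"
        by (rule order_tendstoD) (use that in simp)
      moreover have "\<forall>\<^sub>F n in sequentially. h (\<kappa> n) < \<epsilon> / 2"
        by (rule order_tendstoD[OF h_lim]) (use \<open>0 < \<epsilon>\<close> in simp)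
      moreover have "\<forall>\<^sub>F n in sequentially. dist (p (\<kappa> n) s) (z s) < \<epsilon> / 2"
        by (rule tendstoD[OF p_lim[OF s]]) (use \<open>0 < \<epsilon>\<close> in simp)
      ultimately have "\<forall>\<^sub>F n in sequentially. v (\<kappa> n) s \<in> S"
      proof eventually_elim
        case (elim n)
        have "ball (p (\<kappa> n) s) (h (\<kappa> n)) \<subseteq> ball (z s) \<epsilon>"
        proof
          fix y assume "y \<in> ball (p (\<kappa> n) s) (h (\<kappa> n))"
          then have "dist (p (\<kappa> n) s) y < \<epsilon> / 2" using elim(2) by simp
          then show "y \<in> ball (z s) \<epsilon>"
            using dist_triangle[of "z s" y "p (\<kappa> n) s"] elim(3) by (simp add: dist_commute)
        qed
        then have "G s ` (ball (p (\<kappa> n) s) (h (\<kappa> n)) - M) \<subseteq> K"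
          unfolding K_def by (meson Diff_mono closure_subset hull_subset image_mono order_refl order_trans)
        from g_mem[OF K M this] obtain y where y: "y \<in> K"
          "dist (v (\<kappa> n) s) y \<le> C * (2 + norm (p (\<kappa> n) s)) * h (\<kappa> n)"
          by (auto simp: v_def)
        note y(2)
        also have "\<dots> \<le> C * (1 + R s) * h (\<kappa> n)"
          using p_bound[OF s, of "\<kappa> n"] h(1)[of "\<kappa> n"] \<open>0 \<le> C\<close> by (intro mult_right_mono mult_left_mono) auto
        finally have "dist (v (\<kappa> n) s) y \<le> \<eta>" using elim(1) by linarith
        then show ?case using y(1) by (auto simp: S_def)
      qed
      then obtain n0 where n0: "\<And>n. n0 \<le> n \<Longrightarrow> v (\<kappa> n) s \<in> S"
        by (auto simp: eventually_sequentially)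
      have "(c * R s) *\<^sub>R U n s \<in> S" if "n0 \<le> n" for n
      proof -
        have "U n s \<in> (\<lambda>x. (c * R s) *\<^sub>R x) -` S"
        proof (rule dyadic_mixture_in_convex[OF U])
          show "convex ((\<lambda>x. (c * R s) *\<^sub>R x) -` S)"
            by (intro convex_linear_vimage linear_scaleR S)
          show "u j s \<in> (\<lambda>x. (c * R s) *\<^sub>R x) -` S" if "n \<le> j" for j
            using n0[of j] that \<open>n0 \<le> n\<close> v_u[OF s] by simp
        qed
        then show ?thesis by simp
      qed
      then have "w s \<in> S"
        by (intro Lim_in_closed_set[OF S(1) _ _ lim]) (auto simp: eventually_sequentially)
      then show ?thesis by (simp add: S_def)
    qed
    have "w s \<in> closure K"
      unfolding closure_approachable
    proof (intro allI impI)
      fix e :: real assume "0 < e"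
      then show "\<exists>y\<in>K. dist y (w s) < e" using near_K[of "e / 2"] by (force simp: dist_commute)
    qed
    then show "w s \<in> closure (convex hull (G s ` (ball (z s) \<epsilon> - M)))"
      by (simp add: K_def)
  qed
  have "AE s in lebesgue. s \<in> {t0..} \<longrightarrow> w s \<in> filippov_set (G s) (z s)"
    by (rule AE_completion) (use w_lim in eventually_elim, use w_mem in auto)
  then have "filippov_solution G t0 {t0..} z"
    unfolding filippov_solution_def inclusion_solution_def
    using w_abs z_eq zt0 by (intro exI[of _ w]) auto
  then show ?thesis using that[of z] zt0 by (simp add: G_def[abs_def])
qed

section \<open>Quadratic Lyapunov functions\<close>

text \<open>Telescoping over a uniform partition finer than \<open>\<delta>\<close> leaves the total
  error \<open>\<eta> * (m b - m a)\<close>, with \<open>\<eta>\<close> arbitrary. In the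
  application \<open>m\<close> is the arc length of the curve, and the lemma takes the place of
  almost everywhere differentiation.\<close>

lemma nonincreasing_by_small_steps:
  fixes \<Phi> m :: "real \<Rightarrow> real"
  assumes "a \<le> b"
    and step: "\<And>\<eta>. 0 < \<eta> \<Longrightarrow> \<exists>\<delta>>0. \<forall>s t. a \<le> s \<and> s \<le> t \<and> t \<le> b \<and> t - s < \<delta> \<longrightarrow> \<Phi> t - \<Phi> s \<le> \<eta> * (m t - m s)"
  shows "\<Phi> b \<le> \<Phi> a"
proof (rule field_le_epsilon)
  fix e :: real assume "0 < e"
  define \<eta> where "\<eta> = e / (\<bar>m b - m a\<bar> + 1)"
  have "0 < \<eta>" using \<open>0 < e\<close> by (auto simp: \<eta>_def)
  then obtain \<delta> where "0 < \<delta>" and \<delta>: "\<And>s t. a \<le> s \<Longrightarrow> s \<le> t \<Longrightarrow> t \<le> b \<Longrightarrow> t - s < \<delta> \<Longrightarrow> \<Phi> t - \<Phi> s \<le> \<eta> * (m t - m s)"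
    using step by metis
  obtain n where n: "(b - a) / \<delta> < real n" using reals_Archimedean2 by blast
  then have "0 < n" using \<open>a \<le> b\<close> \<open>0 < \<delta>\<close> by (metis diff_ge_0_iff_ge divide_nonneg_pos gr0I not_less of_nat_0)
  define x where "x i = a + real i * ((b - a) / real n)" for i
  have small: "(b - a) / real n < \<delta>"
    using n \<open>0 < n\<close> \<open>0 < \<delta>\<close> by (simp add: field_simps)
  have "i \<le> n \<Longrightarrow> \<Phi> (x i) - \<Phi> a \<le> \<eta> * (m (x i) - m a)" for i
  proof (induction i)
    case (Suc i)
    have "x (Suc i) = x i + (b - a) / real n" by (simp add: x_def distrib_right add_divide_distrib)
    moreover have "a \<le> x i" using \<open>a \<le> b\<close> by (simp add: x_def)
    moreover have "x (Suc i) \<le> b"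
    proof -
      have "real (Suc i) * ((b - a) / real n) \<le> real n * ((b - a) / real n)"
        using Suc.prems \<open>a \<le> b\<close> by (intro mult_right_mono) auto
      then show ?thesis using \<open>0 < n\<close> by (simp add: x_def)
    qed
    moreover have "0 \<le> (b - a) / real n" using \<open>a \<le> b\<close> by simp
    ultimately have "\<Phi> (x (Suc i)) - \<Phi> (x i) \<le> \<eta> * (m (x (Suc i)) - m (x i))"
      using small by (intro \<delta>) auto
    with Suc show ?case by (simp add: algebra_simps)
  qed (simp add: x_def)
  from this[of n] have "\<Phi> b - \<Phi> a \<le> \<eta> * (m b - m a)"
    using \<open>0 < n\<close> by (simp add: x_def)
  also have "\<dots> \<le> \<eta> * (\<bar>m b - m a\<bar> + 1)"
    using \<open>0 < \<eta>\<close> by (intro mult_left_mono) auto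
  also have "\<dots> = e" by (simp add: \<eta>_def)
  finally show "\<Phi> b \<le> \<Phi> a + e" by simp
qed

lemma integral_le_AE:
  fixes f g :: "'a::euclidean_space \<Rightarrow> real"
  assumes f: "f integrable_on S" and g: "g integrable_on S"
    and "AE x in lebesgue. x \<in> S \<longrightarrow> f x \<le> g x"
  shows "integral S f \<le> integral S g"
proof -
  obtain N where N: "{x. \<not> (x \<in> S \<longrightarrow> f x \<le> g x)} \<subseteq> N" "N \<in> null_sets lebesgue"
    using assms(3) by (auto simp: eventually_ae_filter)
  then have neg: "negligible N" by (simp add: negligible_iff_null_sets)
  let ?f = "\<lambda>x. if x \<in> N then g x else f x"
  have "integral S f = integral S ?f" by (rule integral_spike[OF neg]) auto
  also have "\<dots> \<le> integral S g"
    by (rule integral_le[OF integrable_spike[OF f neg] g]) (use N in auto)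
  finally show ?thesis .
qed

text \<open>\<open>V\<close> is only continuous, so the differential inequality is set up for the
  integral \<open>\<psi> s\<close> from \<open>s\<close> to the fixed end point \<open>b\<close>;
  the hypothesis bounds \<open>W s\<close>, which is minus its derivative, from below. Subtracting
  the equilibrium value \<open>c / \<mu>\<close> makes the inequality homogeneous.\<close>

lemma gronwall_integral_decay:
  fixes V :: "real \<Rightarrow> real"
  assumes "a \<le> b" and cont: "continuous_on {a..b} V" and "0 < \<mu>"
    and decay: "\<And>s. s \<in> {a..b} \<Longrightarrow> V b - V s \<le> integral {s..b} (\<lambda>\<tau>. c - \<mu> * V \<tau>)"
  shows "V b \<le> exp (- \<mu> * (b - a)) * (V a - c / \<mu>) + c / \<mu>"
proof -
  define W where "W t = V t - c / \<mu>" for t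
  have contW: "continuous_on {a..b} W" unfolding W_def by (intro continuous_intros cont)
  define \<psi> where "\<psi> s = integral {s..b} W" for s
  have \<psi>: "(\<psi> has_real_derivative - W s) (at s within {a..b})" if "s \<in> {a..b}" for s
    unfolding \<psi>_def by (rule integral_has_real_derivative'[OF contW that])
  have W_decay: "W b + \<mu> * \<psi> s \<le> W s" if "s \<in> {a..b}" for s
  proof -
    have "(\<lambda>\<tau>. c - \<mu> * V \<tau>) = (\<lambda>\<tau>. - \<mu> * W \<tau>)"
      using \<open>0 < \<mu>\<close> by (auto simp: W_def algebra_simps)
    then have "integral {s..b} (\<lambda>\<tau>. c - \<mu> * V \<tau>) = - \<mu> * \<psi> s"
      unfolding \<psi>_def by simp
    with decay[OF that] show ?thesis by (simp add: W_def)
  qed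
  \<comment> \<open>the factor \<open>exp (\<mu> * s)\<close> integrates the inequality \<open>\<psi>' + \<mu> * \<psi> \<le> - W b\<close>\<close>
  define D where "D s = exp (\<mu> * s) * \<psi> s + W b * exp (\<mu> * s) / \<mu>" for s
  have D: "(D has_real_derivative exp (\<mu> * s) * (W b + \<mu> * \<psi> s - W s)) (at s within {a..b})"
    if "s \<in> {a..b}" for s
    unfolding D_def using \<open>0 < \<mu>\<close>
    by (auto intro!: derivative_eq_intros \<psi>[OF that] simp: algebra_simps)
  have "D b \<le> D a"
  proof (rule DERIV_nonpos_imp_decreasing_open[OF \<open>a \<le> b\<close>])
    fix s assume s: "a < s" "s < b"
    then have "(D has_real_derivative exp (\<mu> * s) * (W b + \<mu> * \<psi> s - W s)) (at s)"
      using D[of s] by (simp add: at_within_Icc_at)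
    moreover have "exp (\<mu> * s) * (W b + \<mu> * \<psi> s - W s) \<le> 0"
      using W_decay[of s] s by (intro mult_nonneg_nonpos) auto
    ultimately show "\<exists>y. (D has_real_derivative y) (at s) \<and> y \<le> 0" by blast
  next
    show "continuous_on {a..b} D"
      using D by (meson DERIV_continuous continuous_on_eq_continuous_within)
  qed
  then have "W b * exp (\<mu> * b) \<le> exp (\<mu> * a) * (\<mu> * \<psi> a) + W b * exp (\<mu> * a)"
    using \<open>0 < \<mu>\<close> by (simp add: D_def \<psi>_def field_simps)
  also have "\<dots> \<le> exp (\<mu> * a) * W a"
    using W_decay[of a] \<open>a \<le> b\<close> mult_left_mono[of "W b + \<mu> * \<psi> a" "W a" "exp (\<mu> * a)"]
    by (simp add: algebra_simps)
  finally have "W b \<le> exp (\<mu> * a) / exp (\<mu> * b) * W a"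
    by (simp add: pos_le_divide_eq)
  also have "exp (\<mu> * a) / exp (\<mu> * b) = exp (- \<mu> * (b - a))"
    by (simp add: exp_diff[symmetric] algebra_simps)
  finally show ?thesis by (simp add: W_def algebra_simps)
qed

text \<open>Symmetry of \<open>Q\<close> makes \<open>V t - V s\<close> exactly
  \<open>Q (z t + z s)\<close> paired with the integral of \<open>v\<close> over the step. Replacing
  \<open>z t + z s\<close> by twice \<open>z \<tau>\<close> brings in the dissipation inequality, at
  a cost of \<open>\<eta> * norm (v \<tau>)\<close> on short steps by uniform continuity.\<close>

lemma quadratic_lyapunov_decay:
  fixes z v :: "real \<Rightarrow> 'a::euclidean_space" and Q :: "'a \<Rightarrow> 'a"
  assumes "t0 \<le> T" and Q: "linear Q" "\<And>x y. x \<bullet> Q y = Q x \<bullet> y"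
    and v: "v absolutely_integrable_on {t0..T}"
    and z: "\<And>t. t \<in> {t0..T} \<Longrightarrow> z t = z t0 + integral {t0..t} v"
    and "0 < \<mu>"
    and dissipation: "AE t in lebesgue. t \<in> {t0..T} \<longrightarrow> 2 * (Q (z t) \<bullet> v t) \<le> c - \<mu> * (z t \<bullet> Q (z t))"
  shows "z T \<bullet> Q (z T) \<le> exp (- \<mu> * (T - t0)) * (z t0 \<bullet> Q (z t0) - c / \<mu>) + c / \<mu>"
proof -
  define V where "V t = z t \<bullet> Q (z t)" for t
  have int_v: "v integrable_on {a..b}" and int_nv: "(\<lambda>t. norm (v t)) integrable_on {a..b}"
    if "t0 \<le> a" "b \<le> T" for a b
  proof -
    have "v absolutely_integrable_on {a..b}"
      by (rule set_integrable_subset[OF v]) (use that in auto)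
    then show "v integrable_on {a..b}" "(\<lambda>t. norm (v t)) integrable_on {a..b}"
      by (auto simp: absolutely_integrable_on_def)
  qed
  have "continuous_on {t0..T} (\<lambda>t. z t0 + integral {t0..t} v)"
    by (intro continuous_intros indefinite_integral_continuous_1 int_v) auto
  then have contz: "continuous_on {t0..T} z"
    by (rule continuous_on_eq) (rule z[symmetric])
  have contQ: "continuous_on A (\<lambda>t. Q (f t))" if "continuous_on A f" for A and f :: "real \<Rightarrow> 'a"
    using linear_continuous_on_compose[OF that Q(1)] .
  have contV: "continuous_on {t0..T} V"
    unfolding V_def by (intro continuous_intros contz contQ)
  obtain B where "0 < B" and B: "\<And>x. norm (Q x) \<le> B * norm x"
    using linear_bounded_pos[OF Q(1)] by blast
  have z_diff: "z t - z s = integral {s..t} v" if "t0 \<le> s" "s \<le> t" "t \<le> T" for s t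
  proof -
    have "integral {t0..s} v + integral {s..t} v = integral {t0..t} v"
      using that by (intro Henstock_Kurzweil_Integration.integral_combine int_v) auto
    then show ?thesis using z[of s] z[of t] that by (simp add: algebra_simps)
  qed
  have uc: "uniformly_continuous_on {t0..T} z"
    by (rule compact_uniformly_continuous[OF contz]) simp
  have decay: "V T - V s0 \<le> integral {s0..T} (\<lambda>\<tau>. c - \<mu> * V \<tau>)" if s0: "s0 \<in> {t0..T}" for s0
  proof -
    define g where "g \<tau> = c - \<mu> * V \<tau>" for \<tau>
    have int_g: "g integrable_on {a..b}" if "t0 \<le> a" "b \<le> T" for a b
      unfolding g_def
      by (rule integrable_continuous_real, intro continuous_intros continuous_on_subset[OF contV]) (use that in auto)
    define \<Phi> where "\<Phi> t = V t - integral {s0..t} g" for t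
    define m where "m t = integral {s0..t} (\<lambda>\<tau>. norm (v \<tau>))" for t
    have "\<Phi> T \<le> \<Phi> s0"
    proof (rule nonincreasing_by_small_steps[where \<Phi>=\<Phi> and m=m and a=s0 and b=T])
      fix \<eta> :: real assume "0 < \<eta>"
      \<comment> \<open>Both \<open>z t\<close> and \<open>z s\<close> deviate from
        \<open>z \<tau>\<close>, and \<open>Q\<close> magnifies by at most \<open>B\<close>; this
        tolerance leaves a total deviation of at most \<open>\<eta>\<close>.\<close>
      then have "0 < \<eta> / (2 * B)" using \<open>0 < B\<close> by simp
      with uc obtain \<delta> where "0 < \<delta>" and \<delta>: "\<And>s t. s \<in> {t0..T} \<Longrightarrow> t \<in> {t0..T} \<Longrightarrow> dist t s < \<delta> \<Longrightarrow> dist (z t) (z s) < \<eta> / (2 * B)"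
        unfolding uniformly_continuous_on_def by metis
      have "\<Phi> t - \<Phi> s \<le> \<eta> * (m t - m s)" if st: "s0 \<le> s" "s \<le> t" "t \<le> T" "t - s < \<delta>" for s t
      proof -
        have "t0 \<le> s0" using s0 by simp
        have int_on: "t0 \<le> s" "t \<le> T" using st s0 by auto
        let ?y = "z t + z s"
        have "V t - V s = ?y \<bullet> Q (z t - z s)"
          using Q(2)[of "z s" "z t"] by (simp add: V_def linear_diff[OF Q(1)] inner_simps inner_commute)
        also have "\<dots> = Q ?y \<bullet> integral {s..t} v"
          using z_diff[of s t] int_on st by (simp add: Q(2))
        also have "\<dots> = integral {s..t} (\<lambda>\<tau>. Q ?y \<bullet> v \<tau>)"
          using integral_linear[OF int_v[OF int_on] bounded_linear_inner_right[of "Q ?y"]] by (simp add: o_def)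
        also have "\<dots> \<le> integral {s..t} (\<lambda>\<tau>. g \<tau> + \<eta> * norm (v \<tau>))"
        proof (rule integral_le_AE)
          show "(\<lambda>\<tau>. Q ?y \<bullet> v \<tau>) integrable_on {s..t}"
            using integrable_linear[OF int_v[OF int_on] bounded_linear_inner_right[of "Q ?y"]] by (simp add: o_def)
          show "(\<lambda>\<tau>. g \<tau> + \<eta> * norm (v \<tau>)) integrable_on {s..t}"
            by (intro integrable_add int_g[OF int_on] integrable_on_mult_right int_nv[OF int_on])
          show "AE \<tau> in lebesgue. \<tau> \<in> {s..t} \<longrightarrow> Q ?y \<bullet> v \<tau> \<le> g \<tau> + \<eta> * norm (v \<tau>)"
            using dissipation
          proof eventually_elim
            case (elim \<tau>)
            show ?case
            proof
              assume \<tau>: "\<tau> \<in> {s..t}"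
              have "dist (z t) (z \<tau>) < \<eta> / (2 * B)" "dist (z s) (z \<tau>) < \<eta> / (2 * B)"
                by (rule \<delta>; use \<tau> st int_on in \<open>auto simp: dist_real_def\<close>)+
              then have "norm (?y - 2 *\<^sub>R z \<tau>) \<le> \<eta> / B"
                using norm_triangle_ineq[of "z t - z \<tau>" "z s - z \<tau>"]
                by (simp add: dist_norm algebra_simps scaleR_2)
              then have "norm (Q (?y - 2 *\<^sub>R z \<tau>)) \<le> B * (\<eta> / B)"
                using B[of "?y - 2 *\<^sub>R z \<tau>"] \<open>0 < B\<close> by (meson mult_left_mono less_imp_le order_trans)
              then have "Q (?y - 2 *\<^sub>R z \<tau>) \<bullet> v \<tau> \<le> \<eta> * norm (v \<tau>)"
                using norm_cauchy_schwarz[of "Q (?y - 2 *\<^sub>R z \<tau>)" "v \<tau>"] \<open>0 < B\<close>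
                by (smt (verit) mult_right_mono nonzero_mult_div_cancel_left norm_ge_zero times_divide_eq_right)
              moreover have "Q ?y \<bullet> v \<tau> = 2 * (Q (z \<tau>) \<bullet> v \<tau>) + Q (?y - 2 *\<^sub>R z \<tau>) \<bullet> v \<tau>"
                by (simp add: linear_diff[OF Q(1)] linear_scale[OF Q(1)] inner_simps)
              moreover have "2 * (Q (z \<tau>) \<bullet> v \<tau>) \<le> g \<tau>"
                using elim \<tau> int_on by (auto simp: g_def V_def)
              ultimately show "Q ?y \<bullet> v \<tau> \<le> g \<tau> + \<eta> * norm (v \<tau>)" by linarith
            qed
          qed
        qed
        also have "\<dots> = integral {s..t} g + \<eta> * integral {s..t} (\<lambda>\<tau>. norm (v \<tau>))"
          using int_g[OF int_on] int_nv[OF int_on]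
          by (subst Henstock_Kurzweil_Integration.integral_add) (auto intro!: integrable_on_mult_right)
        finally have "V t - V s \<le> integral {s..t} g + \<eta> * integral {s..t} (\<lambda>\<tau>. norm (v \<tau>))" .
        moreover have "integral {s0..s} g + integral {s..t} g = integral {s0..t} g"
          using st \<open>t0 \<le> s0\<close> by (intro Henstock_Kurzweil_Integration.integral_combine int_g) auto
        moreover have "m s + integral {s..t} (\<lambda>\<tau>. norm (v \<tau>)) = m t"
          unfolding m_def using st \<open>t0 \<le> s0\<close> by (intro Henstock_Kurzweil_Integration.integral_combine int_nv) auto
        then have "m t - m s = integral {s..t} (\<lambda>\<tau>. norm (v \<tau>))" by simp
        ultimately show ?thesis by (simp add: \<Phi>_def)
      qed
      with \<open>0 < \<delta>\<close> show "\<exists>\<delta>>0. \<forall>s t. s0 \<le> s \<and> s \<le> t \<and> t \<le> T \<and> t - s < \<delta> \<longrightarrow> \<Phi> t - \<Phi> s \<le> \<eta> * (m t - m s)"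
        by blast
    qed (use s0 in auto)
    then show ?thesis by (simp add: \<Phi>_def g_def[abs_def])
  qed
  show ?thesis
    using gronwall_integral_decay[OF \<open>t0 \<le> T\<close> contV \<open>0 < \<mu>\<close> decay] by (simp add: V_def)
qed

section \<open>Bounds that pass to the Filippov set\<close>

lemma filippov_set_inner_le:
  fixes a :: "'a::euclidean_space"
  assumes "y \<in> filippov_set G z" "\<And>\<epsilon>. 0 < \<epsilon> \<Longrightarrow> \<forall>\<^sub>F x in nhds z. a \<bullet> G x \<le> b + \<epsilon>"
  shows "a \<bullet> y \<le> b"
proof (rule field_le_epsilon)
  fix \<epsilon> :: real assume "0 < \<epsilon>"
  then obtain d where "0 < d" and d: "\<And>x. dist x z < d \<Longrightarrow> a \<bullet> G x \<le> b + \<epsilon>"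
    using assms(2) by (metis eventually_nhds_metric)
  \<comment> \<open>The empty null set suffices here, because the bound is assumed at all points
    near \<open>z\<close>.\<close>
  have "y \<in> closure (convex hull (G ` (ball z d - {})))"
    by (rule INT_D[OF INT_D[OF assms(1)[unfolded filippov_set_def]]]) (use \<open>0 < d\<close> in auto)
  also have "\<dots> \<subseteq> {x. a \<bullet> x \<le> b + \<epsilon>}"
    by (intro closure_minimal hull_minimal convex_halfspace_le closed_halfspace_le)
      (use d in \<open>auto simp: dist_commute\<close>)
  finally show "a \<bullet> y \<le> b + \<epsilon>" by simp
qed

lemma filippov_set_norm_le:
  assumes "y \<in> filippov_set G z" "\<And>x. dist x z < 1 \<Longrightarrow> norm (G x) \<le> B"
  shows "norm y \<le> B"
proof -
  have "y \<in> closure (convex hull (G ` (ball z 1 - {})))"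
    by (rule INT_D[OF INT_D[OF assms(1)[unfolded filippov_set_def]]]) auto
  also have "\<dots> \<subseteq> cball 0 B"
    by (intro closure_minimal hull_minimal) (use assms(2) in \<open>auto simp: dist_commute\<close>)
  finally show ?thesis by simp
qed

section \<open>Norms of the input and comparison functions\<close>

lemma is_norm_nonneg:
  assumes "is_norm N" shows "0 \<le> N x"
proof -
  have "N (x + (-1) *\<^sub>R x) \<le> N x + N ((-1) *\<^sub>R x)" "N ((-1) *\<^sub>R x) = \<bar>-1\<bar> * N x" "N 0 = 0"
    using assms unfolding is_norm_def by blast+
  then show ?thesis by simp
qed

text \<open>Triangle inequality over the basis expansion. Inputs are bounded and piecewise
  continuous in the Euclidean sense, whereas the stability estimate measures them by
  \<open>N\<close>; this is the bridge.\<close>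

lemma is_norm_le_norm:
  fixes N :: "'e::euclidean_space \<Rightarrow> real"
  assumes "is_norm N"
  obtains B where "0 < B" "\<And>x. N x \<le> B * norm x"
proof
  let ?B = "1 + (\<Sum>i\<in>Basis. N i)"
  note nn = is_norm_nonneg[OF assms]
  have N_sum: "N (\<Sum>i\<in>A. f i) \<le> (\<Sum>i\<in>A. N (f i))" if "finite A" for A and f :: "'e \<Rightarrow> 'e"
    using that
  proof induction
    case empty
    have "N 0 = 0" using assms unfolding is_norm_def by blast
    then show ?case by simp
  next
    case (insert i A)
    then show ?case using assms by (smt (verit) is_norm_def sum.insert)
  qed
  show "0 < ?B" using nn by (simp add: add_pos_nonneg sum_nonneg)
  fix x
  have "N x = N (\<Sum>i\<in>Basis. (x \<bullet> i) *\<^sub>R i)" by (simp add: euclidean_representation)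
  also have "\<dots> \<le> (\<Sum>i\<in>Basis. \<bar>x \<bullet> i\<bar> * N i)"
    using N_sum[of Basis "\<lambda>i. (x \<bullet> i) *\<^sub>R i"] assms by (simp add: is_norm_def)
  also have "\<dots> \<le> (\<Sum>i\<in>Basis. norm x * N i)"
    by (intro sum_mono mult_right_mono nn Basis_le_norm)
  also have "\<dots> \<le> ?B * norm x" by (simp add: algebra_simps sum_distrib_left)
  finally show "N x \<le> ?B * norm x" .
qed

lemma is_norm_continuous:
  fixes N :: "'e::euclidean_space \<Rightarrow> real"
  assumes "is_norm N" shows "continuous_on UNIV N"
proof -
  obtain B where "0 < B" and B: "\<And>x. N x \<le> B * norm x"
    using is_norm_le_norm[OF assms] by blast
  have diff: "N x - N y \<le> B * dist x y" for x y
  proof -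
    have "N (y + (x - y)) \<le> N y + N (x - y)" using assms unfolding is_norm_def by blast
    then show ?thesis using B[of "x - y"] by (simp add: dist_norm)
  qed
  have "dist (N x) (N y) \<le> B * dist x y" for x y
    using diff[of x y] diff[of y x] by (simp add: dist_real_def abs_le_iff dist_commute)
  then have "B-lipschitz_on UNIV N" using \<open>0 < B\<close> by (intro lipschitz_onI) auto
  then show ?thesis by (rule lipschitz_on_continuous_on)
qed

lemma class_K_linear: "0 < c \<Longrightarrow> class_K (\<lambda>r. c * r)"
  unfolding class_K_def by (auto intro!: continuous_intros strict_mono_onI)

lemma class_KL_exp:
  assumes "0 < c" "0 < \<mu>"
  shows "class_KL (\<lambda>r s. c * exp (- \<mu> * s) * r)"
proof -
  have "((\<lambda>s. c * exp (- \<mu> * s) * r) \<longlongrightarrow> 0) at_top" for r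
    using \<open>0 < \<mu>\<close> by real_asymp
  moreover have "class_K (\<lambda>r. c * exp (- \<mu> * s) * r)" for s
    using class_K_linear[of "c * exp (- \<mu> * s)"] \<open>0 < c\<close> by simp
  moreover have "antimono_on {0..} (\<lambda>s. c * exp (- \<mu> * s) * r)" if "0 \<le> r" for r
    using that assms by (intro monotone_onI mult_right_mono mult_left_mono) auto
  ultimately show ?thesis
    unfolding class_KL_def by (auto intro!: continuous_intros simp: case_prod_beta')
qed

section \<open>Continuation of solutions\<close>

lemma inclusion_solution_glue:
  fixes z1 z2 :: "real \<Rightarrow> 'a::euclidean_space"
  assumes "t0 < T" and z1: "inclusion_solution S t0 {t0..T} z1"
    and z2: "inclusion_solution S T {T..} z2" and "z2 T = z1 T"
  shows "inclusion_solution S t0 {t0..} (\<lambda>t. if t < T then z1 t else z2 t)"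
proof -
  obtain v1 where v1: "\<And>t. t \<in> {t0..T} \<Longrightarrow> v1 absolutely_integrable_on {t0..t}"
      "\<And>t. t \<in> {t0..T} \<Longrightarrow> z1 t = z1 t0 + integral {t0..t} v1"
      "AE t in lebesgue. t \<in> {t0..T} \<longrightarrow> v1 t \<in> S t (z1 t)"
    using z1 unfolding inclusion_solution_def by blast
  obtain v2 where v2: "\<And>t. t \<in> {T..} \<Longrightarrow> v2 absolutely_integrable_on {T..t}"
      "\<And>t. t \<in> {T..} \<Longrightarrow> z2 t = z2 T + integral {T..t} v2"
      "AE t in lebesgue. t \<in> {T..} \<longrightarrow> v2 t \<in> S t (z2 t)"
    using z2 unfolding inclusion_solution_def by blast
  let ?v = "\<lambda>t. if t < T then v1 t else v2 t"
  let ?z = "\<lambda>t. if t < T then z1 t else z2 t"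
  \<comment> \<open>At \<open>T\<close> the glued velocity already takes the value of
    \<open>v2\<close>; a single point does not affect integrals over \<open>{t0..T}\<close>.\<close>
  have left: "?v absolutely_integrable_on {t0..t}" "integral {t0..t} ?v = integral {t0..t} v1"
    if "t \<in> {t0..T}" for t
  proof -
    show "?v absolutely_integrable_on {t0..t}"
      by (rule absolutely_integrable_spike[OF v1(1)[OF that], of "{T}"]) (use that in auto)
    show "integral {t0..t} ?v = integral {t0..t} v1"
      by (rule integral_spike[of "{T}"]) (use that in auto)
  qed
  have right: "?v absolutely_integrable_on {t0..t}" "z2 t = z1 t0 + integral {t0..t} ?v"
    if "T \<le> t" for t
  proof -
    have "?v absolutely_integrable_on {T..t}"
      by (rule absolutely_integrable_spike[OF v2(1), of t "{}"]) (use that in auto)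
    then have "?v absolutely_integrable_on ({t0..T} \<union> {T..t})"
      using left(1)[of T] \<open>t0 < T\<close> by (intro absolutely_integrable_Un) auto
    also have "{t0..T} \<union> {T..t} = {t0..t}" using that \<open>t0 < T\<close> by auto
    finally show int: "?v absolutely_integrable_on {t0..t}" .
    have "integral {t0..T} ?v + integral {T..t} ?v = integral {t0..t} ?v"
      using that \<open>t0 < T\<close>
      by (intro Henstock_Kurzweil_Integration.integral_combine set_lebesgue_integral_eq_integral(1)[OF int]) auto
    moreover have "integral {T..t} ?v = integral {T..t} v2"
      by (rule Henstock_Kurzweil_Integration.integral_cong) auto
    ultimately show "z2 t = z1 t0 + integral {t0..t} ?v"
      using left(2)[of T] v1(2)[of T] v2(2)[of t] that \<open>t0 < T\<close> \<open>z2 T = z1 T\<close> by (simp add: add.assoc)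
  qed
  have "?v absolutely_integrable_on {t0..t} \<and> ?z t = ?z t0 + integral {t0..t} ?v" if "t \<in> {t0..}" for t
  proof (cases "t < T")
    case True
    then show ?thesis using left[of t] v1(2)[of t] that \<open>t0 < T\<close> by simp
  next
    case False
    then show ?thesis using right[of t] \<open>t0 < T\<close> by simp
  qed
  moreover have "AE t in lebesgue. t \<in> {t0..} \<longrightarrow> ?v t \<in> S t (?z t)"
    using v1(3) v2(3) by eventually_elim auto
  ultimately show ?thesis unfolding inclusion_solution_def by blast
qed

text \<open>A bounded velocity is integrable up to \<open>T\<close>, so the integral formula
  supplies the missing value at \<open>T\<close> and remains valid there.\<close>

lemma inclusion_solution_extend_right:
  fixes z :: "real \<Rightarrow> 'a::euclidean_space"
  assumes "t0 < T" and z: "inclusion_solution S t0 {t0..<T} z"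
    and bound: "\<And>t y. t \<in> {t0..<T} \<Longrightarrow> y \<in> S t (z t) \<Longrightarrow> norm y \<le> B"
  obtains z' where "\<And>t. t \<in> {t0..<T} \<Longrightarrow> z' t = z t" "inclusion_solution S t0 {t0..T} z'"
proof -
  obtain v where v: "\<And>t. t \<in> {t0..<T} \<Longrightarrow> v absolutely_integrable_on {t0..t}"
      "\<And>t. t \<in> {t0..<T} \<Longrightarrow> z t = z t0 + integral {t0..t} v"
      "AE t in lebesgue. t \<in> {t0..<T} \<longrightarrow> v t \<in> S t (z t)"
    using z unfolding inclusion_solution_def by blast
  have "v absolutely_integrable_on {t0..<T}"
    unfolding set_integrable_def
  proof (rule integrable_dominated_convergence)
    \<comment> \<open>These times increase to \<open>T\<close> and start at \<open>t0\<close> for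
      \<open>n = 0\<close>, so each truncated velocity is integrable by the solution
      property.\<close>
    let ?T = "\<lambda>n. T - (T - t0) / real (Suc n)"
    let ?f = "\<lambda>n t. indicator {t0..?T n} t *\<^sub>R v t"
    have T: "?T n \<in> {t0..<T}" for n
      using \<open>t0 < T\<close> divide_left_mono[of 1 "real (Suc n)" "T - t0"] by simp
    show meas: "?f n \<in> borel_measurable lebesgue" for n
      using v(1)[OF T[of n]] unfolding set_integrable_def by (rule borel_measurable_integrable)
    have lim: "(\<lambda>n. ?f n t) \<longlonglongrightarrow> indicator {t0..<T} t *\<^sub>R v t" for t
    proof -
      have "?T \<longlonglongrightarrow> T - 0"
        by (intro tendsto_intros LIMSEQ_Suc lim_const_over_n)
      have "\<forall>\<^sub>F n in sequentially. ?f n t = indicator {t0..<T} t *\<^sub>R v t"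
      proof (cases "t < T")
        case True
        then have "\<forall>\<^sub>F n in sequentially. t < ?T n"
          using order_tendstoD(1)[OF \<open>?T \<longlonglongrightarrow> T - 0\<close>] by simp
        then show ?thesis by eventually_elim (use True in \<open>auto simp: indicator_def\<close>)
      next
        case False
        then have "?T n < t" for n using T[of n] by auto
        then show ?thesis using False by (auto simp: indicator_def not_le)
      qed
      then show ?thesis
        by (rule tendsto_eventually)
    qed
    show "(\<lambda>t. indicator {t0..<T} t *\<^sub>R v t) \<in> borel_measurable lebesgue"
      by (rule borel_measurable_LIMSEQ_metric[OF meas lim])
    show "AE t in lebesgue. (\<lambda>n. ?f n t) \<longlonglongrightarrow> indicator {t0..<T} t *\<^sub>R v t"
      using lim by simp
    show "integrable lebesgue (\<lambda>t. indicator {t0..T} t *\<^sub>R \<bar>B\<bar>)"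
      using absolutely_integrable_on_const[of "{t0..T}" "\<bar>B\<bar>"] unfolding set_integrable_def by simp
    show "AE t in lebesgue. norm (?f n t) \<le> indicator {t0..T} t *\<^sub>R \<bar>B\<bar>" for n
      using v(3)
    proof eventually_elim
      case (elim t)
      then show ?case using T[of n] bound[of t "v t"] by (auto simp: indicator_def)
    qed
  qed
  then have int: "v absolutely_integrable_on {t0..T}"
    by (rule absolutely_integrable_spike_set) (rule negligible_subset[of "{T}"], auto)+
  define z' where "z' t = z t0 + integral {t0..t} v" for t
  have eq: "z' t = z t" if "t \<in> {t0..<T}" for t
    unfolding z'_def by (rule v(2)[OF that, symmetric])
  have z0: "z' t0 = z t0" by (simp add: z'_def)
  have "AE t in lebesgue. t \<in> {t0..T} \<longrightarrow> v t \<in> S t (z' t)"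
  proof -
    have "AE t in lebesgue. t \<noteq> T" by (intro AE_completion AE_lborel_singleton)
    with v(3) show ?thesis by eventually_elim (use eq in auto)
  qed
  moreover have "v absolutely_integrable_on {t0..t}" if "t \<in> {t0..T}" for t
    by (rule set_integrable_subset[OF int]) (use that in auto)
  ultimately have "inclusion_solution S t0 {t0..T} z'"
    unfolding inclusion_solution_def by (intro exI[of _ v]) (simp add: z'_def)
  with eq show ?thesis by (rule that)
qed

text \<open>With \<open>V z = z \<bullet> Q z\<close>, dissipation and
  \<open>V \<le> M * (norm z)\<^sup>2\<close> give decay of \<open>V\<close> at rate
  \<open>1 / M\<close> up to the input term. Comparison with \<open>m * (norm z)\<^sup>2\<close> and
  a square root halve the rate and produce the factor \<open>sqrt (M / m)\<close> in
  \<open>\<beta>\<close> and the slope of \<open>\<gamma>\<close>; the state and input parts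
  separate because a sum of squares is at most the square of the sum.\<close>

theorem input_to_state_stable_quadratic_lyapunov:
  fixes F :: "real \<Rightarrow> 'a::euclidean_space \<Rightarrow> 'e::euclidean_space \<Rightarrow> 'a" and Q :: "'a \<Rightarrow> 'a"
  assumes N: "is_norm N" and Q: "linear Q" "\<And>x y. x \<bullet> Q y = Q x \<bullet> y"
    and m: "0 < m" "\<And>x. m * (norm x)\<^sup>2 \<le> x \<bullet> Q x"
    and M: "0 < M" "\<And>x. x \<bullet> Q x \<le> M * (norm x)\<^sup>2"
    and growth: "\<And>t z e. norm (F t z e) \<le> (C0 + C1 * N e) * (1 + norm z)"
    and "0 \<le> C1" and "0 < k"
    and dissipation: "\<And>t z e. 2 * (Q z \<bullet> F t z e) \<le> k * (N e)\<^sup>2 - (norm z)\<^sup>2"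
    and existence: "\<And>t0 e z0. 0 \<le> t0 \<Longrightarrow> piecewise_continuous e \<Longrightarrow> bounded (e ` {0..}) \<Longrightarrow>
      \<exists>z. z t0 = z0 \<and> filippov_solution (\<lambda>t z. F t z (e t)) t0 {t0..} z"
  shows "input_to_state_stable F N"
proof -
  define \<mu> where "\<mu> = 1 / M"
  have "0 < \<mu>" using M by (simp add: \<mu>_def)
  define \<beta> where "\<beta> r s = sqrt (M / m) * exp (- (\<mu> / 2) * s) * r" for r s
  define \<gamma> where "\<gamma> r = sqrt (k * M / m) * r" for r
  note N0 = is_norm_nonneg[OF N]
  have filippov_dissipation: "2 * (Q z \<bullet> y) \<le> k * (N e)\<^sup>2 - (norm z)\<^sup>2"
    if "y \<in> filippov_set (\<lambda>z. F t z e) z" for y z t e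
  proof -
    obtain B where "0 < B" and B: "\<And>x. norm (Q x) \<le> B * norm x"
      using linear_bounded_pos[OF Q(1)] by blast
    define c where "c = C0 + C1 * N e"
    \<comment> \<open>Dissipation pairs \<open>Q x\<close> with the field at the same
      \<open>x\<close>, but a half-space containing the Filippov set needs the fixed normal
      \<open>Q z\<close>. The last summand bounds the mismatch \<open>Q (z - x)\<close> through the
      growth condition and vanishes at \<open>x = z\<close>.\<close>
    define \<phi> where "\<phi> x = k * (N e)\<^sup>2 - (norm x)\<^sup>2 + 2 * (B * norm (z - x) * (c * (1 + norm x)))" for x
    have le: "(2 *\<^sub>R Q z) \<bullet> F t x e \<le> \<phi> x" for x
    proof -
      have "Q (z - x) \<bullet> F t x e \<le> norm (Q (z - x)) * norm (F t x e)"
        by (rule norm_cauchy_schwarz)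
      also have "\<dots> \<le> B * norm (z - x) * (c * (1 + norm x))"
        unfolding c_def using \<open>0 < B\<close> by (intro mult_mono B growth) auto
      finally show ?thesis
        using dissipation[of x t e] by (simp add: \<phi>_def linear_diff[OF Q(1)] inner_diff_left)
    qed
    have "(\<phi> \<longlongrightarrow> \<phi> z) (nhds z)"
      unfolding \<phi>_def by (intro tendsto_intros filterlim_ident)
    then have ev: "\<forall>\<^sub>F x in nhds z. \<phi> x < \<phi> z + \<epsilon>" if "0 < \<epsilon>" for \<epsilon>
      by (rule order_tendstoD) (use that in simp)
    have "(2 *\<^sub>R Q z) \<bullet> y \<le> \<phi> z"
    proof (rule filippov_set_inner_le[OF that])
      fix \<epsilon> :: real assume "0 < \<epsilon>"
      from ev[OF this] show "\<forall>\<^sub>F x in nhds z. (2 *\<^sub>R Q z) \<bullet> F t x e \<le> \<phi> z + \<epsilon>"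
        by eventually_elim (use le in \<open>smt (verit)\<close>)
    qed
    then show ?thesis by (simp add: \<phi>_def)
  qed
  \<comment> \<open>An abstract map \<open>S\<close> covers Filippov and Caratheodory solutions
    together. An arbitrary bound \<open>s\<close> on the input serves both the final supremum and
    the global bound used for continuation.\<close>
  have estimate: "norm (z t) \<le> \<beta> (norm (z t0)) (t - t0) + \<gamma> s"
    if z: "inclusion_solution S t0 I z" and "{t0..t} \<subseteq> I" and "t0 \<le> t"
      and S: "\<And>\<tau> y. y \<in> S \<tau> (z \<tau>) \<Longrightarrow> 2 * (Q (z \<tau>) \<bullet> y) \<le> k * (N (e \<tau>))\<^sup>2 - (norm (z \<tau>))\<^sup>2"
      and s: "\<And>\<tau>. \<tau> \<in> {t0..t} \<Longrightarrow> N (e \<tau>) \<le> s" for S I z t0 t e s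
  proof -
    obtain v where v: "\<And>t. t \<in> I \<Longrightarrow> v absolutely_integrable_on {t0..t}"
      "\<And>t. t \<in> I \<Longrightarrow> z t = z t0 + integral {t0..t} v"
      "AE t in lebesgue. t \<in> I \<longrightarrow> v t \<in> S t (z t)"
      using z unfolding inclusion_solution_def by blast
    have I: "\<tau> \<in> I" if "\<tau> \<in> {t0..t}" for \<tau> using \<open>{t0..t} \<subseteq> I\<close> that by blast
    have "0 \<le> s" using s[of t0] N0[of "e t0"] \<open>t0 \<le> t\<close> by simp
    have "AE \<tau> in lebesgue. \<tau> \<in> {t0..t} \<longrightarrow> 2 * (Q (z \<tau>) \<bullet> v \<tau>) \<le> k * s\<^sup>2 - \<mu> * (z \<tau> \<bullet> Q (z \<tau>))"
      using v(3)
    proof eventually_elim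
      case (elim \<tau>)
      show ?case
      proof
        assume \<tau>: "\<tau> \<in> {t0..t}"
        have "2 * (Q (z \<tau>) \<bullet> v \<tau>) \<le> k * (N (e \<tau>))\<^sup>2 - (norm (z \<tau>))\<^sup>2"
          using elim I[OF \<tau>] by (intro S) auto
        moreover have "k * (N (e \<tau>))\<^sup>2 \<le> k * s\<^sup>2"
          using s[OF \<tau>] N0 \<open>0 < k\<close> by (intro mult_left_mono power_mono) auto
        moreover have "\<mu> * (z \<tau> \<bullet> Q (z \<tau>)) \<le> (norm (z \<tau>))\<^sup>2"
          using M(2)[of "z \<tau>"] \<open>0 < M\<close> by (simp add: \<mu>_def field_simps)
        ultimately show "2 * (Q (z \<tau>) \<bullet> v \<tau>) \<le> k * s\<^sup>2 - \<mu> * (z \<tau> \<bullet> Q (z \<tau>))" by linarith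
      qed
    qed
    from quadratic_lyapunov_decay[OF \<open>t0 \<le> t\<close> Q v(1) v(2) \<open>0 < \<mu>\<close> this] I \<open>t0 \<le> t\<close>
    have "z t \<bullet> Q (z t) \<le> exp (- \<mu> * (t - t0)) * (z t0 \<bullet> Q (z t0) - k * s\<^sup>2 / \<mu>) + k * s\<^sup>2 / \<mu>"
      by auto
    also have "\<dots> \<le> exp (- \<mu> * (t - t0)) * (M * (norm (z t0))\<^sup>2) + k * M * s\<^sup>2"
    proof -
      have "exp (- \<mu> * (t - t0)) * (z t0 \<bullet> Q (z t0) - k * s\<^sup>2 / \<mu>) \<le> exp (- \<mu> * (t - t0)) * (M * (norm (z t0))\<^sup>2)"
        using M(2)[of "z t0"] \<open>0 < k\<close> \<open>0 < \<mu>\<close>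
        by (intro mult_left_mono) (auto intro: order_trans[of _ "z t0 \<bullet> Q (z t0)"])
      then show ?thesis by (simp add: \<mu>_def mult.commute mult.left_commute)
    qed
    finally have "m * (norm (z t))\<^sup>2 \<le> exp (- \<mu> * (t - t0)) * (M * (norm (z t0))\<^sup>2) + k * M * s\<^sup>2"
      using m(2)[of "z t"] by linarith
    then have "(norm (z t))\<^sup>2 \<le> (exp (- \<mu> * (t - t0)) * (M * (norm (z t0))\<^sup>2) + k * M * s\<^sup>2) / m"
      using \<open>0 < m\<close> by (simp add: pos_le_divide_eq mult.commute)
    also have "\<dots> = (\<beta> (norm (z t0)) (t - t0))\<^sup>2 + (\<gamma> s)\<^sup>2"
    proof -
      have "(exp (- (\<mu> / 2) * (t - t0)))\<^sup>2 = exp (- \<mu> * (t - t0))"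
        by (simp add: power2_eq_square exp_add[symmetric] algebra_simps mult_exp_exp)
      then show ?thesis
        using \<open>0 < m\<close> \<open>0 < M\<close> \<open>0 < k\<close> by (simp add: \<beta>_def \<gamma>_def power_mult_distrib add_divide_distrib mult_ac)
    qed
    also have "\<dots> \<le> (\<beta> (norm (z t0)) (t - t0) + \<gamma> s)\<^sup>2"
      using \<open>0 \<le> s\<close> \<open>0 < m\<close> \<open>0 < M\<close> \<open>0 < k\<close> by (simp add: power2_sum \<beta>_def \<gamma>_def)
    finally show ?thesis
      by (rule power2_le_imp_le) (use \<open>0 \<le> s\<close> \<open>0 < m\<close> \<open>0 < M\<close> \<open>0 < k\<close> in \<open>simp add: \<beta>_def \<gamma>_def\<close>)
  qed
  have bdd: "bdd_above ((\<lambda>\<tau>. N (e \<tau>)) ` {0..})" if e: "bounded (e ` {0..})" for e :: "real \<Rightarrow> 'e"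
  proof -
    obtain B where B: "0 < B" "\<And>x. N x \<le> B * norm x" using is_norm_le_norm[OF N] by blast
    obtain R where R: "\<And>t. 0 \<le> t \<Longrightarrow> norm (e t) \<le> R" using e by (auto simp: bounded_iff)
    show ?thesis
    proof (rule bdd_aboveI2)
      fix t :: real assume "t \<in> {0..}"
      then show "N (e t) \<le> B * R" using B(2)[of "e t"] R[of t] \<open>0 < B\<close> by (smt (verit) atLeast_iff mult_left_mono)
    qed
  qed
  have "class_KL \<beta>"
    unfolding \<beta>_def using \<open>0 < m\<close> \<open>0 < M\<close> \<open>0 < \<mu>\<close> by (intro class_KL_exp) auto
  moreover have "class_K \<gamma>"
    unfolding \<gamma>_def using \<open>0 < m\<close> \<open>0 < M\<close> \<open>0 < k\<close> by (intro class_K_linear) auto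
  \<comment> \<open>The estimate bounds the solution on \<open>{t0..<T}\<close>, and growth then
    bounds its velocity. It extends to \<open>T\<close> and is glued to a solution that starts
    there.\<close>
  moreover have "\<exists>z'. (\<forall>t\<in>{t0..<T}. z' t = z t) \<and> filippov_solution (\<lambda>t z. F t z (e t)) t0 {t0..} z'"
    if "0 \<le> t0" and e: "piecewise_continuous e" "bounded (e ` {0..})" and "t0 < T"
      and z: "filippov_solution (\<lambda>t z. F t z (e t)) t0 {t0..<T} z" for t0 e T z
  proof -
    obtain s where s: "\<And>\<tau>. 0 \<le> \<tau> \<Longrightarrow> N (e \<tau>) \<le> s" using bdd[OF e(2)] by (auto simp: bdd_above_def)
    define R where "R = \<beta> (norm (z t0)) 0 + \<gamma> s"
    have zR: "norm (z t) \<le> R" if t: "t \<in> {t0..<T}" for t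
    proof -
      have "norm (z t) \<le> \<beta> (norm (z t0)) (t - t0) + \<gamma> s"
        using z unfolding filippov_solution_def
        by (rule estimate[where e=e]) (use t \<open>0 \<le> t0\<close> s filippov_dissipation in auto)
      moreover have "\<beta> (norm (z t0)) (t - t0) \<le> \<beta> (norm (z t0)) 0"
        unfolding \<beta>_def using t \<open>0 < m\<close> \<open>0 < M\<close> \<open>0 < \<mu>\<close> by (intro mult_right_mono mult_left_mono) auto
      ultimately show ?thesis by (simp add: R_def)
    qed
    obtain z1 where z1: "\<And>t. t \<in> {t0..<T} \<Longrightarrow> z1 t = z t"
      "inclusion_solution (\<lambda>t. filippov_set (\<lambda>z. F t z (e t))) t0 {t0..T} z1"
    proof (rule inclusion_solution_extend_right[OF \<open>t0 < T\<close> z[unfolded filippov_solution_def]])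
      fix t y assume t: "t \<in> {t0..<T}" and y: "y \<in> filippov_set (\<lambda>z. F t z (e t)) (z t)"
      \<comment> \<open>Filippov values at \<open>z t\<close> are limits of convex combinations of
        field values within distance \<open>1\<close>, where the state has norm at most
        \<open>1 + R\<close>.\<close>
      show "norm y \<le> (\<bar>C0\<bar> + C1 * s) * (1 + (1 + R))"
      proof (rule filippov_set_norm_le[OF y])
        fix x assume "dist x (z t) < 1"
        then have "norm x \<le> 1 + R"
          using zR[OF t] norm_triangle_sub[of x "z t"] by (simp add: dist_norm)
        have "0 \<le> s" using s[of t0] N0[of "e t0"] \<open>0 \<le> t0\<close> by simp
        have "norm (F t x (e t)) \<le> (C0 + C1 * N (e t)) * (1 + norm x)" by (rule growth)
        also have "\<dots> \<le> (\<bar>C0\<bar> + C1 * s) * (1 + (1 + R))"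
          using s[of t] t \<open>0 \<le> t0\<close> \<open>0 \<le> C1\<close> \<open>norm x \<le> 1 + R\<close> \<open>0 \<le> s\<close> N0
          by (intro mult_mono add_mono mult_left_mono) auto
        finally show "norm (F t x (e t)) \<le> (\<bar>C0\<bar> + C1 * s) * (1 + (1 + R))" .
      qed
    qed blast
    obtain z2 where z2: "z2 T = z1 T" "filippov_solution (\<lambda>t z. F t z (e t)) T {T..} z2"
      using existence[of T e "z1 T"] e \<open>0 \<le> t0\<close> \<open>t0 < T\<close> by auto
    show ?thesis
      using inclusion_solution_glue[OF \<open>t0 < T\<close> z1(2) z2(2)[unfolded filippov_solution_def] z2(1)] z1(1)
      by (intro exI[of _ "\<lambda>t. if t < T then z1 t else z2 t"]) (auto simp: filippov_solution_def)
  qed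
  moreover have "norm (z t) \<le> \<beta> (norm (z t0)) (t - t0) + \<gamma> (SUP \<tau>\<in>{t0..t}. N (e \<tau>))"
    if "0 \<le> t0" and e: "bounded (e ` {0..})" and t: "t \<in> {t0..T}"
      and z: "filippov_solution (\<lambda>t z. F t z (e t)) t0 {t0..T} z \<or>
        caratheodory_solution (\<lambda>t z. F t z (e t)) t0 {t0..T} z" for t0 e T t z
  proof -
    have sup: "N (e \<tau>) \<le> (SUP \<tau>\<in>{t0..t}. N (e \<tau>))" if "\<tau> \<in> {t0..t}" for \<tau>
      using that \<open>0 \<le> t0\<close> by (intro cSUP_upper bdd_above_mono[OF bdd[OF e]]) auto
    from z show ?thesis
    proof
      assume "filippov_solution (\<lambda>t z. F t z (e t)) t0 {t0..T} z"
      then show ?thesis unfolding filippov_solution_def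
        by (rule estimate[where e=e]) (use t sup filippov_dissipation in auto)
    next
      assume "caratheodory_solution (\<lambda>t z. F t z (e t)) t0 {t0..T} z"
      then show ?thesis unfolding caratheodory_solution_def
        by (rule estimate[where e=e]) (use t sup dissipation in auto)
    qed
  qed
  ultimately show ?thesis
    unfolding input_to_state_stable_def
    by (intro exI[of _ \<beta>] exI[of _ \<gamma>] conjI allI impI ballI existence) blast+
qed

section \<open>The quadratic form and the sign vector\<close>

lemma inner_transpose_vector: "(transpose M *v x) \<bullet> y = x \<bullet> (M *v y)" for M :: "real^'n^'m"
  by (simp add: dot_lmul_matrix)

lemma matrix_vector_mult_norm_le:
  fixes M :: "real^'n^'m"
  obtains c where "0 < c" "\<And>x. norm (M *v x) \<le> c * norm x"
  using linear_bounded_pos[OF matrix_vector_mul_linear[of M]] by blast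

lemma minus_matrix_vector: "(- M) *v x = - (M *v x)" for M :: "real^'n^'m"
  by (simp add: matrix_vector_mult_def vec_eq_iff sum_negf)

lemma norm_sign_vec_le: "norm (sign_vec w) \<le> CARD('m)" for w :: "real^'m"
proof -
  have "norm (sign_vec w) \<le> (\<Sum>i\<in>UNIV. \<bar>sgn (w $ i)\<bar>)"
    using norm_le_l1_cart[of "sign_vec w"] by (simp add: sign_vec_def)
  also have "\<dots> \<le> (\<Sum>i\<in>(UNIV::'m set). 1)" by (intro sum_mono) (simp add: abs_sgn_eq)
  finally show ?thesis by simp
qed

text \<open>The right-hand side is the l1 norm of \<open>w\<close>, which dominates the Euclidean
  norm.\<close>

lemma norm_le_inner_sign_vec: "norm w \<le> w \<bullet> sign_vec w" for w :: "real^'m"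
proof -
  have "w \<bullet> sign_vec w = (\<Sum>i\<in>UNIV. \<bar>w $ i\<bar>)"
    by (simp add: inner_vec_def sign_vec_def abs_sgn mult.commute)
  then show ?thesis using norm_le_l1_cart[of w] by simp
qed

lemma borel_measurable_sign_vec: "(sign_vec :: real^'m \<Rightarrow> real^'m) \<in> borel_measurable borel"
proof -
  have "sign_vec = (\<lambda>w::real^'m. \<Sum>i\<in>UNIV. sgn (w $ i) *\<^sub>R axis i 1)"
    by (rule ext) (simp add: vec_eq_iff sign_vec_def axis_def if_distrib[of "(*) _"] cong: if_cong)
  moreover have "(\<lambda>w::real^'m. \<Sum>i\<in>UNIV. sgn (w $ i) *\<^sub>R (axis i 1 :: real^'m)) \<in> borel_measurable borel"
    by measurable
  ultimately show ?thesis by (simp only:)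
qed

text \<open>The lower constant is the minimum of the form on the unit sphere, extended by
  homogeneity; the upper one is an operator bound for \<open>P\<close>.\<close>

lemma positive_definite_bounds:
  fixes P :: "real^'n^'n"
  assumes "\<And>x. x \<noteq> 0 \<Longrightarrow> 0 < x \<bullet> (P *v x)"
  obtains m M where "0 < m" "\<And>x. m * (norm x)\<^sup>2 \<le> x \<bullet> (P *v x)"
    "0 < M" "\<And>x. x \<bullet> (P *v x) \<le> M * (norm x)\<^sup>2"
proof -
  have cont: "continuous_on (sphere 0 1) (\<lambda>x. x \<bullet> (P *v x))"
    by (intro continuous_intros matrix_vector_mult_linear_continuous_on)
  have "axis undefined 1 \<in> sphere (0::real^'n) 1" by simp
  then have "sphere (0::real^'n) 1 \<noteq> {}" by blast
  then obtain x0 where x0: "x0 \<in> sphere 0 1" "\<And>x. x \<in> sphere 0 1 \<Longrightarrow> x0 \<bullet> (P *v x0) \<le> x \<bullet> (P *v x)"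
    using continuous_attains_inf[OF compact_sphere _ cont] by blast
  define m where "m = x0 \<bullet> (P *v x0)"
  have "0 < m" unfolding m_def using x0(1) by (intro assms) auto
  have lower: "m * (norm x)\<^sup>2 \<le> x \<bullet> (P *v x)" for x
  proof (cases "x = 0")
    case False
    have "m \<le> (x /\<^sub>R norm x) \<bullet> (P *v (x /\<^sub>R norm x))"
      unfolding m_def using False by (intro x0(2)) simp
    also have "\<dots> = (x \<bullet> (P *v x)) / (norm x)\<^sup>2"
      by (simp add: matrix_vector_mult_scaleR power2_eq_square divide_simps)
    finally show ?thesis using False by (simp add: pos_le_divide_eq)
  qed simp
  obtain c where c: "0 < c" "\<And>x. norm (P *v x) \<le> c * norm x"
    using matrix_vector_mult_norm_le[of P] by blast
  have "x \<bullet> (P *v x) \<le> c * (norm x)\<^sup>2" for x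
  proof -
    have "x \<bullet> (P *v x) \<le> norm x * norm (P *v x)" by (rule norm_cauchy_schwarz)
    also have "\<dots> \<le> norm x * (c * norm x)" by (intro mult_left_mono c) simp
    finally show ?thesis by (simp add: power2_eq_square algebra_simps)
  qed
  with \<open>0 < m\<close> lower c(1) show ?thesis by (rule that)
qed

section \<open>Iterated derivatives\<close>

lemma real_differentiable_DERIV_deriv:
  fixes f :: "real \<Rightarrow> real"
  assumes "f differentiable (at x)"
  shows "(f has_real_derivative deriv f x) (at x)" "frechet_derivative f (at x) 1 = deriv f x"
proof -
  obtain D where D: "(f has_real_derivative D) (at x)"
    using assms real_differentiable_def by blast
  then show "(f has_real_derivative deriv f x) (at x)" by (simp add: DERIV_imp_deriv)
  have "frechet_derivative f (at x) = (*) D"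
    using D by (intro frechet_derivative_at[symmetric]) (simp add: has_field_derivative_def)
  then show "frechet_derivative f (at x) 1 = deriv f x" using DERIV_imp_deriv[OF D] by simp
qed

text \<open>Functions that agree on an open set have the same derivatives there. This allows
  \<open>frechet_derivative f (at x) 1\<close>, on which \<open>Ck_open\<close> recurses, to be
  traded for \<open>deriv f\<close>, since the two are only known to agree on
  \<open>U\<close>.\<close>

lemma Ck_open_cong:
  assumes "open U" "\<And>x. x \<in> U \<Longrightarrow> f x = g x" "Ck_open k f U"
  shows "Ck_open k g U"
  using assms(2,3)
proof (induction k arbitrary: f g)
  case 0
  then show ?case by (auto cong: continuous_on_cong)
next
  case (Suc k)
  have deriv: "(g has_derivative frechet_derivative f (at x)) (at x)" if "x \<in> U" for x
  proof (rule has_derivative_transform_within_open[OF _ \<open>open U\<close> that])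
    show "(f has_derivative frechet_derivative f (at x)) (at x)"
      using Suc.prems(2) that by (simp add: frechet_derivative_works[symmetric])
  qed (use Suc.prems(1) in auto)
  have "Ck_open k (\<lambda>x. frechet_derivative g (at x) i) U" if "i \<in> Basis" for i
  proof (rule Suc.IH)
    show "frechet_derivative f (at x) i = frechet_derivative g (at x) i" if "x \<in> U" for x
      using frechet_derivative_at[OF deriv[OF that]] by simp
  qed (use Suc.prems(2) that in auto)
  with deriv show ?case by (auto simp: differentiable_def)
qed

lemma Ck_open_iterated_deriv:
  fixes f :: "real \<Rightarrow> real"
  assumes "open U" "\<And>k. Ck_open k f U"
  shows "Ck_open k ((deriv ^^ j) f) U"
proof (induction j arbitrary: k)
  case (Suc j)
  let ?g = "(deriv ^^ j) f"
  have diff: "?g differentiable (at x)" if "x \<in> U" for x using Suc[of "Suc 0"] that by simp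
  have "Ck_open k (\<lambda>x. frechet_derivative ?g (at x) 1) U" using Suc[of "Suc k"] by simp
  then have "Ck_open k (deriv ?g) U"
    by (rule Ck_open_cong[OF \<open>open U\<close>, rotated]) (rule real_differentiable_DERIV_deriv(2)[OF diff])
  then show ?case by simp
qed (use assms in simp)

lemma C_around_iterated_deriv:
  fixes f :: "real \<Rightarrow> real"
  assumes "C_around \<infinity> f S" "x \<in> S"
  shows "((deriv ^^ j) f has_real_derivative (deriv ^^ Suc j) f x) (at x)"
proof -
  obtain U where U: "open U" "S \<subseteq> U" "\<And>k. Ck_open k f U"
    using assms(1) by (auto simp: C_around_def)
  have "Ck_open (Suc 0) ((deriv ^^ j) f) U" by (rule Ck_open_iterated_deriv[OF U(1,3)])
  then have "(deriv ^^ j) f differentiable (at x)" using U(2) assms(2) by auto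
  from real_differentiable_DERIV_deriv(1)[OF this] show ?thesis by simp
qed

lemma continuous_on_desired_state:
  assumes "\<And>i. C_around \<infinity> (yd i) {0..}"
  shows "continuous_on {0..} (desired_state blk off yd)"
  unfolding desired_state_def
  by (intro continuous_on_vec_lambda continuous_at_imp_continuous_on ballI
      DERIV_isCont[OF C_around_iterated_deriv[OF assms]])

section \<open>The closed loop\<close>

lemma error_field_dissipation:
  fixes P :: "real^'n^'n" and N :: "real^'m^'m \<Rightarrow> real"
  assumes P: "transpose P = P"
    "transpose (A_tilde r blk off K) ** P + P ** A_tilde r blk off K = - mat 1"
    and N: "is_norm N" and \<Delta>b: "\<And>\<xi>. norm (\<Delta>b \<xi>) \<le> N \<Delta> * norm (L \<xi>)"
  shows "2 * ((P *v z) \<bullet> error_field r blk off K yd P N L \<Delta>b \<Delta> t z e) \<le> 1/2 * (N e)\<^sup>2 - (norm z)\<^sup>2"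
proof -
  let ?A = "A_tilde r blk off K" and ?B = "B_tilde r blk off"
  define \<xi> where "\<xi> = z + desired_state blk off yd t"
  define w where "w = transpose ?B *v (P *v z)"
  define l where "l = norm (L \<xi>)"
  define \<delta> where "\<delta> = - (l\<^sup>2 *\<^sub>R w) - (N (\<Delta> - e) * l) *\<^sub>R sign_vec w + \<Delta>b \<xi>"
  have "z \<bullet> ((transpose ?A ** P + P ** ?A) *v z) = 2 * ((P *v z) \<bullet> (?A *v z))"
  proof -
    have "z \<bullet> ((transpose ?A ** P) *v z) = (?A *v z) \<bullet> (P *v z)"
      using inner_transpose_vector[of ?A "P *v z" z]
      by (simp add: matrix_vector_mul_assoc[symmetric] inner_commute)
    moreover have "z \<bullet> ((P ** ?A) *v z) = (P *v z) \<bullet> (?A *v z)"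
      using inner_transpose_vector[of P z "?A *v z"] P(1)
      by (simp add: matrix_vector_mul_assoc[symmetric])
    ultimately show ?thesis
      by (simp add: matrix_vector_mult_add_rdistrib inner_add_right inner_commute)
  qed
  then have A: "2 * ((P *v z) \<bullet> (?A *v z)) = - (norm z)\<^sup>2"
    unfolding P(2) by (simp add: power2_norm_eq_inner minus_matrix_vector)
  have "w \<bullet> \<Delta>b \<xi> \<le> norm w * ((N (\<Delta> - e) + N e) * l)"
  proof -
    have "N ((\<Delta> - e) + e) \<le> N (\<Delta> - e) + N e" using N unfolding is_norm_def by blast
    then have "norm (\<Delta>b \<xi>) \<le> (N (\<Delta> - e) + N e) * l"
      using \<Delta>b[of \<xi>] mult_right_mono[of "N \<Delta>" "N (\<Delta> - e) + N e" l] by (simp add: l_def)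
    then show ?thesis
      using norm_cauchy_schwarz[of w "\<Delta>b \<xi>"] by (meson mult_left_mono norm_ge_zero order_trans)
  qed
  moreover have "N (\<Delta> - e) * l * norm w \<le> N (\<Delta> - e) * l * (w \<bullet> sign_vec w)"
    using is_norm_nonneg[OF N, of "\<Delta> - e"] by (intro mult_left_mono norm_le_inner_sign_vec) (simp add: l_def)
  \<comment> \<open>The damping term of the controller supplies the square. The maximum of
    \<open>l * norm w * N e - (l * norm w)\<^sup>2\<close> is \<open>(N e)\<^sup>2 / 4\<close>, and
    the factor \<open>2\<close> in the derivative of \<open>V\<close> turns it into the constant
    \<open>1/2\<close>.\<close>
  moreover have "0 \<le> (l * norm w - N e / 2)\<^sup>2" by simp
  ultimately have "w \<bullet> \<delta> \<le> (N e)\<^sup>2 / 4"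
    by (simp add: \<delta>_def inner_add_right inner_diff_right inner_minus_right algebra_simps power2_eq_square
        power2_norm_eq_inner[unfolded power2_eq_square, symmetric])
  moreover have "(P *v z) \<bullet> (?B *v \<delta>) = w \<bullet> \<delta>"
    by (simp only: w_def inner_transpose_vector)
  moreover have "error_field r blk off K yd P N L \<Delta>b \<Delta> t z e = ?A *v z + ?B *v \<delta>"
    by (simp add: error_field_def Let_def \<delta>_def l_def w_def \<xi>_def)
  ultimately show ?thesis using A by (simp add: inner_add_right)
qed

section \<open>Growth and measurability of the closed-loop field\<close>

definition feedback_field ::
  "real^'n^'n \<Rightarrow> real^'m^'n \<Rightarrow> real^'n^'n \<Rightarrow> real \<Rightarrow> real^'n \<Rightarrow> real \<times> (real^'m) \<Rightarrow> real^'n" where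
  "feedback_field A B P \<nu> z y = (let w = transpose B *v (P *v z) in
     A *v z + B *v (- ((fst y)\<^sup>2 *\<^sub>R w) - (\<nu> * fst y) *\<^sub>R sign_vec w + snd y))"

text \<open>Separates the arguments by regularity: the input enters through the scalar gain, the
  arbitrary functions through the pair \<open>y\<close>, and the jump of the sign vector depends on
  \<open>z\<close> alone.\<close>

lemma error_field_eq_feedback_field:
  "error_field r blk off K yd P N L \<Delta>b \<Delta> t z e =
     feedback_field (A_tilde r blk off K) (B_tilde r blk off) P (N (\<Delta> - e)) z
       (norm (L (z + desired_state blk off yd t)), \<Delta>b (z + desired_state blk off yd t))"
  by (simp add: error_field_def feedback_field_def Let_def)

text \<open>The gain \<open>\<nu>\<close> multiplies only the bounded sign vector, so it enters
  affinely. Through \<open>N (\<Delta> - e) \<le> N \<Delta> + N e\<close> this becomes affine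
  growth in \<open>N e\<close>.\<close>

lemma feedback_field_growth:
  fixes A P :: "real^'n^'n" and B :: "real^'m^'n"
  assumes "0 \<le> l0" "0 \<le> y0"
  obtains C0 C1 where "0 \<le> C0" "0 \<le> C1"
    "\<And>\<nu> z l y. 0 \<le> \<nu> \<Longrightarrow> 0 \<le> l \<Longrightarrow> l \<le> l0 \<Longrightarrow> norm y \<le> y0 \<Longrightarrow>
       norm (feedback_field A B P \<nu> z (l, y)) \<le> (C0 + C1 * \<nu>) * (1 + norm z)"
proof -
  obtain a where a: "0 < a" "\<And>z. norm (A *v z) \<le> a * norm z"
    using matrix_vector_mult_norm_le[of A] by blast
  obtain b where b: "0 < b" "\<And>\<delta>. norm (B *v \<delta>) \<le> b * norm \<delta>"
    using matrix_vector_mult_norm_le[of B] by blast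
  obtain c where c: "0 < c" "\<And>z. norm ((transpose B ** P) *v z) \<le> c * norm z"
    using matrix_vector_mult_norm_le[of "transpose B ** P"] by blast
  let ?m = "real CARD('m)"
  define C0 where "C0 = a + b * (l0\<^sup>2 * c + y0)"
  define C1 where "C1 = b * (l0 * ?m)"
  show ?thesis
  proof (rule that)
    show "0 \<le> C0" "0 \<le> C1" using a b c assms by (auto simp: C0_def C1_def)
    fix \<nu> l :: real and z :: "real^'n" and y :: "real^'m"
    assume \<nu>: "0 \<le> \<nu>" and l: "0 \<le> l" "l \<le> l0" and y: "norm y \<le> y0"
    define w where "w = transpose B *v (P *v z)"
    have w: "norm w \<le> c * norm z" using c(2)[of z] by (simp add: w_def matrix_vector_mul_assoc)
    have "norm (l\<^sup>2 *\<^sub>R w) \<le> l0\<^sup>2 * (c * norm z)"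
      using l w by (auto intro!: mult_mono power_mono)
    moreover have "norm ((\<nu> * l) *\<^sub>R sign_vec w) \<le> (\<nu> * l0) * ?m"
      using l \<nu> norm_sign_vec_le[of w] by (auto simp: abs_mult intro!: mult_mono)
    moreover have "norm (- (l\<^sup>2 *\<^sub>R w) - (\<nu> * l) *\<^sub>R sign_vec w + y)
        \<le> norm (l\<^sup>2 *\<^sub>R w) + norm ((\<nu> * l) *\<^sub>R sign_vec w) + norm y"
      by (metis norm_minus_cancel norm_triangle_ineq4 norm_triangle_le add_right_mono)
    ultimately have \<delta>: "norm (- (l\<^sup>2 *\<^sub>R w) - (\<nu> * l) *\<^sub>R sign_vec w + y)
        \<le> l0\<^sup>2 * (c * norm z) + \<nu> * l0 * ?m + y0" using y by linarith
    have "norm (feedback_field A B P \<nu> z (l, y)) \<le> a * norm z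
        + b * (l0\<^sup>2 * (c * norm z) + \<nu> * l0 * ?m + y0)"
      unfolding feedback_field_def Let_def fst_conv snd_conv w_def[symmetric]
      using b(1) by (intro norm_triangle_mono a order_trans[OF b(2)] mult_left_mono \<delta>) auto
    also have "\<dots> \<le> (C0 + C1 * \<nu>) * (1 + norm z)"
    proof -
      have "0 \<le> a + b * (l0\<^sup>2 * c)" "0 \<le> b * (y0 + l0 * ?m * \<nu>) * norm z"
        using a(1) b(1) c(1) assms \<nu> by auto
      then show ?thesis by (simp add: C0_def C1_def algebra_simps)
    qed
    finally show "norm (feedback_field A B P \<nu> z (l, y)) \<le> (C0 + C1 * \<nu>) * (1 + norm z)" .
  qed
qed

text \<open>The sign vector is determined by \<open>z\<close> and common to both fields, so its
  jumps do no harm to a Lipschitz estimate in \<open>y\<close>. The square of the first component is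
  Lipschitz because that component ranges over the bounded interval \<open>{0..l0}\<close>.\<close>

lemma feedback_field_lipschitz:
  fixes A P :: "real^'n^'n" and B :: "real^'m^'n"
  assumes "0 \<le> l0"
  obtains C0 C1 where "0 \<le> C0" "0 \<le> C1"
    "\<And>\<nu> z y y'. 0 \<le> \<nu> \<Longrightarrow> fst y \<in> {0..l0} \<Longrightarrow> fst y' \<in> {0..l0} \<Longrightarrow>
       norm (feedback_field A B P \<nu> z y - feedback_field A B P \<nu> z y') \<le> (C0 + C1 * \<nu>) * (1 + norm z) * dist y y'"
proof -
  obtain b where b: "0 < b" "\<And>\<delta>. norm (B *v \<delta>) \<le> b * norm \<delta>"
    using matrix_vector_mult_norm_le[of B] by blast
  obtain c where c: "0 < c" "\<And>z. norm ((transpose B ** P) *v z) \<le> c * norm z"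
    using matrix_vector_mult_norm_le[of "transpose B ** P"] by blast
  let ?m = "real CARD('m)"
  define C0 where "C0 = b * (2 * l0 * c + 1)"
  define C1 where "C1 = b * ?m"
  show ?thesis
  proof (rule that)
    show "0 \<le> C0" "0 \<le> C1" using b c assms by (auto simp: C0_def C1_def)
    fix \<nu> :: real and z :: "real^'n" and y y' :: "real \<times> (real^'m)"
    assume \<nu>: "0 \<le> \<nu>" and l: "fst y \<in> {0..l0}" "fst y' \<in> {0..l0}"
    define w where "w = transpose B *v (P *v z)"
    define l l' where "l = fst y" and "l' = fst y'"
    let ?D = "dist y y'"
    have w: "norm w \<le> c * norm z" using c(2)[of z] by (simp add: w_def matrix_vector_mul_assoc)
    have dl: "\<bar>l - l'\<bar> \<le> ?D" "norm (snd y - snd y') \<le> ?D"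
      using dist_fst_le[of y y'] dist_snd_le[of y y'] by (auto simp: l_def l'_def dist_norm)
    have "norm ((l\<^sup>2 - l'\<^sup>2) *\<^sub>R w) \<le> (2 * l0 * ?D) * (c * norm z)"
    proof -
      have "\<bar>l\<^sup>2 - l'\<^sup>2\<bar> = \<bar>l + l'\<bar> * \<bar>l - l'\<bar>"
        by (simp add: power2_eq_square square_diff_square_factored abs_mult mult.commute)
      also have "\<dots> \<le> (2 * l0) * ?D" using l dl(1) by (intro mult_mono) (auto simp: l_def l'_def)
      finally show ?thesis using w by (auto intro!: mult_mono assms)
    qed
    moreover have "norm ((\<nu> * (l - l')) *\<^sub>R sign_vec w) \<le> (\<nu> * ?D) * ?m"
      using dl(1) \<nu> norm_sign_vec_le[of w] by (auto simp: abs_mult intro!: mult_mono)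
    moreover have "norm (- ((l\<^sup>2 - l'\<^sup>2) *\<^sub>R w) - (\<nu> * (l - l')) *\<^sub>R sign_vec w + (snd y - snd y'))
        \<le> norm ((l\<^sup>2 - l'\<^sup>2) *\<^sub>R w) + norm ((\<nu> * (l - l')) *\<^sub>R sign_vec w) + norm (snd y - snd y')"
      by (metis norm_minus_cancel norm_triangle_ineq4 norm_triangle_le add_right_mono)
    ultimately have \<delta>: "norm (- ((l\<^sup>2 - l'\<^sup>2) *\<^sub>R w) - (\<nu> * (l - l')) *\<^sub>R sign_vec w + (snd y - snd y'))
        \<le> (2 * l0 * ?D) * (c * norm z) + (\<nu> * ?D) * ?m + ?D" using dl(2) by linarith
    have "feedback_field A B P \<nu> z y - feedback_field A B P \<nu> z y' =
        B *v (- ((l\<^sup>2 - l'\<^sup>2) *\<^sub>R w) - (\<nu> * (l - l')) *\<^sub>R sign_vec w + (snd y - snd y'))"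
      unfolding feedback_field_def Let_def w_def[symmetric] l_def[symmetric] l'_def[symmetric]
      by (simp add: algebra_simps)
    then have "norm (feedback_field A B P \<nu> z y - feedback_field A B P \<nu> z y')
        \<le> b * ((2 * l0 * ?D) * (c * norm z) + (\<nu> * ?D) * ?m + ?D)"
      using b(1) by (auto intro!: order_trans[OF b(2)] mult_left_mono \<delta>)
    also have "\<dots> \<le> (C0 + C1 * \<nu>) * (1 + norm z) * ?D"
    proof -
      have "0 \<le> b * (2 * l0 * c) * ?D + b * ?D * norm z + b * ?m * \<nu> * ?D * norm z"
        using b(1) c(1) assms \<nu> by auto
      then show ?thesis by (simp add: C0_def C1_def algebra_simps)
    qed
    finally show "norm (feedback_field A B P \<nu> z y - feedback_field A B P \<nu> z y') \<le> (C0 + C1 * \<nu>) * (1 + norm z) * ?D" .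
  qed
qed

lemma borel_measurable_matrix_vector_mult: "(\<lambda>x. M *v x) \<in> borel_measurable borel" for M :: "real^'n^'m"
  by (intro borel_measurable_continuous_onI matrix_vector_mult_linear_continuous_on)

lemma borel_measurable_feedback_field:
  assumes "n \<in> borel_measurable borel"
  shows "(\<lambda>(t::real, z, y). feedback_field A B P (n t) z y) \<in> borel_measurable borel"
proof -
  note mult = borel_measurable_matrix_vector_mult
  have fst: "fst \<in> borel_measurable (borel :: (real \<times> (real^'a) \<times> real \<times> (real^'b)) measure)"
    and snd: "(\<lambda>x. fst (snd x)) \<in> borel_measurable (borel :: (real \<times> (real^'a) \<times> real \<times> (real^'b)) measure)"
    and snd3: "(\<lambda>x. fst (snd (snd x))) \<in> borel_measurable (borel :: (real \<times> (real^'a) \<times> real \<times> (real^'b)) measure)"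
    and snd4: "(\<lambda>x. snd (snd (snd x))) \<in> borel_measurable (borel :: (real \<times> (real^'a) \<times> real \<times> (real^'b)) measure)"
    by (intro borel_measurable_continuous_onI continuous_intros)+
  show ?thesis
    unfolding feedback_field_def Let_def case_prod_beta'
    by (intro borel_measurable_add borel_measurable_diff borel_measurable_scaleR borel_measurable_uminus
        measurable_compose[OF _ mult] snd snd3 snd4 borel_measurable_power borel_measurable_times
        measurable_compose[OF _ borel_measurable_sign_vec] measurable_compose[OF fst assms])
qed

lemma is_norm_diff_le:
  assumes "is_norm N" shows "N (x - y) \<le> N x + N y"
proof -
  have "N (x + (-1) *\<^sub>R y) \<le> N x + N ((-1) *\<^sub>R y)" "N ((-1) *\<^sub>R y) = \<bar>-1\<bar> * N y"
    using assms unfolding is_norm_def by blast+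
  then show ?thesis by simp
qed

lemma error_field_growth:
  fixes N :: "real^'m^'m \<Rightarrow> real" and L :: "real^'n \<Rightarrow> 'l::real_normed_vector"
  assumes N: "is_norm N" and \<Delta>b: "\<And>\<xi>. norm (\<Delta>b \<xi>) \<le> N \<Delta> * norm (L \<xi>)" and L: "bounded (range L)"
  obtains C0 C1 where "0 \<le> C1"
    "\<And>t z e. norm (error_field r blk off K yd P N L \<Delta>b \<Delta> t z e) \<le> (C0 + C1 * N e) * (1 + norm z)"
proof -
  obtain l0 where l0: "0 < l0" "\<And>\<xi>. norm (L \<xi>) \<le> l0" using L by (auto simp: bounded_pos)
  note N0 = is_norm_nonneg[OF N]
  have y0: "norm (\<Delta>b \<xi>) \<le> N \<Delta> * l0" for \<xi>
    using \<Delta>b[of \<xi>] l0(2)[of \<xi>] N0[of \<Delta>] by (meson mult_left_mono order_trans)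
  obtain C0 C1 where C: "0 \<le> C0" "0 \<le> C1"
    "\<And>\<nu> z l y. 0 \<le> \<nu> \<Longrightarrow> 0 \<le> l \<Longrightarrow> l \<le> l0 \<Longrightarrow> norm y \<le> N \<Delta> * l0 \<Longrightarrow>
       norm (feedback_field (A_tilde r blk off K) (B_tilde r blk off) P \<nu> z (l, y)) \<le> (C0 + C1 * \<nu>) * (1 + norm z)"
    by (rule feedback_field_growth[of l0 "N \<Delta> * l0" "A_tilde r blk off K" "B_tilde r blk off" P])
      (use l0 N0 in auto)
  show ?thesis
  proof (rule that)
    fix t z e
    have "norm (error_field r blk off K yd P N L \<Delta>b \<Delta> t z e) \<le> (C0 + C1 * N (\<Delta> - e)) * (1 + norm z)"
      unfolding error_field_eq_feedback_field by (rule C(3)) (use N0 l0 y0 in auto)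
    also have "\<dots> \<le> (C0 + C1 * N \<Delta> + C1 * N e) * (1 + norm z)"
      using mult_left_mono[OF is_norm_diff_le[OF N] C(2), of \<Delta> e]
      by (intro mult_right_mono) (auto simp: distrib_left)
    finally show "norm (error_field r blk off K yd P N L \<Delta>b \<Delta> t z e) \<le> (C0 + C1 * N \<Delta> + C1 * N e) * (1 + norm z)" .
  qed (rule C(2))
qed

text \<open>There are finitely many discontinuities in each \<open>{0..real n}\<close>, hence
  countably many in all. The clamp continues \<open>e\<close> by the constant \<open>e 0\<close> and
  turns continuity within \<open>{0..}\<close> into two-sided continuity.\<close>

lemma piecewise_continuous_borel_measurable:
  fixes e :: "real \<Rightarrow> 'e::topological_space"
  assumes "piecewise_continuous e"
  shows "(\<lambda>t. e (max 0 t)) \<in> borel_measurable borel"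
proof (rule borel_measurable_continuous_countable_exceptions)
  let ?D = "\<Union>n. {t \<in> {0..real n}. \<not> continuous (at t within {0..}) e}"
  have "finite {t \<in> {0..real n}. \<not> continuous (at t within {0..}) e}" for n
    using assms unfolding piecewise_continuous_def by blast
  then show "countable ?D" by (intro countable_UN countableI_type countable_finite)
  have "isCont (\<lambda>t. e (max 0 t)) t" if "t \<notin> ?D" for t
  proof (cases "t < 0")
    case True
    then have "\<forall>\<^sub>F s in nhds t. s < 0" by (rule order_tendstoD[OF filterlim_ident])
    then have "\<forall>\<^sub>F s in nhds t. e (max 0 s) = e 0" by eventually_elim simp
    then show ?thesis by (simp add: isCont_cong)
  next
    case False
    obtain n where "t \<le> real n" using real_arch_simple by blast
    then have "continuous (at t within {0..}) e" using that False by auto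
    then have "continuous (at (max 0 t) within range (max 0)) e"
      using False by (auto intro: continuous_within_subset)
    then show ?thesis
      by (intro continuous_within_compose2[where g=e and f="max 0"] continuous_intros) 
  qed
  then show "continuous_on (- ?D) (\<lambda>t. e (max 0 t))"
    by (intro continuous_at_imp_continuous_on) blast
qed

lemma filippov_solution_cong:
  assumes "filippov_solution G t0 I z" "\<And>t x. t \<in> I \<Longrightarrow> G t x = G' t x"
  shows "filippov_solution G' t0 I z"
proof -
  have "G t = G' t" if "t \<in> I" for t using assms(2)[OF that] by blast
  then have "t \<in> I \<longrightarrow> y \<in> filippov_set (G t) x \<longleftrightarrow> t \<in> I \<longrightarrow> y \<in> filippov_set (G' t) x" for t y x
    by auto
  with assms(1) show ?thesis unfolding filippov_solution_def inclusion_solution_def by simp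
qed

lemma error_field_filippov_solution_exists:
  fixes N :: "real^'m^'m \<Rightarrow> real" and L :: "real^'n \<Rightarrow> 'l::real_normed_vector"
  assumes N: "is_norm N" and \<Delta>b: "\<And>\<xi>. norm (\<Delta>b \<xi>) \<le> N \<Delta> * norm (L \<xi>)" and L: "bounded (range L)"
    and yd: "\<And>i. C_around \<infinity> (yd i) {0..}"
    and "0 \<le> t0" and e: "piecewise_continuous e" "bounded (e ` {0..})"
  shows "\<exists>z. z t0 = z0 \<and>
    filippov_solution (\<lambda>t z. error_field r blk off K yd P N L \<Delta>b \<Delta> t z (e t)) t0 {t0..} z"
proof -
  let ?A = "A_tilde r blk off K" and ?B = "B_tilde r blk off"
  let ?F = "error_field r blk off K yd P N L \<Delta>b \<Delta>"
  obtain l0 where l0: "0 < l0" "\<And>\<xi>. norm (L \<xi>) \<le> l0" using L by (auto simp: bounded_pos)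
  note N0 = is_norm_nonneg[OF N]
  have y0: "norm (\<Delta>b \<xi>) \<le> N \<Delta> * l0" for \<xi>
    using \<Delta>b[of \<xi>] l0(2)[of \<xi>] N0[of \<Delta>] by (meson mult_left_mono order_trans)
  obtain C0 C1 where C: "0 \<le> C0" "0 \<le> C1"
    "\<And>\<nu> z l y. 0 \<le> \<nu> \<Longrightarrow> 0 \<le> l \<Longrightarrow> l \<le> l0 \<Longrightarrow> norm y \<le> N \<Delta> * l0 \<Longrightarrow>
       norm (feedback_field ?A ?B P \<nu> z (l, y)) \<le> (C0 + C1 * \<nu>) * (1 + norm z)"
    by (rule feedback_field_growth[of l0 "N \<Delta> * l0" ?A ?B P]) (use l0 N0 in auto)
  obtain E0 E1 where E: "0 \<le> E0" "0 \<le> E1"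
    "\<And>\<nu> z y y'. 0 \<le> \<nu> \<Longrightarrow> fst y \<in> {0..l0} \<Longrightarrow> fst y' \<in> {0..l0} \<Longrightarrow>
       norm (feedback_field ?A ?B P \<nu> z y - feedback_field ?A ?B P \<nu> z y') \<le> (E0 + E1 * \<nu>) * (1 + norm z) * dist y y'"
    by (rule feedback_field_lipschitz[of l0 ?A ?B P]) (use l0 in auto)
  obtain e0 where e0: "\<And>t. 0 \<le> t \<Longrightarrow> norm (e t) \<le> e0" using e(2) by (auto simp: bounded_iff)
  obtain B where B: "0 < B" "\<And>x. N x \<le> B * norm x" using is_norm_le_norm[OF N] by blast
  \<comment> \<open>Negative times are clamped to \<open>0\<close>, as nothing is known about \<open>e\<close> and \<open>yd\<close> there. The
    possibly non-measurable functions \<open>L\<close> and \<open>\<Delta>b\<close> enter the field only through \<open>H\<close>.\<close>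
  define \<nu> where "\<nu> t = N (\<Delta> - e (max 0 t))" for t
  define d where "d t = desired_state blk off yd (max 0 t)" for t
  define H where "H \<xi> = (norm (L \<xi>), \<Delta>b \<xi>)" for \<xi>
  have H: "fst (H \<xi>) \<in> {0..l0}" for \<xi> by (simp add: H_def l0)
  define n0 where "n0 = N \<Delta> + B * e0"
  have \<nu>: "0 \<le> \<nu> t" "\<nu> t \<le> n0" for t
  proof -
    have "B * norm (e (max 0 t)) \<le> B * e0" using B(1) e0[of "max 0 t"] by simp
    then have "N (e (max 0 t)) \<le> B * e0" using B(2)[of "e (max 0 t)"] by linarith
    then show "0 \<le> \<nu> t" "\<nu> t \<le> n0"
      using is_norm_diff_le[OF N, of \<Delta> "e (max 0 t)"] N0 by (auto simp: \<nu>_def n0_def)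
  qed
  \<comment> \<open>A single constant has to serve both the growth and the Lipschitz hypothesis,
    uniformly in time; \<open>n0\<close> bounds the gain.\<close>
  define C where "C = (C0 + C1 * n0) + (E0 + E1 * n0)"
  have C_ge: "C0 + C1 * \<nu> t \<le> C" "E0 + E1 * \<nu> t \<le> C" for t
  proof -
    have "C1 * \<nu> t \<le> C1 * n0" "E1 * \<nu> t \<le> E1 * n0" "0 \<le> C1 * n0" "0 \<le> E1 * n0"
      using \<nu>[of t] C(2) E(2) by (auto intro: mult_left_mono)
    then show "C0 + C1 * \<nu> t \<le> C" "E0 + E1 * \<nu> t \<le> C" using C(1) E(1) by (auto simp: C_def)
  qed
  define \<Psi> where "\<Psi> t = feedback_field ?A ?B P (\<nu> t)" for t
  obtain z where z: "z t0 = z0" "filippov_solution (\<lambda>t z. \<Psi> t z (H (z + d t))) t0 {t0..} z"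
  proof (rule filippov_solution_exists[of \<Psi> d H C t0 z0])
    have "\<nu> \<in> borel_measurable borel"
      unfolding \<nu>_def
    proof (rule measurable_compose[OF piecewise_continuous_borel_measurable[OF e(1)]])
      show "(\<lambda>x. N (\<Delta> - x)) \<in> borel_measurable borel"
        by (intro borel_measurable_continuous_onI continuous_on_compose2[OF is_norm_continuous[OF N]] continuous_intros) auto
    qed
    then show "(\<lambda>(t, z, y). \<Psi> t z y) \<in> borel_measurable borel"
      unfolding \<Psi>_def by (rule borel_measurable_feedback_field)
    have "continuous_on UNIV d"
      unfolding d_def
      by (intro continuous_on_compose2[OF continuous_on_desired_state[OF yd]] continuous_intros) auto
    then show "d \<in> borel_measurable borel" by (rule borel_measurable_continuous_onI)
    show "norm (\<Psi> t z (H \<xi>)) \<le> C * (1 + norm z)" for t z \<xi>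
    proof -
      have "norm (\<Psi> t z (H \<xi>)) \<le> (C0 + C1 * \<nu> t) * (1 + norm z)"
        unfolding \<Psi>_def H_def by (rule C(3)) (use \<nu> l0 y0 in auto)
      also have "\<dots> \<le> C * (1 + norm z)" by (intro mult_right_mono C_ge) simp
      finally show ?thesis .
    qed
    show "norm (\<Psi> t z (H \<xi>) - \<Psi> t z (H \<xi>')) \<le> C * (1 + norm z) * dist (H \<xi>) (H \<xi>')" for t z \<xi> \<xi>'
    proof -
      have "norm (\<Psi> t z (H \<xi>) - \<Psi> t z (H \<xi>')) \<le> (E0 + E1 * \<nu> t) * (1 + norm z) * dist (H \<xi>) (H \<xi>')"
        unfolding \<Psi>_def by (rule E(3)[OF \<nu>(1) H H])
      also have "\<dots> \<le> C * (1 + norm z) * dist (H \<xi>) (H \<xi>')" by (intro mult_right_mono C_ge) simp_all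
      finally show ?thesis .
    qed
  qed blast
  have "\<Psi> t z (H (z + d t)) = ?F t z (e t)" if "t \<in> {t0..}" for t z
    using that \<open>0 \<le> t0\<close> by (simp add: \<Psi>_def H_def d_def \<nu>_def error_field_eq_feedback_field max_def)
  from filippov_solution_cong[OF z(2) this] z(1) show ?thesis by blast
qed

section \<open>From plant motions to the error equation\<close>

lemma has_vector_derivative_componentwise_cart:
  fixes f :: "real \<Rightarrow> real^'n"
  assumes "\<And>k. ((\<lambda>s. f s $ k) has_real_derivative f' $ k) (at t)"
  shows "(f has_vector_derivative f') (at t)"
  unfolding has_vector_derivative_def
proof (subst has_derivative_componentwise_within, rule ballI)
  fix i :: "real^'n" assume "i \<in> Basis"
  then obtain k where "i = axis k 1" by (auto simp: Basis_vec_def)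
  then show "((\<lambda>x. f x \<bullet> i) has_derivative (\<lambda>x. (x *\<^sub>R f') \<bullet> i)) (at t)"
    using assms[of k] by (simp add: inner_axis has_field_derivative_def mult_commute_abs)
qed

lemma deriv_eq_on_open:
  fixes f g :: "real \<Rightarrow> real"
  assumes "open I" "t \<in> I" "\<And>s. s \<in> I \<Longrightarrow> f s = g s" "(g has_real_derivative D) (at t)"
  shows "(f has_real_derivative D) (at t)"
  using assms(4)
  by (rule has_field_derivative_transform_within_open[OF _ assms(1,2)]) (use assms(3) in auto)

text \<open>\<open>deriv\<close> is total, so linearity requires genuine differentiability at each
  order below \<open>j\<close>. The induction needs the previous identity near \<open>t\<close>, not
  just at \<open>t\<close>; hence the open set.\<close>

lemma iterated_deriv_diff:
  fixes f g :: "real \<Rightarrow> real"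
  assumes "open I"
    and f: "\<And>i t. i < j \<Longrightarrow> t \<in> I \<Longrightarrow> ((deriv ^^ i) f has_real_derivative (deriv ^^ Suc i) f t) (at t)"
    and g: "\<And>i t. i < j \<Longrightarrow> t \<in> I \<Longrightarrow> ((deriv ^^ i) g has_real_derivative (deriv ^^ Suc i) g t) (at t)"
    and "t \<in> I"
  shows "(deriv ^^ j) (\<lambda>s. f s - g s) t = (deriv ^^ j) f t - (deriv ^^ j) g t"
  using f g \<open>t \<in> I\<close>
proof (induction j arbitrary: t)
  case (Suc j)
  have "((deriv ^^ j) (\<lambda>s. f s - g s) has_real_derivative (deriv ^^ Suc j) f t - (deriv ^^ Suc j) g t) (at t)"
    by (rule deriv_eq_on_open[OF \<open>open I\<close> \<open>t \<in> I\<close>, where g="\<lambda>s. (deriv ^^ j) f s - (deriv ^^ j) g s"])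
      (use Suc in \<open>auto intro!: DERIV_diff simp del: funpow.simps\<close>)
  then show ?case by (simp add: DERIV_imp_deriv)
qed simp

lemma A_tilde_vector_mult:
  assumes "block_labelling r blk off"
  shows "off k < r (blk k) \<Longrightarrow> blk k' = blk k \<Longrightarrow> off k' = Suc (off k) \<Longrightarrow>
      (A_tilde r blk off K *v z) $ k = z $ k'"
    and "off k = r (blk k) \<Longrightarrow>
      (A_tilde r blk off K *v z) $ k = - (\<Sum>l | blk l = blk k. K (blk k) (off l) * z $ l)"
proof -
  assume k: "off k < r (blk k)" and k': "blk k' = blk k" "off k' = Suc (off k)"
  \<comment> \<open>Injectivity of the labelling leaves a single nonzero entry in a row above the
    last one of its block.\<close>
  have "inj (\<lambda>k. (blk k, off k))"
    using assms unfolding block_labelling_def bij_betw_def by blast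
  from injD[OF this, of _ k'] have uniq: "l = k'" if "blk l = blk k" "off l = Suc (off k)" for l
    using k' that by simp
  have "(A_tilde r blk off K *v z) $ k = (\<Sum>l\<in>UNIV. if l = k' then z $ l else 0)"
    unfolding matrix_vector_mult_def A_tilde_def vec_lambda_beta
  proof (rule sum.cong)
    fix l
    show "(if blk k \<noteq> blk l then 0 else if off k = r (blk k) then - K (blk k) (off l)
        else if off l = off k + 1 then 1 else 0) * z $ l = (if l = k' then z $ l else 0)"
    proof (cases "l = k'")
      case True
      with k k' show ?thesis by simp
    next
      case False
      then have "blk k \<noteq> blk l \<or> off l \<noteq> off k + 1" using uniq[of l] by (metis Suc_eq_plus1)
      with False less_imp_neq[OF k] show ?thesis by (cases "blk k = blk l") simp_all
    qed
  qed simp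
  then show "(A_tilde r blk off K *v z) $ k = z $ k'" by simp
next
  assume k: "off k = r (blk k)"
  have "(A_tilde r blk off K *v z) $ k = (\<Sum>l\<in>UNIV. if blk l = blk k then - (K (blk k) (off l) * z $ l) else 0)"
    unfolding matrix_vector_mult_def A_tilde_def vec_lambda_beta
    by (rule sum.cong) (use k in auto)
  then show "(A_tilde r blk off K *v z) $ k = - (\<Sum>l | blk l = blk k. K (blk k) (off l) * z $ l)"
    by (simp add: sum.If_cases sum_negf)
qed

lemma B_tilde_vector_mult:
  "(B_tilde r blk off *v \<delta>) $ k = (if off k = r (blk k) then \<delta> $ blk k else 0)"
proof -
  have "(B_tilde r blk off *v \<delta>) $ k = (\<Sum>i\<in>UNIV. if i = blk k then (if off k = r (blk k) then \<delta> $ i else 0) else 0)"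
    unfolding matrix_vector_mult_def B_tilde_def vec_lambda_beta
    by (rule sum.cong) auto
  then show ?thesis by simp
qed

text \<open>Each block is a chain of integrators. Below its top, an error coordinate has the next
  one as derivative. At the top, the controller cancels \<open>b\<close>, and \<open>v_s\<close>
  contributes the derivative of the desired trajectory and the gain row of
  \<open>A_tilde\<close>.\<close>

lemma closed_loop_error_dynamics:
  fixes x :: "real \<Rightarrow> real^'n" and A :: "real^'n \<Rightarrow> real^'p^'m" and Ai :: "real^'n \<Rightarrow> real^'m^'p"
    and L :: "real^'n \<Rightarrow> 'l::real_normed_vector"
  assumes lab: "block_labelling r blk off" and diffeo: "diffeomorphism_on X \<Phi>"
    and inv: "\<And>\<xi>. \<xi> \<in> \<Phi> ` X \<Longrightarrow> A \<xi> ** Ai \<xi> = mat 1"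
    and yd: "\<And>i. C_around \<infinity> (yd i) {0..}"
    and model: "uncertain_linearized_model f \<Delta>f g h X r blk off \<Phi> b A \<Delta>b"
    and I: "open I" "I \<subseteq> {0..}" and "t \<in> I"
    and motion: "plant_motion f \<Delta>f g X I x (\<lambda>t. controller r blk off K yd P N L b Ai t (\<Phi> (x t)) (Dh t))"
  defines "z \<equiv> \<lambda>t. \<chi> k. (deriv ^^ (off k - 1)) (\<lambda>s. h (x s) $ blk k - yd (blk k) s) t"
  shows "(z has_vector_derivative
    error_field r blk off K yd P N L \<Delta>b \<Delta> t (z t) (\<Delta> - Dh t)) (at t)"
proof -
  let ?u = "\<lambda>t. controller r blk off K yd P N L b Ai t (\<Phi> (x t)) (Dh t)"
  let ?d = "desired_state blk off yd"
  define y where "y i s = h (x s) $ i" for i s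
  have x: "x s \<in> X" "x differentiable (at s)" if "s \<in> I" for s
    using motion that unfolding plant_motion_def
    by (auto simp: has_vector_derivative_def differentiable_def)
  have y_state: "(deriv ^^ (off k - 1)) (y (blk k)) s = \<Phi> (x s) $ k" if "s \<in> I" for s k
    using model I(1) motion that unfolding uncertain_linearized_model_def y_def by blast
  have y_top: "((deriv ^^ (r i - 1)) (y i) has_real_derivative
      (b (\<Phi> (x s)) + A (\<Phi> (x s)) *v ?u s + \<Delta>b (\<Phi> (x s))) $ i) (at s)" if "s \<in> I" for s i
    using model I(1) motion that unfolding uncertain_linearized_model_def y_def by blast
  have range_lab: "(\<lambda>k. (blk k, off k)) ` UNIV = {(i, j). 1 \<le> j \<and> j \<le> r i}"
    using lab unfolding block_labelling_def bij_betw_def by blast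
  have off: "1 \<le> off k" "off k \<le> r (blk k)" for k using range_lab by auto
  have label: "\<exists>k. blk k = i \<and> off k = j" if "1 \<le> j" "j \<le> r i" for i j
  proof -
    have "(i, j) \<in> (\<lambda>k. (blk k, off k)) ` UNIV" using that by (simp only: range_lab) simp
    then show ?thesis by auto
  qed
  \<comment> \<open>\<open>\<Phi>\<close> is smooth on \<open>X\<close> only through an extension
    \<open>\<psi>\<close>, so differentiation along the motion goes through
    \<open>\<psi>\<close>.\<close>
  obtain \<psi> where \<psi>: "C_around \<infinity> \<psi> X" "\<And>p. p \<in> X \<Longrightarrow> \<psi> p = \<Phi> p"
    using diffeo by (auto simp: diffeomorphism_on_def C_on_def)
  obtain U where U: "X \<subseteq> U" "Ck_open (Suc 0) \<psi> U"
    using \<psi>(1) by (auto simp: C_around_def simp del: Ck_open.simps)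
  \<comment> \<open>The model gives the values of the lower output derivatives; that they are
    differentiable comes from writing them on the open set \<open>I\<close> as coordinates of
    \<open>\<psi>\<close> along the motion.\<close>
  have y_deriv: "((deriv ^^ j) (y i) has_real_derivative (deriv ^^ Suc j) (y i) s) (at s)"
    if j: "j < r i" and s: "s \<in> I" for i j s
  proof -
    obtain k where k: "blk k = i" "off k = Suc j" using label[of "Suc j" i] j by auto
    have "\<psi> differentiable (at (x s))" using U x(1)[OF s] by auto
    then have "(\<lambda>s. \<psi> (x s)) differentiable (at s)"
      using differentiable_chain_at[OF x(2)[OF s]] by (simp add: o_def)
    then have "(\<lambda>s. \<psi> (x s) $ k) differentiable (at s)"
      unfolding differentiable_def by (auto intro: bounded_linear.has_derivative[OF bounded_linear_vec_nth])
    then obtain D where D: "((\<lambda>s. \<psi> (x s) $ k) has_real_derivative D) (at s)"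
      using real_differentiable_def by blast
    have "((deriv ^^ j) (y i) has_real_derivative D) (at s)"
    proof (rule deriv_eq_on_open[OF I(1) s _ D])
      show "(deriv ^^ j) (y i) s' = \<psi> (x s') $ k" if "s' \<in> I" for s'
        using y_state[OF that, of k] \<psi>(2)[OF x(1)[OF that]] k by simp
    qed
    then show ?thesis by (simp add: DERIV_imp_deriv)
  qed
  have yd_deriv: "((deriv ^^ j) (yd i) has_real_derivative (deriv ^^ Suc j) (yd i) s) (at s)"
    if "s \<in> I" for i j s
    by (rule C_around_iterated_deriv[OF yd]) (use I(2) that in auto)
  have z_comp: "z s $ k = (deriv ^^ (off k - 1)) (y (blk k)) s - (deriv ^^ (off k - 1)) (yd (blk k)) s"
    if "s \<in> I" for s k
    unfolding z_def vec_lambda_beta y_def[symmetric]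
    by (rule iterated_deriv_diff[OF I(1) y_deriv yd_deriv that]) (use off[of k] in auto)
  then have z_eq: "z s = \<Phi> (x s) - ?d s" if "s \<in> I" for s
    using that by (simp add: vec_eq_iff y_state[OF that, unfolded One_nat_def] desired_state_def)
  define \<xi> where "\<xi> = \<Phi> (x t)"
  have z\<xi>: "z t = \<xi> - ?d t" using z_eq[OF \<open>t \<in> I\<close>] by (simp add: \<xi>_def)
  define w where "w = transpose (B_tilde r blk off) *v (P *v z t)"
  define \<delta> where "\<delta> = - ((norm (L \<xi>))\<^sup>2 *\<^sub>R w) - (N (Dh t) * norm (L \<xi>)) *\<^sub>R sign_vec w + \<Delta>b \<xi>"
  have field: "error_field r blk off K yd P N L \<Delta>b \<Delta> t (z t) (\<Delta> - Dh t) =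
      A_tilde r blk off K *v z t + B_tilde r blk off *v \<delta>"
    by (simp add: error_field_def Let_def \<delta>_def w_def z\<xi>)
  \<comment> \<open>The right inverse of \<open>A\<close> undoes the factor \<open>Ai\<close> in
    both parts of the control; the uncertainty joins the robust part in
    \<open>\<delta>\<close>.\<close>
  have feedback: "b \<xi> + A \<xi> *v ?u t + \<Delta>b \<xi> = v_s r blk off K yd t \<xi> + \<delta>"
  proof -
    have "A \<xi> *v (Ai \<xi> *v q) = q" for q
      using inv[of \<xi>] x(1)[OF \<open>t \<in> I\<close>] by (simp add: matrix_vector_mul_assoc \<xi>_def)
    then show ?thesis
      unfolding controller_def Let_def \<xi>_def[symmetric] z\<xi>[symmetric] w_def[symmetric]
      by (simp add: matrix_vector_right_distrib matrix_vector_mult_diff_distrib linear_neg[OF matrix_vector_mul_linear] \<delta>_def)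
  qed
  show ?thesis
    unfolding field
  proof (rule has_vector_derivative_componentwise_cart)
    fix k
    let ?D = "\<lambda>f. (deriv ^^ (off k - 1)) f"
    have Suc_off: "Suc (off k - 1) = off k" using off(1)[of k] by simp
    \<comment> \<open>The desired trajectory is smooth, so each row only has to supply the
      derivative of the output.\<close>
    have transfer: "((\<lambda>s. z s $ k) has_real_derivative D - (deriv ^^ off k) (yd (blk k)) t) (at t)"
      if "(?D (y (blk k)) has_real_derivative D) (at t)" for D
      by (rule deriv_eq_on_open[OF I(1) \<open>t \<in> I\<close> z_comp DERIV_diff[OF that]])
        (use yd_deriv[OF \<open>t \<in> I\<close>, of "off k - 1" "blk k", unfolded Suc_off] in auto)
    show "((\<lambda>s. z s $ k) has_real_derivative
        (A_tilde r blk off K *v z t + B_tilde r blk off *v \<delta>) $ k) (at t)"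
    proof (cases "off k = r (blk k)")
      case True
      have "(?D (y (blk k)) has_real_derivative (v_s r blk off K yd t \<xi> + \<delta>) $ blk k) (at t)"
        using y_top[OF \<open>t \<in> I\<close>, of "blk k"] feedback by (simp only: True \<xi>_def)
      from transfer[OF this] show ?thesis
        using True A_tilde_vector_mult(2)[OF lab True, of K "z t"]
        by (simp add: B_tilde_vector_mult v_s_def z\<xi>)
    next
      case False
      then have less: "off k < r (blk k)" using off(2)[of k] by simp
      then obtain k' where k': "blk k' = blk k" "off k' = Suc (off k)"
        using label[of "Suc (off k)" "blk k"] by auto
      have "(?D (y (blk k)) has_real_derivative (deriv ^^ off k) (y (blk k)) t) (at t)"
        using y_deriv[OF _ \<open>t \<in> I\<close>, of "off k - 1" "blk k"] less unfolding Suc_off by simp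
      from transfer[OF this] show ?thesis
        using False A_tilde_vector_mult(1)[OF lab less k', of K "z t"] z_comp[OF \<open>t \<in> I\<close>, of k'] k'
        by (simp add: B_tilde_vector_mult)
    qed
  qed
qed

text \<open>The first conjunct ties \<open>error_field\<close> to the plant for arbitrary estimates
  \<open>Dh\<close>, so that the stability asserted in the second concerns the actual closed
  loop.\<close>

theorem theorem3p1:
  fixes f \<Delta>f :: "real^'n \<Rightarrow> real^'n"
    and g :: "real^'n \<Rightarrow> real^'p^'n"
    and h :: "real^'n \<Rightarrow> real^'m"
    and X :: "(real^'n) set"
    and r :: "'m \<Rightarrow> nat"
    and blk :: "'n \<Rightarrow> 'm" and off :: "'n \<Rightarrow> nat"
    and \<Phi> :: "real^'n \<Rightarrow> real^'n"
    and b \<Delta>b :: "real^'n \<Rightarrow> real^'m"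
    and A :: "real^'n \<Rightarrow> real^'p^'m"
    and Ai :: "real^'n \<Rightarrow> real^'m^'p"
    and yd :: "'m \<Rightarrow> real \<Rightarrow> real" and y_init y_final :: "'m \<Rightarrow> real" and tf :: real
    and \<A> :: "('m \<Rightarrow> nat \<Rightarrow> real) set" and K :: "'m \<Rightarrow> nat \<Rightarrow> real"
    and P :: "real^'n^'n"
    and N :: "real^'m^'m \<Rightarrow> real"
    and L :: "real^'n \<Rightarrow> 'l::real_normed_vector"
    and \<Delta> :: "real^'m^'m"
  assumes "CARD('m) \<le> CARD('p)"
    and "bounded X"
    \<comment> \<open>smoothness of the plant\<close>
    and "C_around \<infinity> f X" and "\<And>j. C_around \<infinity> (\<lambda>x. column j (g x)) X" and "C_around \<infinity> h X"
    and "C_on 1 \<Delta>f X"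
    \<comment> \<open>relative degree and linearizability\<close>
    and "\<And>x. x \<in> X \<Longrightarrow> vector_relative_degree f g h r x"
    and "(\<Sum>i\<in>UNIV. r i) = CARD('n)"
    \<comment> \<open>linearizing coordinates and the functions of the nominal model\<close>
    and "block_labelling r blk off"
    and "\<Phi> = linearizing_coords f h blk off" and "diffeomorphism_on X \<Phi>"
    and "b = model_b f h r X \<Phi>" and "A = model_A f g h r X \<Phi>"
    and "\<And>\<xi>. \<xi> \<in> \<Phi> ` X \<Longrightarrow> A \<xi> ** Ai \<xi> = mat 1"
    \<comment> \<open>desired trajectories\<close>
    and "\<And>i. C_around \<infinity> (yd i) {0..}" and "0 < tf"
    and "\<And>i. yd i 0 = y_init i" and "\<And>i. yd i tf = y_final i"
    \<comment> \<open>uncertainty in the linearized model\<close>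
    and "uncertain_linearized_model f \<Delta>f g h X r blk off \<Phi> b A \<Delta>b"
    and "C_on 1 \<Delta>b (\<Phi> ` X)"
    \<comment> \<open>gains\<close>
    and "\<A> \<noteq> {}" and "\<And>\<kappa> i. \<kappa> \<in> \<A> \<Longrightarrow> hurwitz_poly (gain_poly (\<kappa> i) (r i))" and "K \<in> \<A>"
    \<comment> \<open>the Lyapunov matrix\<close>
    and "transpose P = P" and "\<And>x. x \<noteq> 0 \<Longrightarrow> 0 < x \<bullet> (P *v x)"
    and "transpose (A_tilde r blk off K) ** P + P ** A_tilde r blk off K = - mat 1"
    \<comment> \<open>the bound on the uncertainty, for a norm \<open>N\<close> on the \<open>m \<times> m\<close> matrices\<close>
    and "is_norm N" and "bounded (range L)"
    and "\<And>\<xi>. norm (\<Delta>b \<xi>) \<le> N \<Delta> * norm (L \<xi>)"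
  shows
    \<comment> \<open>whatever the estimate, motions of the plant under the controller obey \<open>z' = F(t, z, e)\<close>\<close>
    "(\<forall>I x Dh. open I \<longrightarrow> I \<subseteq> {0..} \<longrightarrow>
        plant_motion f \<Delta>f g X I x
          (\<lambda>t. controller r blk off K yd P N L b Ai t (\<Phi> (x t)) (Dh t)) \<longrightarrow>
        (let z = (\<lambda>t. \<chi> k. (deriv ^^ (off k - 1)) (\<lambda>s. h (x s) $ blk k - yd (blk k) s) t)
         in \<forall>t\<in>I. (z has_vector_derivative
              error_field r blk off K yd P N L \<Delta>b \<Delta> t (z t) (\<Delta> - Dh t)) (at t))) \<and>
     input_to_state_stable (error_field r blk off K yd P N L \<Delta>b \<Delta>) N"
proof (intro conjI allI impI)
  fix I x Dh
  assume "open I" "I \<subseteq> {0..}" and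
    "plant_motion f \<Delta>f g X I x (\<lambda>t. controller r blk off K yd P N L b Ai t (\<Phi> (x t)) (Dh t))"
  then show "let z = (\<lambda>t. \<chi> k. (deriv ^^ (off k - 1)) (\<lambda>s. h (x s) $ blk k - yd (blk k) s) t)
         in \<forall>t\<in>I. (z has_vector_derivative
              error_field r blk off K yd P N L \<Delta>b \<Delta> t (z t) (\<Delta> - Dh t)) (at t)"
    unfolding Let_def using assms(9,11,14,15,19)
    by (intro ballI closed_loop_error_dynamics)
next
  obtain m M where mM: "0 < m" "\<And>x. m * (norm x)\<^sup>2 \<le> x \<bullet> (P *v x)"
    "0 < M" "\<And>x. x \<bullet> (P *v x) \<le> M * (norm x)\<^sup>2"
    using positive_definite_bounds[of P] assms(25) by blast
  obtain C0 C1 where C: "0 \<le> C1"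
    "\<And>t z e. norm (error_field r blk off K yd P N L \<Delta>b \<Delta> t z e) \<le> (C0 + C1 * N e) * (1 + norm z)"
    by (rule error_field_growth[OF assms(27,29,28)]) blast
  show "input_to_state_stable (error_field r blk off K yd P N L \<Delta>b \<Delta>) N"
  \<comment> \<open>With \<open>k = 1/2\<close> the resulting gain function is
    \<open>\<gamma> r = sqrt (M / (2 * m)) * r\<close>, and \<open>\<beta>\<close> decays at rate
    \<open>1 / (2 * M)\<close>.\<close>
  proof (rule input_to_state_stable_quadratic_lyapunov[OF assms(27), where Q="(*v) P" and k="1/2" and m=m and M=M])
    show "x \<bullet> (P *v y) = (P *v x) \<bullet> y" for x y
      using inner_transpose_vector[of P x y] assms(24) by simp
    show "2 * ((P *v z) \<bullet> error_field r blk off K yd P N L \<Delta>b \<Delta> t z e) \<le> 1/2 * (N e)\<^sup>2 - (norm z)\<^sup>2" for t z e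
      by (rule error_field_dissipation[OF assms(24,26,27,29)])
    show "\<exists>z. z t0 = z0 \<and> filippov_solution (\<lambda>t z. error_field r blk off K yd P N L \<Delta>b \<Delta> t z (e t)) t0 {t0..} z"
      if "0 \<le> t0" "piecewise_continuous e" "bounded (e ` {0..})" for t0 e z0
      by (rule error_field_filippov_solution_exists[OF assms(27,29,28,15) that])
  qed (use mM C in \<open>auto intro: matrix_vector_mul_linear\<close>)
qed

end
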